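(* Let $\alpha,\beta,\gamma\in\mathbb{C}$ be algebraically independent over $\mathbb{Q}$. Then the set $X(\alpha,\beta,\gamma)\subset\mathcal{U}$ of solutions of the Schwarzian equation $$S_t(y)+(y')^2R_{\alpha,\beta,\gamma}(y)=0$$ is strongly minimal.
   Context: Let $(\mathcal{U},\partial)$ be a saturated (universal) differentially closed field of characteristic $0$ whose field of constants is $\mathbb{C}$; all differential fields are taken inside $\mathcal{U}$. Write $y'=\partial y=\frac{dy}{dt}$. The Schwarzian derivative is $S_t(y)=\left(\frac{y''}{y'}\right)'-\frac12\left(\frac{y''}{y'}\right)^2$, and $$R_{\alpha,\beta,\gamma}(y)=\frac12\left(\frac{1-\beta^{-2}}{y^2}+\frac{1-\gamma^{-2}}{(y-1)^2}+\frac{\beta^{-2}+\gamma^{-2}-\alpha^{-2}-1}{y(y-1)}\right).$$ $X(\alpha,\beta,\gamma)$ is the set of $y\in\mathcal{U}$ with $y'\neq 0$ satisfying the equation. "Definable" means definable in the language of differential rings $(0,1,+,\cdot,\partial)$, with parameters from $\mathcal{U}$. A definable set is strongly minimal if it is infinite and every definable subset of it is finite or co-finite. *)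

theory Defs
  imports Complex_Main "HOL-Library.Poly_Mapping" "HOL-Library.Equipollence"
begin

section \<open>Multivariate polynomials\<close>

text \<open>
  A polynomial with coefficients in \<open>'c\<close> and variables indexed by \<open>'i\<close> is a finitely
  supported map from monomials (themselves finitely supported maps from variables to
  exponents) to coefficients. The map \<open>h\<close> sends coefficients into the ring in which the
  polynomial is evaluated.
\<close>

type_synonym ('i, 'c) mpol = "('i \<Rightarrow>\<^sub>0 nat) \<Rightarrow>\<^sub>0 'c"

definition mpol_vars :: "('i, 'c::zero) mpol \<Rightarrow> 'i set" where
  "mpol_vars p = (\<Union>m\<in>Poly_Mapping.keys p. Poly_Mapping.keys m)"

definition mpol_eval ::
    "('c::zero \<Rightarrow> 'a::comm_semiring_1) \<Rightarrow> ('i \<Rightarrow> 'a) \<Rightarrow> ('i, 'c) mpol \<Rightarrow> 'a" where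
  "mpol_eval h x p =
     (\<Sum>m\<in>Poly_Mapping.keys p.
        h (Poly_Mapping.lookup p m) *
        (\<Prod>i\<in>Poly_Mapping.keys m. x i ^ Poly_Mapping.lookup m i))"

text \<open>Independence of a list as a family: repeated entries are dependent.\<close>

definition alg_indep_over_rat :: "'a::field_char_0 list \<Rightarrow> bool" where
  "alg_indep_over_rat xs \<longleftrightarrow>
     (\<forall>p :: (nat, rat) mpol. p \<noteq> 0 \<longrightarrow> mpol_vars p \<subseteq> {..<length xs} \<longrightarrow>
        mpol_eval of_rat (\<lambda>i. xs ! i) p \<noteq> 0)"


section \<open>Differentially closed fields\<close>

definition derivation :: "('u::field \<Rightarrow> 'u) \<Rightarrow> bool" where
  "derivation d \<longleftrightarrow>
     (\<forall>x y. d (x + y) = d x + d y) \<and> (\<forall>x y. d (x * y) = d x * y + x * d y)"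

definition constants :: "('u::field \<Rightarrow> 'u) \<Rightarrow> 'u set" where
  "constants d = {x. d x = 0}"

text \<open>
  A differential polynomial in one differential indeterminate \<open>X\<close> is a polynomial in the
  variables \<open>X, X', X'', \<dots>\<close>; variable number \<open>i\<close> stands for the \<open>i\<close>-th derivative of \<open>X\<close>.
  Elements of the base field have order \<open>-1\<close>.
\<close>

type_synonym 'u dpol = "(nat, 'u) mpol"

definition dpol_eval :: "('u::field \<Rightarrow> 'u) \<Rightarrow> 'u dpol \<Rightarrow> 'u \<Rightarrow> 'u" where
  "dpol_eval d p a = mpol_eval (\<lambda>c. c) (\<lambda>i. (d ^^ i) a) p"

definition dpol_order :: "'u::field dpol \<Rightarrow> int" where
  "dpol_order p = (if mpol_vars p = {} then -1 else int (Max (mpol_vars p)))"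

text \<open>Blum's axioms.\<close>

definition differentially_closed :: "('u::field_char_0 \<Rightarrow> 'u) \<Rightarrow> bool" where
  "differentially_closed d \<longleftrightarrow>
     derivation d \<and>
     (\<forall>f g :: 'u dpol. g \<noteq> 0 \<longrightarrow> dpol_order f > dpol_order g \<longrightarrow>
        (\<exists>a. dpol_eval d f a = 0 \<and> dpol_eval d g a \<noteq> 0))"


section \<open>First-order formulas in the language of differential rings\<close>

text \<open>
  The language is \<open>(0, 1, +, \<cdot>, \<partial>)\<close>, expanded by a constant symbol \<open>Par a\<close> for each
  parameter \<open>a\<close>.
\<close>

datatype (tm_params: 'u) tm =
    Var nat | Par 'u | Zero | One | Add "'u tm" "'u tm" | Mul "'u tm" "'u tm" | Der "'u tm"

datatype (fm_params: 'u) fm =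
    Equ "'u tm" "'u tm" | Neg "'u fm" | Conj "'u fm" "'u fm" | Exi nat "'u fm"

primrec tm_vars :: "'u tm \<Rightarrow> nat set" where
  "tm_vars (Var n) = {n}"
| "tm_vars (Par a) = {}"
| "tm_vars Zero = {}"
| "tm_vars One = {}"
| "tm_vars (Add s t) = tm_vars s \<union> tm_vars t"
| "tm_vars (Mul s t) = tm_vars s \<union> tm_vars t"
| "tm_vars (Der t) = tm_vars t"

primrec fm_free :: "'u fm \<Rightarrow> nat set" where
  "fm_free (Equ s t) = tm_vars s \<union> tm_vars t"
| "fm_free (Neg \<phi>) = fm_free \<phi>"
| "fm_free (Conj \<phi> \<psi>) = fm_free \<phi> \<union> fm_free \<psi>"
| "fm_free (Exi n \<phi>) = fm_free \<phi> - {n}"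

primrec tm_val :: "('u::field \<Rightarrow> 'u) \<Rightarrow> (nat \<Rightarrow> 'u) \<Rightarrow> 'u tm \<Rightarrow> 'u" where
  "tm_val d e (Var n) = e n"
| "tm_val d e (Par a) = a"
| "tm_val d e Zero = 0"
| "tm_val d e One = 1"
| "tm_val d e (Add s t) = tm_val d e s + tm_val d e t"
| "tm_val d e (Mul s t) = tm_val d e s * tm_val d e t"
| "tm_val d e (Der t) = d (tm_val d e t)"

primrec fm_sat :: "('u::field \<Rightarrow> 'u) \<Rightarrow> (nat \<Rightarrow> 'u) \<Rightarrow> 'u fm \<Rightarrow> bool" where
  "fm_sat d e (Equ s t) \<longleftrightarrow> tm_val d e s = tm_val d e t"
| "fm_sat d e (Neg \<phi>) \<longleftrightarrow> \<not> fm_sat d e \<phi>"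
| "fm_sat d e (Conj \<phi> \<psi>) \<longleftrightarrow> fm_sat d e \<phi> \<and> fm_sat d e \<psi>"
| "fm_sat d e (Exi n \<phi>) \<longleftrightarrow> (\<exists>x. fm_sat d (e(n := x)) \<phi>)"

definition unary_fms :: "'u set \<Rightarrow> 'u fm set" where
  "unary_fms A = {\<phi>. fm_free \<phi> \<subseteq> {0} \<and> fm_params \<phi> \<subseteq> A}"

text \<open>Used only for \<open>\<phi> \<in> unary_fms A\<close>, where just the value of variable \<open>0\<close> matters.\<close>

definition fm_holds :: "('u::field \<Rightarrow> 'u) \<Rightarrow> 'u fm \<Rightarrow> 'u \<Rightarrow> bool" where
  "fm_holds d \<phi> x \<longleftrightarrow> fm_sat d (\<lambda>_. x) \<phi>"

definition definable :: "('u::field \<Rightarrow> 'u) \<Rightarrow> 'u set \<Rightarrow> bool" where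
  "definable d X \<longleftrightarrow> (\<exists>\<phi>\<in>unary_fms UNIV. X = {x. fm_holds d \<phi> x})"

definition strongly_minimal :: "('u::field \<Rightarrow> 'u) \<Rightarrow> 'u set \<Rightarrow> bool" where
  "strongly_minimal d X \<longleftrightarrow>
     definable d X \<and> infinite X \<and>
     (\<forall>Y. Y \<subseteq> X \<longrightarrow> definable d Y \<longrightarrow> finite Y \<or> finite (X - Y))"

text \<open>
  Saturation in the cardinality of the structure itself; partial types in one variable
  suffice.
\<close>

definition saturated :: "('u::field \<Rightarrow> 'u) \<Rightarrow> bool" where
  "saturated d \<longleftrightarrow>
     (\<forall>A :: 'u set. \<forall>\<Sigma>. A \<prec> (UNIV :: 'u set) \<longrightarrow> \<Sigma> \<subseteq> unary_fms A \<longrightarrow>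
        (\<forall>F. finite F \<longrightarrow> F \<subseteq> \<Sigma> \<longrightarrow> (\<exists>x. \<forall>\<phi>\<in>F. fm_holds d \<phi> x)) \<longrightarrow>
        (\<exists>x. \<forall>\<phi>\<in>\<Sigma>. fm_holds d \<phi> x))"

definition constants_iso_complex :: "('u::field \<Rightarrow> 'u) \<Rightarrow> (complex \<Rightarrow> 'u) \<Rightarrow> bool" where
  "constants_iso_complex d \<iota> \<longleftrightarrow>
     \<iota> 1 = 1 \<and> (\<forall>x y. \<iota> (x + y) = \<iota> x + \<iota> y) \<and> (\<forall>x y. \<iota> (x * y) = \<iota> x * \<iota> y) \<and>
     bij_betw \<iota> UNIV (constants d)"


section \<open>The Schwarzian equation\<close>

definition schwarzian :: "('u::field_char_0 \<Rightarrow> 'u) \<Rightarrow> 'u \<Rightarrow> 'u" where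
  "schwarzian d y = d (d (d y) / d y) - 1 / 2 * (d (d y) / d y)\<^sup>2"

definition triangle_R :: "'u::field_char_0 \<Rightarrow> 'u \<Rightarrow> 'u \<Rightarrow> 'u \<Rightarrow> 'u" where
  "triangle_R \<alpha> \<beta> \<gamma> y =
     1 / 2 * ((1 - \<beta> powi (-2)) / y\<^sup>2 + (1 - \<gamma> powi (-2)) / (y - 1)\<^sup>2
              + (\<beta> powi (-2) + \<gamma> powi (-2) - \<alpha> powi (-2) - 1) / (y * (y - 1)))"

text \<open>
  The condition \<open>d y \<noteq> 0\<close> excludes the constants \<open>0\<close> and \<open>1\<close>, so no denominator vanishes on
  this set when \<open>\<alpha>, \<beta>, \<gamma>\<close> are nonzero.
\<close>

definition schwarzian_solutions :: "('u::field_char_0 \<Rightarrow> 'u) \<Rightarrow> 'u \<Rightarrow> 'u \<Rightarrow> 'u \<Rightarrow> 'u set" where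
  "schwarzian_solutions d \<alpha> \<beta> \<gamma> =
     {y. d y \<noteq> 0 \<and> schwarzian d y + (d y)\<^sup>2 * triangle_R \<alpha> \<beta> \<gamma> y = 0}"

end

theory Submission
  imports Defs
    "HOL-Computational_Algebra.Polynomial"
    "HOL-Computational_Algebra.Formal_Laurent_Series"
    "HOL-Analysis.Continuum_Not_Denumerable"
begin

text \<open>
  Write \<open>u = y'\<close>, \<open>v = y''\<close> and let \<open>R\<close> be the rational function of the equation, which then reads
  \<open>u v' = 3/2 v\<^sup>2 - u\<^sup>4 R(y)\<close>. The heart of the matter is that, over every countable differential field
  \<open>K\<close> containing \<open>1/\<alpha>, 1/\<beta>, 1/\<gamma>\<close>, a solution \<open>y\<close> that is transcendental over \<open>K\<close> has \<open>y, u, v\<close>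
  algebraically independent over \<open>K\<close>. Two such solutions \<open>y\<^sub>1, y\<^sub>2\<close> generate isomorphic differential
  fields over \<open>K\<close>, and a back-and-forth argument (\<open>fm_sat_iso\<close>, from Blum's axioms and saturation)
  shows that they satisfy the same formulas over \<open>K\<close>. A definable subset that is neither finite nor
  cofinite would separate two of them, because by saturation both the subset and its complement in the
  set of solutions contain an element transcendental over \<open>K\<close> (\<open>generic_element\<close>).

  It remains to exclude two algebraic relations. Both arguments are local computations with Puiseux
  series (\<open>newton_puiseux\<close>) followed by a count of zeros, poles or residues over the whole line.

  Order one (\<open>no_order1\<close>). Let \<open>u\<close> be algebraic over \<open>K(y)\<close>, so that the derivation is
  \<open>\<partial> + u d/dy\<close> on algebraic functions of \<open>y\<close>. Let \<open>u \<sim> c (y - a)\<^sup>r\<close> on some branch. If \<open>r < 1\<close> and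
  \<open>a \<in> {0, 1}\<close>, or if \<open>r < 0\<close>, then \<open>u d/dy\<close> dominates and the equation gives \<open>(r - 1)\<^sup>2 = \<rho>\<close>, where \<open>\<rho>\<close> is
  \<open>1/\<beta>\<^sup>2\<close> at \<open>0\<close>, \<open>1/\<gamma>\<^sup>2\<close> at \<open>1\<close> and \<open>1\<close> elsewhere. In the first two cases this contradicts
  the rationality of \<open>r\<close>, in the third it contradicts \<open>r < 0\<close>. Similarly \<open>u\<close> grows at most like \<open>y\<close> at infinity,
  because \<open>1/\<alpha>\<close> is irrational. Hence \<open>z = u / (y (y - 1))\<close> has no poles and vanishes at infinity on every branch,
  so its norm to \<open>K(y)\<close> is \<open>0\<close>, although \<open>z \<noteq> 0\<close>.

  Order two (\<open>no_order2\<close>). Let \<open>v\<close> be algebraic over \<open>K(y, u)\<close> and expand it at \<open>u = \<infinity>\<close>. Comparing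
  leading terms gives \<open>v \<sim> c u\<^sup>2\<close> with \<open>dc/dy = - c\<^sup>2/2 - R(y)\<close>. This Riccati equation holds for every
  extension of \<open>d/dy\<close> to the universe. As a derivation may be prescribed arbitrarily on a transcendental
  element (\<open>derivation_extend\<close>), \<open>c\<close> is algebraic over \<open>K(y)\<close>, say of degree \<open>n\<close>. Every branch of \<open>c\<close> has
  at most a pole of order one, with residue \<open>1 \<plusminus> 1/\<beta>\<close> at \<open>0\<close>, \<open>1 \<plusminus> 1/\<gamma>\<close> at \<open>1\<close>, \<open>0\<close> or \<open>2\<close> at
  other finite points, and behaves like \<open>(1 \<plusminus> 1/\<alpha>)/y\<close> at infinity. Summing the residues of the trace
  of \<open>c\<close> gives \<open>n + i/\<alpha> = 2 n + j/\<beta> + k/\<gamma> + 2 M\<close> with integers \<open>i, j, k\<close> and \<open>M \<ge> 0\<close>, which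
  contradicts the linear independence of \<open>1, 1/\<alpha>, 1/\<beta>, 1/\<gamma>\<close> over the rationals
  (\<open>no_algebraic_riccati\<close>).
\<close>

section \<open>Subfields, simple extensions and homomorphisms\<close>

definition is_subfield :: "'a::field set \<Rightarrow> bool" where
  "is_subfield K \<longleftrightarrow> 1 \<in> K \<and> (\<forall>x\<in>K. \<forall>y\<in>K. x - y \<in> K \<and> x * y \<in> K) \<and> (\<forall>x\<in>K. inverse x \<in> K)"

definition poly_over :: "'a::zero set \<Rightarrow> 'a poly set" where
  "poly_over K = {p. \<forall>i. coeff p i \<in> K}"

definition adjoin :: "'a::field set \<Rightarrow> 'a \<Rightarrow> 'a set" where
  "adjoin K a = {poly p a / poly q a | p q. p \<in> poly_over K \<and> q \<in> poly_over K \<and> poly q a \<noteq> 0}"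

definition alg_over :: "'a::field set \<Rightarrow> 'a \<Rightarrow> bool" where
  "alg_over K a \<longleftrightarrow> (\<exists>p\<in>poly_over K. p \<noteq> 0 \<and> poly p a = 0)"

definition hom_on :: "'a::field set \<Rightarrow> ('a \<Rightarrow> 'b::comm_ring_1) \<Rightarrow> bool" where
  "hom_on K \<sigma> \<longleftrightarrow> \<sigma> 1 = 1 \<and> (\<forall>x\<in>K. \<forall>y\<in>K. \<sigma> (x + y) = \<sigma> x + \<sigma> y \<and> \<sigma> (x * y) = \<sigma> x * \<sigma> y)"

lemma sf_one: "is_subfield K \<Longrightarrow> 1 \<in> K"
  and sf_diff: "is_subfield K \<Longrightarrow> x \<in> K \<Longrightarrow> y \<in> K \<Longrightarrow> x - y \<in> K"
  and sf_mult: "is_subfield K \<Longrightarrow> x \<in> K \<Longrightarrow> y \<in> K \<Longrightarrow> x * y \<in> K"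
  and sf_inverse: "is_subfield K \<Longrightarrow> x \<in> K \<Longrightarrow> inverse x \<in> K"
  by (auto simp: is_subfield_def)

lemma sf_zero: "is_subfield K \<Longrightarrow> 0 \<in> K"
  using sf_diff[of K 1 1] sf_one[of K] by simp

lemma sf_minus: "is_subfield K \<Longrightarrow> x \<in> K \<Longrightarrow> - x \<in> K"
  using sf_diff[of K 0 x] sf_zero[of K] by simp

lemma sf_add: "is_subfield K \<Longrightarrow> x \<in> K \<Longrightarrow> y \<in> K \<Longrightarrow> x + y \<in> K"
  using sf_diff[of K x "- y"] sf_minus[of K y] by simp

lemma sf_divide: "is_subfield K \<Longrightarrow> x \<in> K \<Longrightarrow> y \<in> K \<Longrightarrow> x / y \<in> K"
  by (simp add: divide_inverse sf_mult sf_inverse)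

lemma sf_of_nat: "is_subfield K \<Longrightarrow> of_nat n \<in> K"
  by (induction n) (auto intro: sf_zero sf_one sf_add)

lemma sf_numeral: "is_subfield K \<Longrightarrow> numeral n \<in> K"
  using sf_of_nat[of K "numeral n"] by simp

lemma sf_power: "is_subfield K \<Longrightarrow> x \<in> K \<Longrightarrow> x ^ n \<in> K"
  by (induction n) (auto intro: sf_one sf_mult)

lemma sf_sum: "is_subfield K \<Longrightarrow> (\<And>i. i \<in> A \<Longrightarrow> f i \<in> K) \<Longrightarrow> sum f A \<in> K"
  by (induction A rule: infinite_finite_induct) (auto intro: sf_zero sf_add)

lemmas sf_intros = sf_zero sf_one sf_add sf_diff sf_minus sf_mult sf_inverse sf_divide
  sf_of_nat sf_numeral sf_power sf_sum

lemma poly_overD: "p \<in> poly_over K \<Longrightarrow> coeff p i \<in> K"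
  by (auto simp: poly_over_def)

lemma poly_over_mono: "K \<subseteq> L \<Longrightarrow> p \<in> poly_over K \<Longrightarrow> p \<in> poly_over L"
  by (auto simp: poly_over_def)

lemma po_zero: "is_subfield K \<Longrightarrow> 0 \<in> poly_over K"
  by (auto simp: poly_over_def sf_zero)

lemma po_pCons_iff: "is_subfield K \<Longrightarrow> pCons c p \<in> poly_over K \<longleftrightarrow> c \<in> K \<and> p \<in> poly_over K"
  by (auto simp: poly_over_def coeff_pCons split: nat.splits)

lemma po_one: "is_subfield K \<Longrightarrow> 1 \<in> poly_over K"
  by (auto simp: one_pCons po_pCons_iff po_zero sf_one)

lemma po_add: "is_subfield K \<Longrightarrow> p \<in> poly_over K \<Longrightarrow> q \<in> poly_over K \<Longrightarrow> p + q \<in> poly_over K"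
  and po_diff: "is_subfield K \<Longrightarrow> p \<in> poly_over K \<Longrightarrow> q \<in> poly_over K \<Longrightarrow> p - q \<in> poly_over K"
  and po_minus: "is_subfield K \<Longrightarrow> p \<in> poly_over K \<Longrightarrow> - p \<in> poly_over K"
  and po_mult: "is_subfield K \<Longrightarrow> p \<in> poly_over K \<Longrightarrow> q \<in> poly_over K \<Longrightarrow> p * q \<in> poly_over K"
  and po_smult: "is_subfield K \<Longrightarrow> c \<in> K \<Longrightarrow> p \<in> poly_over K \<Longrightarrow> smult c p \<in> poly_over K"
  and po_monom: "is_subfield K \<Longrightarrow> c \<in> K \<Longrightarrow> monom c n \<in> poly_over K"
  by (auto simp: poly_over_def coeff_mult intro!: sf_intros)

lemma po_pderiv: "is_subfield K \<Longrightarrow> p \<in> poly_over K \<Longrightarrow> pderiv p \<in> poly_over K"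
  by (auto simp: poly_over_def coeff_pderiv intro!: sf_mult sf_of_nat simp del: of_nat_Suc)

lemmas po_intros = po_zero po_one po_add po_diff po_minus po_mult po_smult po_monom po_pderiv

lemma poly_over_eval: "is_subfield K \<Longrightarrow> p \<in> poly_over K \<Longrightarrow> x \<in> K \<Longrightarrow> poly p x \<in> K"
  by (induction p) (auto simp: po_pCons_iff intro!: sf_intros)

lemma adjoinI: "p \<in> poly_over K \<Longrightarrow> q \<in> poly_over K \<Longrightarrow> poly q a \<noteq> 0 \<Longrightarrow> poly p a / poly q a \<in> adjoin K a"
  by (auto simp: adjoin_def)

lemma adjoin_poly: "is_subfield K \<Longrightarrow> p \<in> poly_over K \<Longrightarrow> poly p a \<in> adjoin K a"
  using adjoinI[of p K 1 a] by (simp add: po_one)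

lemma adjoin_base: "is_subfield K \<Longrightarrow> x \<in> K \<Longrightarrow> x \<in> adjoin K a"
  using adjoin_poly[of K "[:x:]" a] by (simp add: po_pCons_iff po_zero)

lemma adjoin_gen: "is_subfield K \<Longrightarrow> a \<in> adjoin K a"
  using adjoin_poly[of K "[:0,1:]" a] by (simp add: po_pCons_iff po_zero sf_zero sf_one)

lemma is_subfield_adjoin:
  assumes K: "is_subfield K"
  shows "is_subfield (adjoin K a)"
  unfolding is_subfield_def
proof (intro conjI ballI)
  show "1 \<in> adjoin K a" by (intro adjoin_base K sf_one)
next
  fix x y assume "x \<in> adjoin K a" "y \<in> adjoin K a"
  then obtain p q r s where x: "x = poly p a / poly q a" "p \<in> poly_over K" "q \<in> poly_over K" "poly q a \<noteq> 0"
    and y: "y = poly r a / poly s a" "r \<in> poly_over K" "s \<in> poly_over K" "poly s a \<noteq> 0"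
    unfolding adjoin_def by blast
  have "x - y = poly (p * s - r * q) a / poly (q * s) a"
    unfolding x(1) y(1) using x(4) y(4) by (simp add: field_simps)
  then show "x - y \<in> adjoin K a"
    using x y by (simp only:) (intro adjoinI po_intros K, auto)
  have "x * y = poly (p * r) a / poly (q * s) a"
    unfolding x(1) y(1) by simp
  then show "x * y \<in> adjoin K a"
    using x y by (simp only:) (intro adjoinI po_intros K, auto)
next
  fix x assume "x \<in> adjoin K a"
  then obtain p q where x: "x = poly p a / poly q a" "p \<in> poly_over K" "q \<in> poly_over K" "poly q a \<noteq> 0"
    unfolding adjoin_def by blast
  show "inverse x \<in> adjoin K a"
  proof (cases "poly p a = 0")
    case True
    then show ?thesis using x by (simp add: adjoin_base K sf_zero)
  next
    case False
    then show ?thesis using x adjoinI[of q K p a] by simp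
  qed
qed

lemma hom_one: "hom_on K \<sigma> \<Longrightarrow> \<sigma> 1 = 1"
  and hom_add: "hom_on K \<sigma> \<Longrightarrow> x \<in> K \<Longrightarrow> y \<in> K \<Longrightarrow> \<sigma> (x + y) = \<sigma> x + \<sigma> y"
  and hom_mult: "hom_on K \<sigma> \<Longrightarrow> x \<in> K \<Longrightarrow> y \<in> K \<Longrightarrow> \<sigma> (x * y) = \<sigma> x * \<sigma> y"
  by (auto simp: hom_on_def)

lemma hom_zero: "is_subfield K \<Longrightarrow> hom_on K \<sigma> \<Longrightarrow> \<sigma> 0 = 0"
  using hom_add[of K \<sigma> 0 0] sf_zero[of K] by simp

lemma hom_minus: "is_subfield K \<Longrightarrow> hom_on K \<sigma> \<Longrightarrow> x \<in> K \<Longrightarrow> \<sigma> (- x) = - \<sigma> x"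
  using hom_add[of K \<sigma> x "- x"] by (simp add: hom_zero sf_minus eq_neg_iff_add_eq_0 add.commute)

lemma hom_diff: "is_subfield K \<Longrightarrow> hom_on K \<sigma> \<Longrightarrow> x \<in> K \<Longrightarrow> y \<in> K \<Longrightarrow> \<sigma> (x - y) = \<sigma> x - \<sigma> y"
  using hom_add[of K \<sigma> x "- y"] by (simp add: hom_minus sf_minus)

lemma hom_power: "is_subfield K \<Longrightarrow> hom_on K \<sigma> \<Longrightarrow> x \<in> K \<Longrightarrow> \<sigma> (x ^ n) = \<sigma> x ^ n"
  by (induction n) (simp_all add: hom_one hom_mult sf_power)

lemma hom_of_nat: "is_subfield K \<Longrightarrow> hom_on K \<sigma> \<Longrightarrow> \<sigma> (of_nat n) = of_nat n"
  by (induction n) (simp_all add: hom_zero hom_one hom_add sf_of_nat sf_one)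

lemma hom_numeral: "is_subfield K \<Longrightarrow> hom_on K \<sigma> \<Longrightarrow> \<sigma> (numeral n) = numeral n"
  using hom_of_nat[of K \<sigma> "numeral n"] by simp

lemma hom_sum: "is_subfield K \<Longrightarrow> hom_on K \<sigma> \<Longrightarrow> (\<And>i. i \<in> A \<Longrightarrow> f i \<in> K) \<Longrightarrow> \<sigma> (sum f A) = (\<Sum>i\<in>A. \<sigma> (f i))"
  by (induction A rule: infinite_finite_induct) (simp_all add: hom_zero hom_add sf_sum)

lemma hom_eq_0_iff:
  assumes "is_subfield K" "hom_on K \<sigma>" "x \<in> K"
  shows "\<sigma> x = 0 \<longleftrightarrow> x = 0"
proof
  assume 0: "\<sigma> x = 0"
  show "x = 0"
  proof (rule ccontr)
    assume "x \<noteq> 0"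
    then have "\<sigma> (x * inverse x) = 1" using assms by (simp add: hom_one)
    then show False using hom_mult[OF assms(2,3) sf_inverse[OF assms(1,3)]] 0 by simp
  qed
qed (use assms in \<open>simp add: hom_zero\<close>)

lemma hom_inverse:
  fixes \<sigma> :: "'a::field \<Rightarrow> 'b::field"
  assumes "is_subfield K" "hom_on K \<sigma>" "x \<in> K"
  shows "\<sigma> (inverse x) = inverse (\<sigma> x)"
proof (cases "x = 0")
  case False
  then have "\<sigma> (x * inverse x) = 1" using assms by (simp add: hom_one)
  then show ?thesis using hom_mult[OF assms(2,3) sf_inverse[OF assms(1,3)]]
    by (metis inverse_unique)
qed (use assms in \<open>simp add: hom_zero\<close>)

lemma hom_divide:
  fixes \<sigma> :: "'a::field \<Rightarrow> 'b::field"
  shows "is_subfield K \<Longrightarrow> hom_on K \<sigma> \<Longrightarrow> x \<in> K \<Longrightarrow> y \<in> K \<Longrightarrow> \<sigma> (x / y) = \<sigma> x / \<sigma> y"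
  by (simp add: divide_inverse hom_mult hom_inverse sf_inverse)

lemma hom_inj: "is_subfield K \<Longrightarrow> hom_on K \<sigma> \<Longrightarrow> inj_on \<sigma> K"
proof (rule inj_onI)
  fix x y assume a: "is_subfield K" "hom_on K \<sigma>" "x \<in> K" "y \<in> K" "\<sigma> x = \<sigma> y"
  then have "\<sigma> (x - y) = 0" by (simp add: hom_diff)
  then show "x = y" using hom_eq_0_iff[OF a(1,2) sf_diff[OF a(1,3,4)]] by simp
qed

lemma hom_on_subset: "hom_on L \<sigma> \<Longrightarrow> K \<subseteq> L \<Longrightarrow> hom_on K \<sigma>"
  by (auto simp: hom_on_def)

lemma hom_coeff: "is_subfield K \<Longrightarrow> hom_on K \<sigma> \<Longrightarrow> coeff (map_poly \<sigma> p) i = \<sigma> (coeff p i)"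
  by (simp add: coeff_map_poly hom_zero)

lemma hom_map_pCons: "is_subfield K \<Longrightarrow> hom_on K \<sigma> \<Longrightarrow> map_poly \<sigma> (pCons c p) = pCons (\<sigma> c) (map_poly \<sigma> p)"
  by (simp add: map_poly_pCons hom_zero)

lemma hom_map_add: "is_subfield K \<Longrightarrow> hom_on K \<sigma> \<Longrightarrow> p \<in> poly_over K \<Longrightarrow> q \<in> poly_over K \<Longrightarrow>
    map_poly \<sigma> (p + q) = map_poly \<sigma> p + map_poly \<sigma> q"
  by (rule poly_eqI) (simp add: hom_coeff hom_add poly_overD)

lemma hom_map_diff: "is_subfield K \<Longrightarrow> hom_on K \<sigma> \<Longrightarrow> p \<in> poly_over K \<Longrightarrow> q \<in> poly_over K \<Longrightarrow>
    map_poly \<sigma> (p - q) = map_poly \<sigma> p - map_poly \<sigma> q"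
  by (rule poly_eqI) (simp add: hom_coeff hom_diff poly_overD)

lemma hom_map_mult: "is_subfield K \<Longrightarrow> hom_on K \<sigma> \<Longrightarrow> p \<in> poly_over K \<Longrightarrow> q \<in> poly_over K \<Longrightarrow>
    map_poly \<sigma> (p * q) = map_poly \<sigma> p * map_poly \<sigma> q"
  by (rule poly_eqI) (simp add: hom_coeff coeff_mult hom_sum hom_mult poly_overD sf_mult)

lemma hom_map_one: "is_subfield K \<Longrightarrow> hom_on K \<sigma> \<Longrightarrow> map_poly \<sigma> 1 = 1"
  by (rule poly_eqI) (simp add: hom_coeff hom_zero hom_one)

lemma hom_eval: "is_subfield K \<Longrightarrow> hom_on K \<sigma> \<Longrightarrow> p \<in> poly_over K \<Longrightarrow> x \<in> K \<Longrightarrow>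
    poly (map_poly \<sigma> p) (\<sigma> x) = \<sigma> (poly p x)"
  by (induction p) (simp_all add: hom_zero hom_map_pCons po_pCons_iff hom_add hom_mult sf_mult poly_over_eval)

lemma hom_map_eq_0_iff: "is_subfield K \<Longrightarrow> hom_on K \<sigma> \<Longrightarrow> p \<in> poly_over K \<Longrightarrow> map_poly \<sigma> p = 0 \<longleftrightarrow> p = 0"
  by (auto simp: poly_eq_iff hom_coeff hom_eq_0_iff poly_overD)

lemma hom_degree: "is_subfield K \<Longrightarrow> hom_on K \<sigma> \<Longrightarrow> p \<in> poly_over K \<Longrightarrow> degree (map_poly \<sigma> p) = degree p"
  by (rule antisym, rule degree_le, simp add: hom_coeff hom_zero coeff_eq_0, cases "p = 0")
    (auto intro!: le_degree simp: hom_coeff hom_eq_0_iff poly_overD)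

text \<open>
  Evaluating at \<open>b\<close> is well defined on \<open>K(a)\<close> as soon as every polynomial vanishing at \<open>a\<close>
  vanishes at \<open>b\<close> and every other one becomes a unit. The target is a mere ring so that
  dual numbers are covered, for which homomorphisms are derivations.
\<close>

lemma hom_extend:
  fixes \<sigma> :: "'a::field \<Rightarrow> 'b::comm_ring_1"
  assumes K: "is_subfield K" and \<sigma>: "hom_on K \<sigma>"
    and zero: "\<And>p. p \<in> poly_over K \<Longrightarrow> poly p a = 0 \<Longrightarrow> poly (map_poly \<sigma> p) b = 0"
    and unit: "\<And>p. p \<in> poly_over K \<Longrightarrow> poly p a \<noteq> 0 \<Longrightarrow> poly (map_poly \<sigma> p) b dvd 1"
  obtains \<tau> where "hom_on (adjoin K a) \<tau>" "\<And>x. x \<in> K \<Longrightarrow> \<tau> x = \<sigma> x" "\<tau> a = b"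
proof -
  let ?ev = "\<lambda>p. poly (map_poly \<sigma> p) b"
  define \<tau> where "\<tau> x = (SOME z. \<exists>p q. p \<in> poly_over K \<and> q \<in> poly_over K \<and> poly q a \<noteq> 0 \<and>
      x = poly p a / poly q a \<and> z * ?ev q = ?ev p)" for x
  have ev_add: "?ev (p + q) = ?ev p + ?ev q" and ev_mult: "?ev (p * q) = ?ev p * ?ev q"
    and ev_diff: "?ev (p - q) = ?ev p - ?ev q"
    if "p \<in> poly_over K" "q \<in> poly_over K" for p q
    using that by (simp_all add: hom_map_add[OF K \<sigma>] hom_map_mult[OF K \<sigma>] hom_map_diff[OF K \<sigma>])
  have cancel: "x = y" if "x * ?ev q = y * ?ev q" "q \<in> poly_over K" "poly q a \<noteq> 0" for x y q
  proof -
    from unit[OF that(2,3)] obtain w where w: "1 = ?ev q * w" by (auto simp: dvd_def)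
    have "x * (?ev q * w) = y * (?ev q * w)" using that(1) by (simp add: mult.assoc[symmetric])
    then show ?thesis using w by simp
  qed
  have \<tau>_eq: "\<tau> x * ?ev q = ?ev p"
    if "p \<in> poly_over K" "q \<in> poly_over K" "poly q a \<noteq> 0" "x = poly p a / poly q a" for x p q
  proof -
    from unit[OF that(2,3)] obtain w where w: "1 = ?ev q * w" by (auto simp: dvd_def)
    have "(?ev p * w) * ?ev q = ?ev p" using w by (metis mult.assoc mult.commute mult_1_right)
    then have "\<exists>z. \<exists>p q. p \<in> poly_over K \<and> q \<in> poly_over K \<and> poly q a \<noteq> 0 \<and>
      x = poly p a / poly q a \<and> z * ?ev q = ?ev p" using that by blast
    from someI_ex[OF this] obtain r s where rs: "r \<in> poly_over K" "s \<in> poly_over K" "poly s a \<noteq> 0"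
      "x = poly r a / poly s a" "\<tau> x * ?ev s = ?ev r" unfolding \<tau>_def by blast
    have "poly (p * s - r * q) a = 0" using that rs by (simp add: frac_eq_eq)
    then have "?ev (p * s - r * q) = 0" by (intro zero po_intros K that rs)
    then have "?ev p * ?ev s = ?ev r * ?ev q"
      using that rs by (simp add: ev_diff ev_mult po_mult K)
    moreover have "(\<tau> x * ?ev q) * ?ev s = (\<tau> x * ?ev s) * ?ev q" by (simp only: mult_ac)
    ultimately have "(\<tau> x * ?ev q) * ?ev s = ?ev p * ?ev s" using rs(5) by simp
    then show ?thesis using cancel rs by blast
  qed
  have poly\<tau>: "\<tau> (poly p a) = ?ev p" if "p \<in> poly_over K" for p
    using \<tau>_eq[of p 1 "poly p a"] that by (simp add: po_one K hom_map_one[OF K \<sigma>])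
  have c: "\<tau> x = \<sigma> x" if "x \<in> K" for x
    using poly\<tau>[of "[:x:]"] that by (simp add: po_pCons_iff K po_zero hom_map_pCons[OF K \<sigma>])
  have "\<tau> a = b"
    using poly\<tau>[of "[:0,1:]"] by (simp add: po_pCons_iff K po_zero sf_zero sf_one hom_map_pCons[OF K \<sigma>] hom_one[OF \<sigma>] hom_zero[OF K \<sigma>])
  moreover have "hom_on (adjoin K a) \<tau>"
    unfolding hom_on_def
  proof (intro conjI ballI)
    show "\<tau> 1 = 1" using c[of 1] by (simp add: sf_one K hom_one[OF \<sigma>])
  next
    fix x y assume "x \<in> adjoin K a" "y \<in> adjoin K a"
    then obtain p q r s where x: "x = poly p a / poly q a" "p \<in> poly_over K" "q \<in> poly_over K" "poly q a \<noteq> 0"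
      and y: "y = poly r a / poly s a" "r \<in> poly_over K" "s \<in> poly_over K" "poly s a \<noteq> 0"
      unfolding adjoin_def by blast
    have qs: "q * s \<in> poly_over K" "poly (q * s) a \<noteq> 0" using x y by (auto intro: po_mult K)
    have ex: "\<tau> x * ?ev q = ?ev p" using \<tau>_eq x by blast
    have ey: "\<tau> y * ?ev s = ?ev r" using \<tau>_eq y by blast
    have e: "\<tau> (x + y) * ?ev (q * s) = ?ev (p * s + r * q)"
    proof (rule \<tau>_eq)
      show "x + y = poly (p * s + r * q) a / poly (q * s) a"
        unfolding x(1) y(1) using x(4) y(4) by (simp add: field_simps)
    qed (use x y qs in \<open>auto intro!: po_intros K\<close>)
    have "(\<tau> x + \<tau> y) * ?ev (q * s) = (\<tau> x * ?ev q) * ?ev s + (\<tau> y * ?ev s) * ?ev q"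
      using x y by (simp add: ev_mult algebra_simps)
    also have "\<dots> = \<tau> (x + y) * ?ev (q * s)"
      unfolding e ex ey using x y by (simp add: ev_mult ev_add po_mult K)
    finally show "\<tau> (x + y) = \<tau> x + \<tau> y" using cancel[OF _ qs] by metis
    have e: "\<tau> (x * y) * ?ev (q * s) = ?ev (p * r)"
    proof (rule \<tau>_eq)
      show "x * y = poly (p * r) a / poly (q * s) a" unfolding x(1) y(1) by simp
    qed (use x y qs in \<open>auto intro!: po_intros K\<close>)
    have "(\<tau> x * \<tau> y) * ?ev (q * s) = (\<tau> x * ?ev q) * (\<tau> y * ?ev s)"
      using x y by (simp add: ev_mult algebra_simps)
    also have "\<dots> = \<tau> (x * y) * ?ev (q * s)"
      unfolding e ex ey using x y by (simp add: ev_mult)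
    finally show "\<tau> (x * y) = \<tau> x * \<tau> y" using cancel[OF _ qs] by metis
  qed
  ultimately show ?thesis using c that by blast
qed

lemma hom_extend_transcendental:
  fixes \<sigma> :: "'a::field \<Rightarrow> 'b::field"
  assumes K: "is_subfield K" and \<sigma>: "hom_on K \<sigma>" and a: "\<not> alg_over K a"
    and b: "\<And>p. p \<in> poly_over K \<Longrightarrow> p \<noteq> 0 \<Longrightarrow> poly (map_poly \<sigma> p) b \<noteq> 0"
  obtains \<tau> where "hom_on (adjoin K a) \<tau>" "\<And>x. x \<in> K \<Longrightarrow> \<tau> x = \<sigma> x" "\<tau> a = b"
proof (rule hom_extend[OF K \<sigma>, of a b])
  fix p assume p: "p \<in> poly_over K"
  show "poly (map_poly \<sigma> p) b = 0" if "poly p a = 0"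
    using a p that by (auto simp: alg_over_def)
  show "poly (map_poly \<sigma> p) b dvd 1" if "poly p a \<noteq> 0"
    using b[OF p] that by (force simp: dvd_field_iff)
qed (use that in blast)

section \<open>Minimal polynomials\<close>

lemma poly_over_divide:
  assumes K: "is_subfield K" and g: "g \<in> poly_over K" "lead_coeff g = 1"
  shows "f \<in> poly_over K \<Longrightarrow> \<exists>q\<in>poly_over K. \<exists>r\<in>poly_over K. f = g * q + r \<and> (r = 0 \<or> degree r < degree g)"
proof (induction "degree f" arbitrary: f rule: less_induct)
  case less
  show ?case
  proof (cases "f = 0 \<or> degree f < degree g")
    case True
    then show ?thesis using less.prems by (intro bexI[of _ 0] bexI[of _ f]) (auto intro: po_zero K)
  next
    case False
    define h where "h = monom (lead_coeff f) (degree f - degree g)"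
    have h: "h \<in> poly_over K" unfolding h_def by (intro po_intros K poly_overD less.prems)
    have f': "f - g * h \<in> poly_over K" by (intro po_intros K h less.prems g)
    have dh: "degree h = degree f - degree g" using False by (simp add: h_def degree_monom_eq)
    have h0: "h \<noteq> 0" using False by (simp add: h_def)
    have g0: "g \<noteq> 0" using g by auto
    have dsum: "degree g + degree h = degree f" using False by (simp add: dh)
    have deq: "degree (g * h) = degree f" using h0 g0 dsum by (simp add: degree_mult_eq)
    have "lead_coeff h = lead_coeff f" unfolding h_def by (rule lead_coeff_monom)
    then have lc: "coeff (g * h) (degree f) = lead_coeff f"
      using coeff_mult_degree_sum[of g h] g(2) unfolding dsum by simp
    have "f - g * h = 0 \<or> degree (f - g * h) < degree f"
    proof (cases "degree f = 0")
      case True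
      then have "degree (f - g * h) = 0" using deq degree_diff_le[of f 0 "g*h"] by simp
      then show ?thesis using lc True
        by (metis coeff_diff diff_self leading_coeff_0_iff)
    next
      case False
      have "degree (f - g * h) \<le> degree f" using deq degree_diff_le[of f "degree f" "g*h"] by simp
      moreover have "coeff (f - g * h) (degree f) = 0" using lc by simp
      ultimately show ?thesis by (metis False le_neq_implies_less leading_coeff_0_iff)
    qed
    then obtain q r where "q \<in> poly_over K" "r \<in> poly_over K" "f - g * h = g * q + r" "r = 0 \<or> degree r < degree g"
    proof
      assume "f - g * h = 0" then show ?thesis using that[of 0 0] by (auto intro: po_zero K)
    next
      assume "degree (f - g * h) < degree f"
      from less.hyps[OF this f'] show ?thesis using that by blast
    qed
    then show ?thesis using h by (intro bexI[of _ "h + q"] bexI[of _ r]) (auto simp: algebra_simps intro: po_add K)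
  qed
qed

text \<open>An element of least degree, made monic, generates the ideal.\<close>

lemma poly_over_principal:
  assumes K: "is_subfield K" and I: "I \<subseteq> poly_over K" "f0 \<in> I" "f0 \<noteq> 0"
    and diff: "\<And>f g. f \<in> I \<Longrightarrow> g \<in> I \<Longrightarrow> f - g \<in> I"
    and mult: "\<And>f g. f \<in> I \<Longrightarrow> g \<in> poly_over K \<Longrightarrow> f * g \<in> I"
  obtains g where "g \<in> I" "lead_coeff g = 1" "\<And>f. f \<in> I \<Longrightarrow> \<exists>q\<in>poly_over K. f = g * q"
proof -
  obtain g1 where g1: "g1 \<in> I" "g1 \<noteq> 0" and min: "\<And>f. f \<in> I \<Longrightarrow> f \<noteq> 0 \<Longrightarrow> degree g1 \<le> degree f"
    using ex_has_least_nat[of "\<lambda>f. f \<in> I \<and> f \<noteq> 0" f0 degree] I by blast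
  define g where "g = g1 * [:inverse (lead_coeff g1):]"
  have c: "[:inverse (lead_coeff g1):] \<in> poly_over K"
    using g1 I by (auto simp: po_pCons_iff K po_zero intro!: sf_inverse poly_overD)
  have g: "g \<in> I" unfolding g_def by (intro mult g1 c)
  have lc: "lead_coeff g = 1" and dg: "degree g = degree g1"
    using g1 by (simp_all add: g_def mult.commute[of g1])
  have gK: "g \<in> poly_over K" using g I by blast
  have "\<exists>q\<in>poly_over K. f = g * q" if f: "f \<in> I" for f
  proof -
    from poly_over_divide[OF K gK lc, of f] f I obtain q r
      where qr: "q \<in> poly_over K" "r \<in> poly_over K" "f = g * q + r" "r = 0 \<or> degree r < degree g" by blast
    have "r \<in> I" using diff[OF f mult[OF g qr(1)]] qr(3) by simp
    then have "r = 0" using min qr(4) dg by (metis leD)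
    then show ?thesis using qr by auto
  qed
  then show ?thesis using g lc that by blast
qed

text \<open>
  The Bezout clause expresses irreducibility without mentioning factorisations; it survives the
  passage to another field along a homomorphism.
\<close>

definition is_minpoly :: "'a::field set \<Rightarrow> 'a \<Rightarrow> 'a poly \<Rightarrow> bool" where
  "is_minpoly K a m \<longleftrightarrow> m \<in> poly_over K \<and> lead_coeff m = 1 \<and> poly m a = 0 \<and>
     (\<forall>p\<in>poly_over K. poly p a = 0 \<longrightarrow> (\<exists>q\<in>poly_over K. p = m * q)) \<and>
     (\<forall>p\<in>poly_over K. poly p a \<noteq> 0 \<longrightarrow> (\<exists>s\<in>poly_over K. \<exists>t\<in>poly_over K. s * p + t * m = 1)) \<and>
     poly (pderiv m) a \<noteq> 0"

text \<open>
  The monic generator \<open>g\<close> of the ideal of \<open>p\<close> and \<open>m\<close> does not vanish at \<open>a\<close>, so the cofactor \<open>m / g\<close>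
  does and has the full degree of \<open>m\<close>; hence \<open>g = 1\<close>.
\<close>

lemma minpoly_exists:
  fixes a :: "'a::field_char_0"
  assumes K: "is_subfield K" and a: "alg_over K a"
  obtains m where "is_minpoly K a m"
proof -
  define I where "I = {p \<in> poly_over K. poly p a = 0}"
  from a obtain f0 where f0: "f0 \<in> I" "f0 \<noteq> 0" by (auto simp: alg_over_def I_def)
  obtain m where m: "m \<in> I" "lead_coeff m = 1" and gen: "\<And>f. f \<in> I \<Longrightarrow> \<exists>q\<in>poly_over K. f = m * q"
    by (rule poly_over_principal[OF K, of I f0]) (use f0 in \<open>auto simp: I_def intro: po_intros K\<close>)
  have mK: "m \<in> poly_over K" and m0: "poly m a = 0" using m by (auto simp: I_def)
  have mnz: "m \<noteq> 0" using m by auto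
  have dm: "degree m > 0"
  proof (rule ccontr)
    assume "\<not> degree m > 0"
    then obtain c where "m = [:c:]" by (metis degree_eq_zeroE gr0I)
    then show False using m0 mnz by simp
  qed
  have smaller: "degree f \<ge> degree m" if "f \<in> poly_over K" "poly f a = 0" "f \<noteq> 0" for f
  proof -
    from gen[of f] that obtain q where "f = m * q" by (auto simp: I_def)
    then show ?thesis using that mnz by (auto simp: degree_mult_eq)
  qed
  have bez: "\<exists>s\<in>poly_over K. \<exists>t\<in>poly_over K. s * p + t * m = 1" if p: "p \<in> poly_over K" "poly p a \<noteq> 0" for p
  proof -
    define J where "J = {s * p + t * m | s t. s \<in> poly_over K \<and> t \<in> poly_over K}"
    have pJ: "p \<in> J" unfolding J_def by (rule CollectI, rule exI[of _ 1], rule exI[of _ 0]) (auto intro: po_intros K)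
    have mJ: "m \<in> J" unfolding J_def by (rule CollectI, rule exI[of _ 0], rule exI[of _ 1]) (auto intro: po_intros K)
    obtain g where g: "g \<in> J" "lead_coeff g = 1" and geng: "\<And>f. f \<in> J \<Longrightarrow> \<exists>q\<in>poly_over K. f = g * q"
    proof (rule poly_over_principal[OF K, of J p])
      show "J \<subseteq> poly_over K" unfolding J_def using p mK by (auto intro: po_intros K)
      show "p \<in> J" by fact
      show "p \<noteq> 0" using p by auto
    next
      fix f h assume "f \<in> J" "h \<in> J"
      then obtain s t s' t' where "f = s * p + t * m" "h = s' * p + t' * m"
        "s \<in> poly_over K" "t \<in> poly_over K" "s' \<in> poly_over K" "t' \<in> poly_over K"
        unfolding J_def by blast
      then show "f - h \<in> J" unfolding J_def
        by (intro CollectI exI[of _ "s - s'"] exI[of _ "t - t'"]) (auto simp: algebra_simps intro: po_intros K)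
    next
      fix f h assume "f \<in> J" "h \<in> poly_over K"
      moreover from this obtain s t where "f = s * p + t * m" "s \<in> poly_over K" "t \<in> poly_over K"
        unfolding J_def by blast
      ultimately show "f * h \<in> J" unfolding J_def
        by (intro CollectI exI[of _ "s * h"] exI[of _ "t * h"]) (auto simp: algebra_simps intro: po_intros K)
    qed (use that in blast)
    from geng[OF pJ] obtain q1 where q1: "p = g * q1" by blast
    from geng[OF mJ] obtain q2 where q2: "q2 \<in> poly_over K" "m = g * q2" by blast
    have ga: "poly g a \<noteq> 0" using q1 p by auto
    have "poly q2 a = 0" using q2 m0 ga by simp
    then have "degree q2 \<ge> degree m" using smaller[of q2] q2 mnz by auto
    moreover have "degree m = degree g + degree q2" using q2 mnz by (auto simp: degree_mult_eq)
    ultimately have "degree g = 0" by simp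
    then have "g = 1" using g(2) by (metis degree_eq_zeroE lead_coeff_pCons(2) one_pCons)
    then show ?thesis using g(1) unfolding J_def by auto
  qed
  have "poly (pderiv m) a \<noteq> 0"
  proof
    assume "poly (pderiv m) a = 0"
    moreover have "pderiv m \<noteq> 0" using dm by (simp add: pderiv_eq_0_iff)
    ultimately have "degree (pderiv m) \<ge> degree m" using smaller po_pderiv[OF K mK] by blast
    then show False using dm by (simp add: degree_pderiv)
  qed
  then have "is_minpoly K a m"
    unfolding is_minpoly_def using mK m m0 gen bez by (auto simp: I_def)
  then show ?thesis by (rule that)
qed

lemma minpoly_degree: "is_minpoly K a m \<Longrightarrow> degree m > 0"
proof (rule ccontr)
  assume m: "is_minpoly K a m" and "\<not> degree m > 0"
  then obtain c where "m = [:c:]" by (metis degree_eq_zeroE gr0I)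
  then show False using m by (simp add: is_minpoly_def)
qed

text \<open>A Bezout relation between \<open>p\<close> and \<open>m\<close> over \<open>K\<close> makes the image of \<open>p\<close> invertible at \<open>b\<close>.\<close>

lemma hom_extend_algebraic:
  fixes \<sigma> :: "'a::field \<Rightarrow> 'b::field"
  assumes K: "is_subfield K" and \<sigma>: "hom_on K \<sigma>" and m: "is_minpoly K a m"
    and b: "poly (map_poly \<sigma> m) b = 0"
  obtains \<tau> where "hom_on (adjoin K a) \<tau>" "\<And>x. x \<in> K \<Longrightarrow> \<tau> x = \<sigma> x" "\<tau> a = b"
proof (rule hom_extend[OF K \<sigma>, of a b])
  fix p assume p: "p \<in> poly_over K"
  have mK: "m \<in> poly_over K" using m by (simp add: is_minpoly_def)
  show "poly (map_poly \<sigma> p) b = 0" if "poly p a = 0"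
  proof -
    from m p that obtain q where "q \<in> poly_over K" "p = m * q" unfolding is_minpoly_def by blast
    then show ?thesis using b mK by (simp add: hom_map_mult[OF K \<sigma>])
  qed
  show "poly (map_poly \<sigma> p) b dvd 1" if "poly p a \<noteq> 0"
  proof -
    from m p that obtain s t where st: "s \<in> poly_over K" "t \<in> poly_over K" "s * p + t * m = 1"
      unfolding is_minpoly_def by blast
    have "map_poly \<sigma> (s * p + t * m) = map_poly \<sigma> s * map_poly \<sigma> p + map_poly \<sigma> t * map_poly \<sigma> m"
      using st(1,2) p mK by (simp add: hom_map_mult[OF K \<sigma>] hom_map_add[OF K \<sigma>] po_mult K)
    then have "poly (map_poly \<sigma> (s * p + t * m)) b = poly (map_poly \<sigma> s) b * poly (map_poly \<sigma> p) b"
      using b by simp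
    then have "poly (map_poly \<sigma> s) b * poly (map_poly \<sigma> p) b = 1"
      unfolding st(3) by (simp add: hom_map_one[OF K \<sigma>])
    then show ?thesis by (metis dvd_triv_right)
  qed
qed (use that in blast)

section \<open>Derivations along a homomorphism\<close>

definition deriv_along :: "'a::field set \<Rightarrow> ('a \<Rightarrow> 'b::comm_ring_1) \<Rightarrow> ('a \<Rightarrow> 'b) \<Rightarrow> bool" where
  "deriv_along K \<sigma> \<Delta> \<longleftrightarrow> (\<forall>x\<in>K. \<forall>y\<in>K. \<Delta> (x + y) = \<Delta> x + \<Delta> y \<and> \<Delta> (x * y) = \<Delta> x * \<sigma> y + \<sigma> x * \<Delta> y)"

lemma deriv_along_poly:
  assumes K: "is_subfield K" and L: "is_subfield L" "K \<subseteq> L" "a \<in> L"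
    and \<sigma>: "hom_on L \<sigma>" and \<Delta>: "deriv_along L \<sigma> \<Delta>" and \<Delta>K: "\<And>x. x \<in> K \<Longrightarrow> \<Delta> x = 0"
  shows "p \<in> poly_over K \<Longrightarrow> \<Delta> (poly p a) = \<sigma> (poly (pderiv p) a) * \<Delta> a"
proof (induction p)
  case 0
  then show ?case using \<Delta>K[OF sf_zero[OF K]] by (simp add: hom_zero[OF L(1) \<sigma>])
next
  case (pCons c p)
  have c: "c \<in> L" "\<Delta> c = 0" and p: "p \<in> poly_over K" using pCons.prems L \<Delta>K by (auto simp: po_pCons_iff K)
  have pL: "p \<in> poly_over L" by (rule poly_over_mono[OF L(2) p])
  have pa: "poly p a \<in> L" "poly (pderiv p) a \<in> L"
    by (intro poly_over_eval po_pderiv L pL)+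
  have "\<Delta> (poly (pCons c p) a) = \<Delta> a * \<sigma> (poly p a) + \<sigma> a * (\<sigma> (poly (pderiv p) a) * \<Delta> a)"
    using \<Delta> c pa L pCons.IH[OF p] by (simp add: deriv_along_def sf_mult)
  also have "\<dots> = \<sigma> (poly (pderiv (pCons c p)) a) * \<Delta> a"
    using pa L by (simp add: pderiv_pCons hom_add[OF \<sigma>] hom_mult[OF \<sigma>] sf_mult algebra_simps)
  finally show ?case .
qed

text \<open>If \<open>a\<close> is algebraic, applying \<open>\<Delta>\<close> to \<open>m(a) = 0\<close> gives \<open>\<Delta> a = 0\<close>, since \<open>m\<close> is separable.\<close>

lemma deriv_along_zero:
  fixes \<sigma> :: "'a::field_char_0 \<Rightarrow> 'b::idom"
  assumes K: "is_subfield K" and \<sigma>: "hom_on (adjoin K a) \<sigma>" and \<Delta>: "deriv_along (adjoin K a) \<sigma> \<Delta>"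
    and \<Delta>K: "\<And>x. x \<in> K \<Longrightarrow> \<Delta> x = 0" and a: "alg_over K a \<or> \<Delta> a = 0"
    and x: "x \<in> adjoin K a"
  shows "\<Delta> x = 0"
proof -
  let ?L = "adjoin K a"
  have L: "is_subfield ?L" "K \<subseteq> ?L" "a \<in> ?L"
    by (auto intro: is_subfield_adjoin adjoin_base adjoin_gen K)
  have P: "\<Delta> (poly p a) = \<sigma> (poly (pderiv p) a) * \<Delta> a" if "p \<in> poly_over K" for p
    by (rule deriv_along_poly[OF K L \<sigma> \<Delta> _ that]) (rule \<Delta>K)
  have "\<Delta> a = 0"
  proof (cases "alg_over K a")
    case True
    then obtain m where m: "is_minpoly K a m" using minpoly_exists[OF K] by blast
    have mK: "m \<in> poly_over K" using m by (simp add: is_minpoly_def)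
    have "\<sigma> (poly (pderiv m) a) * \<Delta> a = 0"
      using P[OF mK] m \<Delta>K[OF sf_zero[OF K]] by (simp add: is_minpoly_def)
    moreover have "\<sigma> (poly (pderiv m) a) \<noteq> 0"
      using m hom_eq_0_iff[OF L(1) \<sigma>, of "poly (pderiv m) a"] adjoin_poly[OF K po_pderiv[OF K mK]]
      by (simp add: is_minpoly_def)
    ultimately show ?thesis by simp
  qed (use a in simp)
  then have P0: "\<Delta> (poly p a) = 0" if "p \<in> poly_over K" for p using P[OF that] by simp
  from x obtain p q where pq: "x = poly p a / poly q a" "p \<in> poly_over K" "q \<in> poly_over K" "poly q a \<noteq> 0"
    unfolding adjoin_def by blast
  have q: "poly q a \<in> ?L" using pq by (intro adjoin_poly K)
  have "\<Delta> (x * poly q a) = 0" using pq P0 by simp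
  then have "\<Delta> x * \<sigma> (poly q a) = 0" using \<Delta> x q P0[OF pq(3)] by (simp add: deriv_along_def)
  moreover have "\<sigma> (poly q a) \<noteq> 0" using hom_eq_0_iff[OF L(1) \<sigma> q] pq by simp
  ultimately show ?thesis by simp
qed

unbundle fps_syntax

section \<open>Lowest coefficients of Laurent series\<close>

text \<open>
  A bound on the order of vanishing that needs no exception for \<open>f = 0\<close>; the coefficient at \<open>N\<close>
  itself may vanish.
\<close>

definition low :: "int \<Rightarrow> 'a::zero fls \<Rightarrow> bool" where
  "low N f \<longleftrightarrow> (\<forall>i<N. f $$ i = 0)"

lemma low_nth: "low N f \<Longrightarrow> i < N \<Longrightarrow> f $$ i = 0"
  by (simp add: low_def)

lemma low_mono: "low N f \<Longrightarrow> M \<le> N \<Longrightarrow> low M f"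
  by (simp add: low_def)

lemma low_0 [simp]: "low N 0"
  by (simp add: low_def)

lemma low_const [simp]: "N \<le> 0 \<Longrightarrow> low N (fls_const c)"
  by (simp add: low_def)

lemma low_one [simp]: "N \<le> 0 \<Longrightarrow> low N 1"
  by (simp add: low_def)

lemma low_add: "low N f \<Longrightarrow> low N g \<Longrightarrow> low N (f + g)" for f g :: "'a::monoid_add fls"
  by (simp add: low_def)

lemma low_diff: "low N f \<Longrightarrow> low N g \<Longrightarrow> low N (f - g)" for f g :: "'a::group_add fls"
  by (simp add: low_def)

lemma low_minus: "low N f \<Longrightarrow> low N (- f)" for f :: "'a::group_add fls"
  by (simp add: low_def)

lemma low_subdegree: "f \<noteq> 0 \<Longrightarrow> low N f \<longleftrightarrow> N \<le> fls_subdegree f"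
  by (auto simp: low_def intro: fls_subdegree_geI)

lemma low_Suc: "low N f \<Longrightarrow> f $$ N = 0 \<Longrightarrow> low (N + 1) f"
  by (auto simp: low_def zless_add1_eq le_less)

lemma low_mult: 
  fixes f g :: "'a::idom fls"
  assumes "low a f" "low b g"
  shows "low (a + b) (f * g)" "(f * g) $$ (a + b) = f $$ a * g $$ b"
proof -
  have "low (a + b) (f * g) \<and> (f * g) $$ (a + b) = f $$ a * g $$ b"
  proof (cases "f = 0 \<or> g = 0")
    case False
    then have ab: "a \<le> fls_subdegree f" "b \<le> fls_subdegree g" using assms by (simp_all add: low_subdegree)
    have "low (a + b) (f * g)" unfolding low_def using ab by (auto intro: fls_times_nth_eq0)
    moreover have "(f * g) $$ (a + b) = f $$ a * g $$ b"
    proof (cases "a = fls_subdegree f \<and> b = fls_subdegree g")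
      case True
      then show ?thesis by simp
    next
      case False
      then have "a < fls_subdegree f \<or> b < fls_subdegree g" using ab by auto
      moreover from this have "a + b < fls_subdegree f + fls_subdegree g" using ab by auto
      ultimately show ?thesis by (auto simp: fls_times_nth_eq0)
    qed
    ultimately show ?thesis by blast
  qed auto
  then show "low (a + b) (f * g)" "(f * g) $$ (a + b) = f $$ a * g $$ b" by auto
qed

lemma low_mult_eq: 
  fixes f g :: "'a::idom fls"
  shows "low a f \<Longrightarrow> low b g \<Longrightarrow> N = a + b \<Longrightarrow> low N (f * g)"
    and "low a f \<Longrightarrow> low b g \<Longrightarrow> N = a + b \<Longrightarrow> (f * g) $$ N = f $$ a * g $$ b"
  by (simp_all add: low_mult)

lemma low_power:
  fixes f :: "'a::idom fls"
  assumes "low a f"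
  shows "low (int n * a) (f ^ n)" "(f ^ n) $$ (int n * a) = (f $$ a) ^ n"
proof -
  have "low (int n * a) (f ^ n) \<and> (f ^ n) $$ (int n * a) = (f $$ a) ^ n"
    by (induction n) (auto simp: assms intro: low_mult_eq simp: low_mult_eq[OF assms] algebra_simps)
  then show "low (int n * a) (f ^ n)" "(f ^ n) $$ (int n * a) = (f $$ a) ^ n" by auto
qed

lemma low_cancel:
  fixes f g :: "'a::idom fls"
  assumes "low (a + b) (f * g)" "low a f" "f $$ a \<noteq> 0"
  shows "low b g"
proof (cases "g = 0")
  case False
  have f: "f \<noteq> 0" using assms by auto
  have "fls_subdegree f = a" using assms by (intro fls_subdegree_eqI) (auto simp: low_def)
  then show ?thesis using assms f False by (simp add: low_subdegree)
qed simp

lemma fls_times_nth_low: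
  fixes f g :: "'a::idom fls"
  assumes "low a f" "low b g"
  shows "(f * g) $$ n = (\<Sum>i=a..n - b. f $$ i * g $$ (n - i))"
proof (cases "f = 0 \<or> g = 0")
  case False
  then have ab: "a \<le> fls_subdegree f" "b \<le> fls_subdegree g" using assms by (simp_all add: low_subdegree)
  show ?thesis unfolding fls_times_nth(2)
    by (rule sum.mono_neutral_left) (use ab in \<open>auto simp: not_le\<close>)
qed auto

definition fls_map :: "('a \<Rightarrow> 'a) \<Rightarrow> 'a::zero fls \<Rightarrow> 'a fls" where
  "fls_map D f = Abs_fls (\<lambda>n. D (f $$ n))"

lemma fls_map_nth: "D 0 = 0 \<Longrightarrow> fls_map D f $$ n = D (f $$ n)"
  unfolding fls_map_def
  by (rule nth_Abs_fls_lower_bound[of "fls_subdegree f"]) simp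

lemma low_map: "D 0 = 0 \<Longrightarrow> low N f \<Longrightarrow> low N (fls_map D f)"
  by (simp add: low_def fls_map_nth)

lemma derivation_add: "derivation D \<Longrightarrow> D (x + y) = D x + D y"
  and derivation_mult: "derivation D \<Longrightarrow> D (x * y) = D x * y + x * D y"
  by (auto simp: derivation_def)

lemma derivation_zero: "derivation D \<Longrightarrow> D 0 = 0"
  using derivation_add[of D 0 0] by (metis add.right_neutral add_left_cancel)

lemma derivation_one: "derivation D \<Longrightarrow> D 1 = 0"
  using derivation_mult[of D 1 1] by (metis add.right_neutral add_left_cancel mult_1 mult_1_right)

lemma derivation_sum: "derivation D \<Longrightarrow> D (sum f A) = (\<Sum>i\<in>A. D (f i))"
  by (induction A rule: infinite_finite_induct) (simp_all add: derivation_zero derivation_add)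

lemma derivation_fls_map:
  assumes D: "derivation D"
  shows "derivation (fls_map D)"
  unfolding derivation_def
proof (intro conjI allI)
  note D0 = derivation_zero[OF D]
  fix f g :: "'a fls"
  show "fls_map D (f + g) = fls_map D f + fls_map D g"
    by (rule fls_eqI) (simp add: fls_map_nth D0 derivation_add[OF D])
  have l: "low (fls_subdegree f) f" "low (fls_subdegree g) g" by (simp_all add: low_def)
  show "fls_map D (f * g) = fls_map D f * g + f * fls_map D g"
  proof (rule fls_eqI)
    fix n
    show "fls_map D (f * g) $$ n = (fls_map D f * g + f * fls_map D g) $$ n"
      using fls_times_nth_low[OF low_map[of D, OF D0 l(1)] l(2), of n] fls_times_nth_low[OF l(1) low_map[of D, OF D0 l(2)], of n]
      by (simp add: fls_map_nth D0 fls_times_nth_low[OF l] derivation_sum[OF D] derivation_mult[OF D] sum.distrib)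
  qed
qed

section \<open>Hensel's lemma and Puiseux series\<close>

text \<open>
  Going from \<open>m\<close> to \<open>m + 1\<close>, a multiple of \<open>h\<close> is moved from \<open>t\<close> into \<open>s\<close> so that what remains of \<open>t\<close>
  vanishes at \<open>c\<close>.
\<close>

lemma linear_power_bezout:
  fixes h :: "'a::field poly"
  assumes "poly h c \<noteq> 0"
  shows "\<exists>s t. E = s * h + t * [:-c, 1:] ^ m \<and> (s = 0 \<or> degree s < m)"
proof (induction m)
  case 0
  then show ?case by (intro exI[of _ 0] exI[of _ E]) auto
next
  case (Suc m)
  let ?L = "[:-c, 1:]"
  from Suc obtain s t where st: "E = s * h + t * ?L ^ m" "s = 0 \<or> degree s < m" by blast
  define k where "k = poly t c / poly h c"
  have "poly (t - smult k h) c = 0" using assms by (simp add: k_def)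
  then have "?L dvd t - smult k h" by (simp only: poly_eq_0_iff_dvd)
  then obtain t' where t': "t - smult k h = ?L * t'" by (rule dvdE)
  have "E = (s + smult k (L ^ m)) * h + t' * L ^ Suc m" if "t - smult k h = L * t'" "E = s * h + t * L ^ m" for L
  proof -
    have "t = smult k h + L * t'" using that(1) by (metis add.commute diff_add_cancel)
    then show ?thesis unfolding that(2) by (simp add: algebra_simps)
  qed
  from this[OF t' st(1)] have "E = (s + smult k (?L ^ m)) * h + t' * ?L ^ Suc m" .
  moreover have "degree (s + smult k (?L ^ m)) \<le> m"
    using st(2) by (intro degree_add_le) (auto simp: degree_linear_power intro: order.trans[OF degree_smult_le])
  ultimately show ?case by (metis less_Suc_eq_le)
qed

text \<open>The pair of coefficients of \<open>X\<^sup>i\<close> in the two factors of \<open>\<Sum>q\<^sub>i X\<^sup>i\<close>, when \<open>sol\<close> solves the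
  linearised factorisation problem.\<close>

function hensel_coeffs :: "(nat \<Rightarrow> 'a::field poly) \<Rightarrow> ('a poly \<Rightarrow> 'a poly \<times> 'a poly) \<Rightarrow> 'a poly \<times> 'a poly \<Rightarrow> nat \<Rightarrow> 'a poly \<times> 'a poly" where
  "hensel_coeffs q sol z 0 = z"
| "hensel_coeffs q sol z (Suc i) =
     sol (q (Suc i) - (\<Sum>l\<in>{1..i}. fst (hensel_coeffs q sol z l) * snd (hensel_coeffs q sol z (Suc i - l))))"
  by pat_completeness auto
termination by (relation "measure (\<lambda>(_,_,_,i). i)") auto

text \<open>
  The factors are found coefficient by coefficient: in degree \<open>i\<close> one has to write a known polynomial
  as \<open>s h0 + t (X - c)\<^sup>m\<close>.
\<close>

lemma hensel:
  fixes Q :: "'a::field fps poly"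
  assumes Q: "lead_coeff Q = 1" and Q0: "map_poly (\<lambda>f. f $ 0) Q = [:-c, 1:] ^ m * h0" and h0: "poly h0 c \<noteq> 0"
  obtains G H where "Q = G * H" "degree G = m" "degree H \<le> degree Q - m"
proof -
  let ?L = "[:-c, 1:]"
  define n where "n = degree Q"
  define q where "q i = map_poly (\<lambda>f. f $ i) Q" for i
  have q_nth: "coeff (q i) k = coeff Q k $ i" for i k by (simp add: q_def coeff_map_poly)
  have q0: "q 0 = ?L ^ m * h0" using Q0 by (simp add: q_def)
  have h0n: "h0 \<noteq> 0" using h0 by auto
  have deg_q0: "degree (q 0) = n"
  proof (rule antisym)
    show "degree (q 0) \<le> n" by (rule degree_le) (simp add: q_nth n_def coeff_eq_0)
    show "n \<le> degree (q 0)" by (rule le_degree) (use Q in \<open>simp add: q_nth n_def\<close>)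
  qed
  have n: "n = m + degree h0"
  proof -
    have "degree (?L ^ m * h0) = m + degree h0"
      using h0n by (subst degree_mult_eq) (auto simp: degree_linear_power)
    then show ?thesis using deg_q0 q0 by simp
  qed
  have deg_q: "coeff (q (Suc i)) k = 0" if "k \<ge> n" for i k
    using that Q by (cases "k = n") (auto simp: q_nth n_def coeff_eq_0)
  have "\<exists>s t. (s = 0 \<or> degree s < m) \<and> ((\<forall>k\<ge>n. coeff E k = 0) \<longrightarrow> (\<forall>k\<ge>degree h0. coeff t k = 0)) \<and> E = s * h0 + t * ?L ^ m" for E
  proof -
    from linear_power_bezout[OF h0, of E m] obtain s t
      where st: "E = s * h0 + t * ?L ^ m" "s = 0 \<or> degree s < m" by blast
    have "\<forall>k\<ge>degree h0. coeff t k = 0" if E: "\<forall>k\<ge>n. coeff E k = 0"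
    proof (rule ccontr)
      assume "\<not> ?thesis"
      then obtain k where k: "k \<ge> degree h0" "coeff t k \<noteq> 0" by blast
      then have t0: "t \<noteq> 0" and kt: "k \<le> degree t" by (auto simp: le_degree)
      have d: "degree (t * ?L ^ m) = degree t + m"
        using t0 by (subst degree_mult_eq) (auto simp: degree_linear_power)
      have "t * ?L ^ m \<noteq> 0" using t0 by simp
      then have tnz: "coeff (t * ?L ^ m) (degree t + m) \<noteq> 0" using leading_coeff_neq_0 d by metis
      have "coeff (s * h0) (degree t + m) = 0"
      proof (cases "s = 0")
        case False
        then have "degree (s * h0) < degree t + m" using st(2) k(1) kt h0n by (simp add: degree_mult_eq)
        then show ?thesis by (rule coeff_eq_0)
      qed simp
      then have "coeff E (degree t + m) \<noteq> 0" using tnz st(1) by simp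
      then show False using E k(1) kt n by auto
    qed
    then show ?thesis using st by blast
  qed
  then obtain s t where sol: "\<And>E. s E = 0 \<or> degree (s E) < m"
      "\<And>E. (\<forall>k\<ge>n. coeff E k = 0) \<Longrightarrow> (\<forall>k\<ge>degree h0. coeff (t E) k = 0)"
      "\<And>E. E = s E * h0 + t E * ?L ^ m"
    by metis
  define gh where "gh = hensel_coeffs q (\<lambda>E. (s E, t E)) (?L ^ m, h0)"
  define g where "g i = fst (gh i)" for i
  define h where "h i = snd (gh i)" for i
  have g0: "g 0 = ?L ^ m" and h0': "h 0 = h0" by (simp_all add: g_def h_def gh_def)
  define E where "E i = q (Suc i) - (\<Sum>l\<in>{1..i}. g l * h (Suc i - l))" for i
  have gS: "g (Suc i) = s (E i)" and hS: "h (Suc i) = t (E i)" for i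
    by (simp_all add: g_def h_def gh_def E_def)
  have dg: "coeff (g (Suc i)) k = 0" if "k \<ge> m" for i k
    using sol(1)[of "E i"] that unfolding gS by (auto intro: coeff_eq_0)
  have dh: "\<forall>k\<ge>degree h0. coeff (h (Suc i)) k = 0" for i
  proof (induction i rule: less_induct)
    case (less i)
    have "coeff (g l * h (Suc i - l)) k = 0" if l: "l \<in> {1..i}" and k: "k \<ge> n" for l k
      unfolding coeff_mult
    proof (rule sum.neutral, rule ballI)
      fix j assume j: "j \<in> {..k}"
      show "coeff (g l) j * coeff (h (Suc i - l)) (k - j) = 0"
      proof (cases "j \<ge> m")
        case True
        then show ?thesis using dg[of j "l - 1"] l by simp
      next
        case False
        then have "k - j \<ge> degree h0" using k n by auto
        moreover have "Suc i - l = Suc (i - l)" "i - l < i" using l by auto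
        ultimately show ?thesis using less by simp
      qed
    qed
    then have "\<forall>k\<ge>n. coeff (E i) k = 0" by (simp add: E_def coeff_sum deg_q)
    then show ?case unfolding hS by (rule sol(2))
  qed
  have conv: "(\<Sum>l\<le>i. g l * h (i - l)) = q i" for i
  proof (cases i)
    case 0
    then show ?thesis by (simp add: g0 h0' q0)
  next
    case (Suc i')
    have "{..i} = insert 0 (insert i {1..i'})" using Suc by auto
    then have "(\<Sum>l\<le>i. g l * h (i - l)) = g 0 * h i + (g i * h 0 + (\<Sum>l\<in>{1..i'}. g l * h (i - l)))"
      using Suc by simp
    also have "\<dots> = (s (E i') * h0 + t (E i') * ?L ^ m) + (\<Sum>l\<in>{1..i'}. g l * h (Suc i' - l))"
      using Suc by (simp add: g0 h0' gS hS algebra_simps)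
    also have "\<dots> = q i" unfolding sol(3)[symmetric] by (simp add: E_def Suc)
    finally show ?thesis .
  qed
  define G where "G = Abs_poly (\<lambda>k. Abs_fps (\<lambda>i. coeff (g i) k))"
  define H where "H = Abs_poly (\<lambda>k. Abs_fps (\<lambda>i. coeff (h i) k))"
  have gk: "coeff (g i) k = 0" if "k > m" for i k
    using that dg[of k "i - 1"] by (cases i) (auto simp: g0 degree_linear_power intro: coeff_eq_0)
  have hk: "coeff (h i) k = 0" if "k > degree h0" for i k
    using that dh[of "i - 1"] by (cases i) (auto simp: h0' intro: coeff_eq_0)
  have cG: "coeff G = (\<lambda>k. Abs_fps (\<lambda>i. coeff (g i) k))" unfolding G_def
    by (rule coeff_Abs_poly[of m]) (simp add: fps_eq_iff gk)
  have cH: "coeff H = (\<lambda>k. Abs_fps (\<lambda>i. coeff (h i) k))" unfolding H_def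
    by (rule coeff_Abs_poly[of "degree h0"]) (simp add: fps_eq_iff hk)
  have "Q = G * H"
  proof (rule poly_eqI, rule fps_ext)
    fix k i
    have "coeff (G * H) k $ i = (\<Sum>j\<le>k. \<Sum>l\<le>i. coeff (g l) j * coeff (h (i - l)) (k - j))"
      by (simp add: coeff_mult cG cH fps_sum_nth fps_mult_nth atLeast0AtMost)
    also have "\<dots> = coeff (\<Sum>l\<le>i. g l * h (i - l)) k"
      by (subst sum.swap) (simp add: coeff_sum coeff_mult)
    also have "\<dots> = coeff Q k $ i" by (simp add: conv q_nth)
    finally show "coeff Q k $ i = coeff (G * H) k $ i" by simp
  qed
  moreover have "degree G = m"
  proof (rule antisym)
    show "degree G \<le> m" by (rule degree_le) (simp add: cG fps_eq_iff gk)
    have "coeff G m $ 0 = 1" using lead_coeff_power[of ?L m] by (simp add: cG g0 degree_linear_power)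
    then show "m \<le> degree G" by (intro le_degree) auto
  qed
  moreover have "degree H \<le> degree Q - m"
    by (rule degree_le) (use n in \<open>simp add: cH fps_eq_iff hk n_def\<close>)
  ultimately show ?thesis by (rule that)
qed

text \<open>The substitution \<open>X \<mapsto> X\<^sup>e\<close>.\<close>

abbreviation ramify :: "nat \<Rightarrow> 'a::zero fls \<Rightarrow> 'a fls" where
  "ramify e \<equiv> (\<lambda>f. fls_compose_power f e)"

lemma is_subfield_UNIV [simp]: "is_subfield UNIV"
  by (simp add: is_subfield_def)

lemma poly_over_UNIV [simp]: "poly_over UNIV = UNIV"
  by (simp add: poly_over_def)

lemma hom_ramify: "e > 0 \<Longrightarrow> hom_on UNIV (ramify e :: 'a::field fls \<Rightarrow> 'a fls)"
  by (simp add: hom_on_def)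

lemma ramify_ramify: "e > 0 \<Longrightarrow> e' > 0 \<Longrightarrow> ramify e' (ramify e f) = ramify (e * e') f"
proof (rule fls_eqI)
  fix n assume e: "e > 0" "e' > 0"
  have "(int e' dvd n \<and> int e dvd n div int e') \<longleftrightarrow> int e * int e' dvd n"
    using e by (metis dvd_div_iff_mult dvd_mult_right mult.commute of_nat_0_less_iff order_less_irrefl)
  then show "ramify e' (ramify e f) $$ n = ramify (e * e') f $$ n"
    using e by (auto simp: fls_nth_compose_power div_mult2_eq zdiv_zmult2_eq mult.commute)
qed

lemma map_ramify_ramify: "e > 0 \<Longrightarrow> e' > 0 \<Longrightarrow>
    map_poly (ramify e') (map_poly (ramify e) P) = map_poly (ramify (e * e')) P" for P :: "'a::field fls poly"
  by (rule poly_eqI) (simp add: coeff_map_poly ramify_ramify)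

lemma low_ramify: "e > 0 \<Longrightarrow> low N f \<Longrightarrow> low (int e * N) (ramify e f)"
  by (auto simp: low_def fls_nth_compose_power)

lemma ramify_nth: "e > 0 \<Longrightarrow> ramify e f $$ (int e * N) = f $$ N"
  by (simp add: fls_nth_compose_power)

lemma low_ramifyD: "e > 0 \<Longrightarrow> low (int e * N) (ramify e f) \<Longrightarrow> low N f"
  unfolding low_def by (metis mult_less_cancel_left_pos of_nat_0_less_iff ramify_nth)

definition ram_reducible :: "'a::field fls poly \<Rightarrow> bool" where
  "ram_reducible P \<longleftrightarrow> (\<exists>e>0. \<exists>A B. map_poly (ramify e) P = A * B \<and> degree A < degree P \<and> degree B < degree P)"

lemma ram_reducibleI: "e > 0 \<Longrightarrow> map_poly (ramify e) P = A * B \<Longrightarrow>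
    degree A < degree P \<Longrightarrow> degree B < degree P \<Longrightarrow> ram_reducible P"
  unfolding ram_reducible_def by blast

lemma ram_reducible_smult:
  assumes "ram_reducible (smult c P)" "c \<noteq> 0"
  shows "ram_reducible P"
proof -
  from assms obtain e A B where e: "e > 0" and AB: "map_poly (ramify e) (smult c P) = A * B"
    "degree A < degree P" "degree B < degree P"
    by (auto simp: ram_reducible_def)
  have "map_poly (ramify e) (smult c P) = smult (ramify e c) (map_poly (ramify e) P)"
    by (rule poly_eqI) (simp add: coeff_map_poly)
  moreover have "ramify e c \<noteq> 0"
    using hom_eq_0_iff[OF is_subfield_UNIV hom_ramify[OF e], of c] assms by simp
  ultimately have "map_poly (ramify e) P = smult (inverse (ramify e c)) A * B"
    using AB(1) by (metis (no_types, lifting) left_inverse mult_smult_left smult_1_left smult_smult)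
  then show ?thesis
    by (rule ram_reducibleI[OF e]) (use AB(2,3) in \<open>auto intro: order.strict_trans1[OF degree_smult_le]\<close>)
qed

lemma map_poly_pcompose_hom:
  assumes "hom_on UNIV \<sigma>"
  shows "map_poly \<sigma> (pcompose p q) = pcompose (map_poly \<sigma> p) (map_poly \<sigma> q)"
proof (induction p)
  case 0
  then show ?case by simp
next
  case (pCons a p)
  note h = is_subfield_UNIV assms
  show ?case using pCons
    by (simp add: pcompose_pCons hom_map_pCons[OF h] hom_map_add[OF h] hom_map_mult[OF h])
qed

lemma ram_reducible_pcompose:
  assumes "ram_reducible (pcompose P [:t, c:])" "c \<noteq> 0"
  shows "ram_reducible P"
proof -
  have dP: "degree (pcompose P [:t, c:]) = degree P" using assms(2) by (simp add: degree_pcompose)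
  with assms obtain e A B where e: "e > 0" and AB: "map_poly (ramify e) (pcompose P [:t, c:]) = A * B"
    "degree A < degree P" "degree B < degree P"
    by (auto simp: ram_reducible_def)
  note h = is_subfield_UNIV hom_ramify[OF e]
  let ?t = "ramify e t" and ?c = "ramify e c"
  let ?L = "[:- ?t / ?c, 1 / ?c:]"
  have c: "?c \<noteq> 0" using hom_eq_0_iff[OF h, of c] assms by simp
  have "pcompose [:?t, ?c:] ?L = [:0, 1:]" using c by (simp add: pcompose_pCons)
  then have "map_poly (ramify e) P = pcompose (pcompose (map_poly (ramify e) P) [:?t, ?c:]) ?L"
    by (simp flip: pcompose_assoc)
  also have "pcompose (map_poly (ramify e) P) [:?t, ?c:] = A * B"
    using AB(1) by (simp add: map_poly_pcompose_hom[OF h(2)] hom_map_pCons[OF h])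
  finally have "map_poly (ramify e) P = pcompose A ?L * pcompose B ?L" by (simp add: pcompose_mult)
  moreover have dle: "degree (pcompose p ?L) \<le> degree p" for p
    using c degree_pcompose_le[of p ?L] by (simp add: degree_pcompose)
  ultimately show ?thesis
    using order.strict_trans1[OF dle AB(2)] order.strict_trans1[OF dle AB(3)] by (intro ram_reducibleI[OF e])
qed

lemma ram_reducible_ramify:
  assumes "ram_reducible (map_poly (ramify e) P)" "e > 0"
  shows "ram_reducible P"
proof -
  have "degree (map_poly (ramify e) P) = degree P"
    using hom_degree[OF is_subfield_UNIV hom_ramify[OF assms(2)], of P] by simp
  with assms obtain e' A B where "e' > 0" "map_poly (ramify (e * e')) P = A * B"
    "degree A < degree P" "degree B < degree P"
    by (auto simp: ram_reducible_def map_ramify_ramify)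
  then show ?thesis unfolding ram_reducible_def using assms(2)
    by (intro exI[of _ "e * e'"]) auto
qed

text \<open>Used to choose the shift that makes the sum of the roots vanish.\<close>

lemma coeff_pcompose_shift:
  fixes p :: "'a::comm_ring_1 poly"
  assumes "degree p \<le> Suc N"
  shows "coeff (pcompose p [:t, 1:]) N = coeff p N + of_nat (Suc N) * t * coeff p (Suc N)"
    and "coeff (pcompose p [:t, 1:]) (Suc N) = coeff p (Suc N)"
proof -
  have "degree p \<le> Suc N \<Longrightarrow>
    coeff (pcompose p [:t, 1:]) N = coeff p N + of_nat (Suc N) * t * coeff p (Suc N) \<and>
    coeff (pcompose p [:t, 1:]) (Suc N) = coeff p (Suc N)" for N
  proof (induction p arbitrary: N)
    case 0
    then show ?case by simp
  next
    case (pCons a p)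
    show ?case
    proof (cases N)
      case 0
      then have "degree p = 0" using pCons.prems pCons.hyps by (auto split: if_splits)
      then obtain b where "p = [:b:]" by (rule degree_eq_zeroE)
      then show ?thesis using 0 by (simp add: pcompose_pCons)
    next
      case (Suc M)
      have d: "degree p \<le> Suc M" using pCons.prems Suc by (cases "p = 0") auto
      have "degree (pcompose p [:t, 1:]) \<le> degree p" using degree_pcompose_le[of p "[:t,1:]"] by simp
      then have "coeff (pcompose p [:t, 1:]) (Suc (Suc M)) = 0" using d by (intro coeff_eq_0) auto
      then show ?thesis using pCons.IH[OF d] Suc
        by (simp add: pcompose_pCons algebra_simps)
    qed
  qed
  then show "coeff (pcompose p [:t, 1:]) N = coeff p N + of_nat (Suc N) * t * coeff p (Suc N)"
    "coeff (pcompose p [:t, 1:]) (Suc N) = coeff p (Suc N)" using assms by blast+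
qed

definition alg_closed_type :: "'a::field itself \<Rightarrow> bool" where
  "alg_closed_type _ \<longleftrightarrow> (\<forall>p :: 'a poly. degree p > 0 \<longrightarrow> (\<exists>x. poly p x = 0))"

text \<open>
  The reduction has two distinct roots: as its second coefficient vanishes, it could only be
  \<open>(X - c)\<^sup>n\<close> with \<open>c = 0\<close>, but it is not \<open>X\<^sup>n\<close>. Hensel's lemma lifts the resulting factorisation.
\<close>

lemma ram_reducible_integral:
  fixes Q :: "'a::field_char_0 fls poly"
  assumes AC: "alg_closed_type TYPE('a)" and Q: "lead_coeff Q = 1" "\<And>k. low 0 (coeff Q k)"
    and n: "degree Q = Suc N" and N0: "coeff Q N $$ 0 = 0" and k: "k < Suc N" "coeff Q k $$ 0 \<noteq> 0"
  shows "ram_reducible Q"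
proof -
  define q where "q = map_poly (\<lambda>f. f $$ 0) Q"
  have q: "coeff q i = coeff Q i $$ 0" for i by (simp add: q_def coeff_map_poly)
  have dq: "degree q = Suc N"
  proof (rule antisym)
    show "degree q \<le> Suc N" by (rule degree_le) (simp add: q n[symmetric] coeff_eq_0)
    show "Suc N \<le> degree q" by (rule le_degree) (use Q n in \<open>simp add: q\<close>)
  qed
  have lq: "lead_coeff q = 1" using Q n by (simp add: dq q)
  from AC dq obtain c where c: "poly q c = 0" unfolding alg_closed_type_def by (metis zero_less_Suc)
  define m where "m = order c q"
  have q0: "q \<noteq> 0" using dq by auto
  from order_decomp[OF q0, of c] obtain h where h: "q = [:-c, 1:] ^ m * h" "\<not> [:-c, 1:] dvd h"
    unfolding m_def by blast
  have hc: "poly h c \<noteq> 0" using h(2) by (simp add: poly_eq_0_iff_dvd)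
  have m0: "m > 0" using c q0 by (simp add: m_def order_gt_0_iff)
  have "h \<noteq> 0" using hc by auto
  then have "degree ([:-c, 1:] ^ m * h) = m + degree h"
    by (subst degree_mult_eq) (auto simp: degree_linear_power)
  then have dqm: "Suc N = m + degree h" using dq h(1) by simp
  have mN: "m < Suc N"
  proof (rule ccontr)
    assume "\<not> m < Suc N"
    then have dh: "degree h = 0" "m = Suc N" using dqm by auto
    from dh(1) obtain w where w: "h = [:w:]" by (rule degree_eq_zeroE)
    have "lead_coeff (L ^ m * [:w:]) = w" if "lead_coeff L = 1" for L
      using that by (simp only: lead_coeff_mult lead_coeff_power) simp
    from this[of "[:-c, 1:]"] have "w = 1" using lq by (simp add: h(1) w del: mult_pCons_right)
    then have qc: "q = [:-c, 1:] ^ Suc N" unfolding h(1) w dh(2) by (simp only: mult_1_right flip: one_pCons)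
    have "[:-c, 1:] ^ Suc N = pcompose (monom 1 (Suc N)) [:-c, 1:]"
      by (simp add: pcompose_altdef map_poly_monom poly_monom)
    then have "coeff q N = of_nat (Suc N) * (-c)"
      using coeff_pcompose_shift(1)[of "monom 1 (Suc N)" N "-c"] by (simp add: qc degree_monom_eq)
    then have "c = 0" using N0 by (simp add: q del: of_nat_Suc)
    then have "q = monom 1 (Suc N)" using qc by (simp add: monom_altdef)
    then show False using k q[of k] by simp
  qed
  define Q' where "Q' = map_poly fls_regpart Q"
  have cQ': "fps_to_fls (coeff Q' i) = coeff Q i" for i
    using fls_subdegree_ge0I[of "coeff Q i"] Q(2)[of i] by (simp add: Q'_def coeff_map_poly low_def)
  have cQ'0: "coeff Q' i = 0 \<longleftrightarrow> coeff Q i = 0" for i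
    using cQ'[of i] by (metis fps_to_fls_eq_0_iff)
  have dQ': "degree Q' = degree Q"
  proof (rule antisym; rule degree_le; intro allI impI)
    fix i
    show "coeff Q' i = 0" if "degree Q < i" using cQ'0[of i] coeff_eq_0[OF that] by simp
    show "coeff Q i = 0" if "degree Q' < i" using cQ'0[of i] coeff_eq_0[OF that] by simp
  qed
  have "fps_to_fls (lead_coeff Q') = 1" by (simp add: cQ' dQ' Q(1))
  then have lQ': "lead_coeff Q' = 1" by simp
  have "map_poly (\<lambda>f. f $ 0) Q' = q"
    by (rule poly_eqI) (simp add: Q'_def q coeff_map_poly)
  then obtain G H where GH: "Q' = G * H" "degree G = m" "degree H \<le> degree Q' - m"
    using hensel[OF lQ', of c m h] h(1) hc by metis
  have sum: "fps_to_fls (sum f A) = (\<Sum>i\<in>A. fps_to_fls (f i))" for f :: "nat \<Rightarrow> 'a fps" and A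
    by (induction A rule: infinite_finite_induct) auto
  have "Q = map_poly fps_to_fls G * map_poly fps_to_fls H"
    by (rule poly_eqI) (simp add: cQ'[symmetric] GH(1) coeff_mult coeff_map_poly sum fls_times_fps_to_fls)
  moreover have dle: "degree (map_poly fps_to_fls P) \<le> degree P" for P :: "'a fps poly"
    by (rule degree_le) (simp add: coeff_map_poly coeff_eq_0)
  moreover have "map_poly (ramify 1) Q = Q"
    by (rule poly_eqI) (simp add: coeff_map_poly, simp add: fls_eq_iff fls_nth_compose_power)
  moreover have "degree G < degree Q" "degree H < degree Q"
    using GH(2,3) dQ' mN m0 n by auto
  ultimately show ?thesis
    using order.strict_trans1[OF dle] by (intro ram_reducibleI[of 1 Q "map_poly fps_to_fls G" "map_poly fps_to_fls H"]) auto
qed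

text \<open>After the substitution that makes the sum of the roots vanish, and rescaling along the
  steepest side of the Newton polygon, the reduction is not a pure power.\<close>

lemma ram_reducible_ge_2:
  fixes P :: "'a::field_char_0 fls poly"
  assumes AC: "alg_closed_type TYPE('a)" and deg: "degree P \<ge> 2"
  shows "ram_reducible P"
proof -
  obtain N where N: "degree P = Suc N" "N \<ge> 1" using deg by (metis One_nat_def Suc_1 Suc_le_D Suc_le_mono)
  define P1 where "P1 = smult (inverse (lead_coeff P)) P"
  have lc0: "lead_coeff P \<noteq> 0" using deg by auto
  have d1: "degree P1 = Suc N" and l1: "coeff P1 (Suc N) = 1" using lc0 N by (simp_all add: P1_def)
  define t where "t = - coeff P1 N / of_nat (Suc N)"
  define P2 where "P2 = pcompose P1 [:t, 1:]"
  have d2: "degree P2 = Suc N" by (simp add: P2_def degree_pcompose d1)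
  have l2: "coeff P2 (Suc N) = 1" and z2: "coeff P2 N = 0"
    using coeff_pcompose_shift[of P1 N t] d1 l1 by (simp_all add: P2_def t_def del: of_nat_Suc)
  have "ram_reducible P2"
  proof (cases "\<forall>k\<le>N. coeff P2 k = 0")
    case True
    have "P2 = monom 1 (Suc N)"
      by (rule poly_eqI) (metis True coeff_eq_0 coeff_monom d2 l2 le_Suc_eq not_le_imp_less)
    then have "map_poly (ramify 1) P2 = monom 1 1 * monom 1 N" by (simp add: map_poly_monom mult_monom)
    then show ?thesis
      by (rule ram_reducibleI[of 1, OF zero_less_one]) (use N d2 in \<open>auto simp: degree_monom_eq\<close>)
  next
    case False
    define S where "S = {k. k \<le> N \<and> coeff P2 k \<noteq> 0}"
    define v where "v k = real_of_int (fls_subdegree (coeff P2 k)) / real (Suc N - k)" for k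
    have S: "finite S" "S \<noteq> {}" using False by (auto simp: S_def)
    \<comment> \<open>The denominator \<open>Suc N - k0\<close> of the least slope is the ramification index that makes it an integer.\<close>
    define k0 where "k0 = arg_min_on v S"
    have k0: "k0 \<in> S" and min: "\<And>k. k \<in> S \<Longrightarrow> v k0 \<le> v k"
      using arg_min_if_finite[OF S, of v] by (auto simp: k0_def not_less)
    define e where "e = Suc N - k0"
    define s where "s = fls_subdegree (coeff P2 k0)"
    have e0: "e > 0" using k0 by (auto simp: e_def S_def)
    have slope: "s * int (Suc N - k) \<le> int e * fls_subdegree (coeff P2 k)" if "k \<in> S" for k
    proof -
      have "0 < real (Suc N - k)" using that by (auto simp: S_def)
      moreover have "0 < real e" using e0 by simp
      moreover have "real_of_int s / real e \<le> real_of_int (fls_subdegree (coeff P2 k)) / real (Suc N - k)"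
        using min[OF that] by (simp add: v_def s_def e_def)
      ultimately have "real_of_int s * real (Suc N - k) \<le> real e * real_of_int (fls_subdegree (coeff P2 k))"
        by (simp add: field_simps)
      then have "real_of_int (s * int (Suc N - k)) \<le> real_of_int (int e * fls_subdegree (coeff P2 k))" by simp
      then show ?thesis by (simp only: of_int_le_iff)
    qed
    define z :: "'a fls" where "z = fls_X_intpow s"
    define w :: "'a fls" where "w = fls_X_intpow (- s)"
    have zw: "w * z = 1" by (simp add: z_def w_def fls_shifted_times_simps)
    have z0: "z \<noteq> 0" and w0: "w \<noteq> 0" using zw by auto
    define P3 where "P3 = map_poly (ramify e) P2"
    define Q where "Q = smult (w ^ Suc N) (pcompose P3 [:0, z:])"
    have d3: "degree P3 = Suc N"
      using hom_degree[OF is_subfield_UNIV hom_ramify[OF e0], of P2] by (simp add: P3_def d2)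
    have dQ: "degree Q = Suc N" using z0 w0 by (simp add: Q_def degree_pcompose d3)
    have cQ: "coeff Q k = w ^ (Suc N - k) * ramify e (coeff P2 k)" if "k \<le> Suc N" for k
    proof -
      have "w ^ Suc N * z ^ k = w ^ (Suc N - k) * (w * z) ^ k"
        using that by (simp only: power_mult_distrib mult.assoc[symmetric] power_add[symmetric]) simp
      then show ?thesis
        unfolding Q_def by (simp add: coeff_pcompose_linear P3_def coeff_map_poly zw mult.assoc[symmetric])
    qed
    have lw: "low (- s * int j) (w ^ j)" "(w ^ j) $$ (- s * int j) = 1" for j
      using low_power[of "- s" w j] by (simp_all add: w_def low_def mult.commute)
    have lowQ: "low 0 (coeff Q k)" for k
    proof (cases "k \<in> S")
      case True
      then have kN: "k \<le> Suc N" by (auto simp: S_def)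
      have "low (fls_subdegree (coeff P2 k)) (coeff P2 k)" by (simp add: low_def)
      from low_mult(1)[OF lw(1)[of "Suc N - k"] low_ramify[OF e0 this]]
      show ?thesis unfolding cQ[OF kN] by (rule low_mono) (use slope[OF True] in simp)
    next
      case False
      then consider "k = Suc N" | "k > Suc N" | "k \<le> N" "coeff P2 k = 0" by (force simp: S_def not_le)
      then show ?thesis
      proof cases
        case 1
        then show ?thesis using cQ[of k] l2 e0 by (simp add: low_def)
      next
        case 2
        then show ?thesis by (simp add: coeff_eq_0 dQ)
      next
        case 3
        then show ?thesis using cQ[of k] by simp
      qed
    qed
    have "ram_reducible Q"
    proof (rule ram_reducible_integral[OF AC _ lowQ dQ])
      show "lead_coeff Q = 1" using cQ[of "Suc N"] l2 e0 by (simp add: dQ)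
      show "coeff Q N $$ 0 = 0" using cQ[of N] z2 by simp
      show "k0 < Suc N" using k0 by (auto simp: S_def)
      have "low s (coeff P2 k0)" by (simp add: low_def s_def)
      then have "(w ^ e * ramify e (coeff P2 k0)) $$ (- s * int e + int e * s) = (w ^ e) $$ (- s * int e) * ramify e (coeff P2 k0) $$ (int e * s)"
        by (intro low_mult lw low_ramify e0)
      then have "coeff Q k0 $$ 0 = coeff P2 k0 $$ s"
        using cQ[of k0] k0 lw(2)[of e] ramify_nth[OF e0, of "coeff P2 k0" s]
        by (simp add: S_def e_def[symmetric] mult.commute)
      then show "coeff Q k0 $$ 0 \<noteq> 0" using k0 by (simp add: s_def S_def)
    qed
    then have "ram_reducible (pcompose P3 [:0, z:])"
      unfolding Q_def by (rule ram_reducible_smult) (use w0 in simp)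
    then have "ram_reducible P3" by (rule ram_reducible_pcompose) (rule z0)
    then show ?thesis unfolding P3_def by (rule ram_reducible_ramify) (rule e0)
  qed
  then have "ram_reducible P1" unfolding P2_def by (rule ram_reducible_pcompose) simp
  then show ?thesis unfolding P1_def by (rule ram_reducible_smult) (use lc0 in simp)
qed

text \<open>The exponent \<open>e\<close> is common to all roots, which is what makes symmetric functions of them accessible.\<close>

theorem newton_puiseux:
  fixes P :: "'a::field_char_0 fls poly"
  assumes AC: "alg_closed_type TYPE('a)" and P: "P \<noteq> 0"
  shows "\<exists>e>0. \<exists>c rs. map_poly (ramify e) P = smult c (\<Prod>r\<leftarrow>rs. [:-r, 1:])"
  using P
proof (induction "degree P" arbitrary: P rule: less_induct)
  case less
  consider "degree P = 0" | "degree P = 1" | "degree P \<ge> 2" by linarith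
  then show ?case
  proof cases
    case 1
    then obtain c where "P = [:c:]" by (rule degree_eq_zeroE)
    then show ?thesis by (intro exI[of _ 1] conjI exI[of _ "ramify 1 c"] exI[of _ "[]"]) (auto simp: map_poly_pCons)
  next
    case 2
    define P' where "P' = map_poly (ramify 1) P"
    have "degree P' = 1"
      using hom_degree[OF is_subfield_UNIV hom_ramify[of 1], of P] 2 by (simp add: P'_def)
    then obtain a b where ab: "P' = [:a, b:]" "b \<noteq> 0"
      by (rule degree1_coeffs)
    then show ?thesis unfolding P'_def
      by (intro exI[of _ 1] conjI exI[of _ b] exI[of _ "[- a / b]"]) auto
  next
    case 3
    from ram_reducible_ge_2[OF AC 3] obtain e A B where e: "e > 0" and AB: "map_poly (ramify e) P = A * B"
      and d: "degree A < degree P" "degree B < degree P" unfolding ram_reducible_def by blast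
    have "map_poly (ramify e) P \<noteq> 0"
      using hom_map_eq_0_iff[OF is_subfield_UNIV hom_ramify[OF e], of P] less.prems by simp
    then have AB0: "A \<noteq> 0" "B \<noteq> 0" using AB by auto
    from less.hyps[OF d(1) AB0(1)] obtain e1 c1 rs1 where 1: "e1 > 0"
      "map_poly (ramify e1) A = smult c1 (\<Prod>r\<leftarrow>rs1. [:-r, 1:])" by blast
    define B' where "B' = map_poly (ramify e1) B"
    have B': "degree B' = degree B" "B' \<noteq> 0"
      using hom_degree[OF is_subfield_UNIV hom_ramify[OF 1(1)], of B]
        hom_map_eq_0_iff[OF is_subfield_UNIV hom_ramify[OF 1(1)], of B] AB0 by (simp_all add: B'_def)
    from less.hyps[OF _ B'(2)] B'(1) d(2) obtain e2 c2 rs2 where 2: "e2 > 0"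
      "map_poly (ramify e2) B' = smult c2 (\<Prod>r\<leftarrow>rs2. [:-r, 1:])" by auto
    note h1 = is_subfield_UNIV hom_ramify[OF 1(1)] and h2 = is_subfield_UNIV hom_ramify[OF 2(1)]
    have split: "map_poly (ramify e2) (\<Prod>r\<leftarrow>rs. [:-r, 1:]) = (\<Prod>r\<leftarrow>map (ramify e2) rs. [:-r, 1:])" for rs :: "'a fls list"
    proof (induction rs)
      case (Cons a rs)
      have "map_poly (ramify e2) ([:-a, 1:] * R) = [:- ramify e2 a, 1:] * map_poly (ramify e2) R" for R
        by (subst hom_map_mult[OF h2]) (simp_all add: hom_map_pCons[OF h2] 2(1) del: mult_pCons_left)
      then show ?case using Cons by (simp del: mult_pCons_left)
    qed (simp add: hom_map_one[OF h2])
    have sm: "map_poly (ramify e2) (smult c p) = smult (ramify e2 c) (map_poly (ramify e2) p)" for c :: "'a fls" and p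
      by (rule poly_eqI) (simp add: coeff_map_poly)
    have "map_poly (ramify (e * e1 * e2)) P = map_poly (ramify e2) (map_poly (ramify e1) (A * B))"
      using e 1 2 by (simp add: AB[symmetric] map_ramify_ramify mult.assoc)
    also have "\<dots> = map_poly (ramify e2) (smult c1 (\<Prod>r\<leftarrow>rs1. [:-r, 1:])) * map_poly (ramify e2) B'"
      by (simp add: hom_map_mult[OF h1] hom_map_mult[OF h2] 1(2) B'_def del: mult_smult_left)
    also have "\<dots> = smult (ramify e2 c1 * c2) (\<Prod>r\<leftarrow>map (ramify e2) rs1 @ rs2. [:-r, 1:])"
      unfolding sm split 2(2) by (simp add: mult.commute)
    finally have "map_poly (ramify (e * e1 * e2)) P = smult (ramify e2 c1 * c2) (\<Prod>r\<leftarrow>map (ramify e2) rs1 @ rs2. [:-r, 1:])" .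
    moreover have "e * e1 * e2 > 0" using e 1(1) 2(1) by simp
    ultimately show ?thesis by blast
  qed
qed

section \<open>Extending derivations\<close>

datatype 'a dual = Dual (re: 'a) (ep: 'a)

instantiation dual :: (comm_ring_1) comm_ring_1
begin
definition "0 = Dual 0 0"
definition "1 = Dual 1 0"
definition "x + y = Dual (re x + re y) (ep x + ep y)"
definition "x - y = Dual (re x - re y) (ep x - ep y)"
definition "- x = Dual (- re x) (- ep x)"
definition "x * y = Dual (re x * re y) (ep x * re y + re x * ep y)"
instance
  by standard (auto simp: zero_dual_def one_dual_def plus_dual_def minus_dual_def uminus_dual_def
    times_dual_def algebra_simps intro: dual.expand)
end

lemma dual_sel [simp]:
  "re 0 = 0" "ep 0 = 0" "re 1 = 1" "ep 1 = 0"
  "re (x + y) = re x + re y" "ep (x + y) = ep x + ep y"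
  "re (x - y) = re x - re y" "ep (x - y) = ep x - ep y"
  "re (x * y) = re x * re y" "ep (x * y) = ep x * re y + re x * ep y"
  by (simp_all add: zero_dual_def one_dual_def plus_dual_def minus_dual_def times_dual_def)

lemma dual_eqI: "re x = re y \<Longrightarrow> ep x = ep y \<Longrightarrow> x = y"
  by (rule dual.expand) simp

lemma dual_unit:
  fixes x :: "'a::field dual"
  assumes "re x \<noteq> 0"
  shows "x dvd 1"
proof (rule dvdI)
  show "1 = x * Dual (inverse (re x)) (- ep x / (re x)\<^sup>2)"
    using assms by (intro dual_eqI) (simp_all add: field_simps power2_eq_square)
qed

text \<open>A derivation \<open>\<delta>\<close> on \<open>K\<close> is the same as the homomorphism \<open>x \<mapsto> x + \<delta>(x) \<epsilon>\<close>.\<close>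

definition dual_hom :: "'a::field set \<Rightarrow> ('a \<Rightarrow> 'a dual) \<Rightarrow> bool" where
  "dual_hom K h \<longleftrightarrow> is_subfield K \<and> hom_on K h \<and> (\<forall>x\<in>K. re (h x) = x)"

text \<open>The infinitesimal part is an affine function of \<open>w\<close>, with the derivative of \<open>p\<close> as slope.\<close>

lemma dual_hom_poly:
  assumes "dual_hom K h"
  shows "p \<in> poly_over K \<Longrightarrow> re (poly (map_poly h p) (Dual a w)) = poly p a \<and>
    ep (poly (map_poly h p) (Dual a w)) = ep (poly (map_poly h p) (Dual a 0)) + poly (pderiv p) a * w"
proof (induction p)
  case (pCons c p)
  from assms have h: "is_subfield K" "hom_on K h" and re: "\<And>x. x \<in> K \<Longrightarrow> re (h x) = x"
    by (auto simp: dual_hom_def)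
  show ?case using pCons
    by (simp add: po_pCons_iff[OF h(1)] hom_map_pCons[OF h] re pderiv_pCons algebra_simps)
qed simp

lemma dual_hom_extend_step:
  assumes "dual_hom K h"
    and zero: "\<And>p. p \<in> poly_over K \<Longrightarrow> poly p a = 0 \<Longrightarrow> poly (map_poly h p) (Dual a w) = 0"
  obtains \<tau> where "dual_hom (adjoin K a) \<tau>" "\<And>x. x \<in> K \<Longrightarrow> \<tau> x = h x" "\<tau> a = Dual a w"
proof -
  from assms have h: "is_subfield K" "hom_on K h" by (auto simp: dual_hom_def)
  note re = dual_hom_poly[OF assms(1), THEN conjunct1]
  obtain \<tau> where \<tau>: "hom_on (adjoin K a) \<tau>" "\<And>x. x \<in> K \<Longrightarrow> \<tau> x = h x" "\<tau> a = Dual a w"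
  proof (rule hom_extend[OF h, of a "Dual a w"])
    fix p assume p: "p \<in> poly_over K"
    show "poly (map_poly h p) (Dual a w) = 0" if "poly p a = 0" by (rule zero[OF p that])
    show "poly (map_poly h p) (Dual a w) dvd 1" if "poly p a \<noteq> 0"
      using that p by (intro dual_unit) (simp add: re)
  qed (rule that)
  have L: "is_subfield (adjoin K a)" by (rule is_subfield_adjoin[OF h(1)])
  have re_poly: "re (\<tau> (poly p a)) = poly p a" if p: "p \<in> poly_over K" for p
  proof -
    have "p \<in> poly_over (adjoin K a)" by (rule poly_over_mono[OF _ p]) (auto intro: adjoin_base h)
    then have "\<tau> (poly p a) = poly (map_poly \<tau> p) (\<tau> a)"
      by (rule hom_eval[OF L \<tau>(1) _ adjoin_gen[OF h(1)], symmetric])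
    also have "map_poly \<tau> p = map_poly h p"
      by (rule poly_eqI) (simp add: hom_coeff[OF L \<tau>(1)] hom_coeff[OF h] \<tau>(2) poly_overD[OF p])
    finally show ?thesis by (simp add: re p \<tau>(3))
  qed
  have "re (\<tau> x) = x" if x: "x \<in> adjoin K a" for x
  proof -
    from x obtain p q where pq: "x = poly p a / poly q a" "p \<in> poly_over K" "q \<in> poly_over K" "poly q a \<noteq> 0"
      unfolding adjoin_def by blast
    have "\<tau> (x * poly q a) = \<tau> x * \<tau> (poly q a)"
      using x pq adjoin_poly h by (intro hom_mult[OF \<tau>(1)]) auto
    moreover have "x * poly q a = poly p a" using pq by simp
    ultimately have "re (\<tau> (poly p a)) = re (\<tau> x) * re (\<tau> (poly q a))" by simp
    then have "re (\<tau> x) * poly q a = x * poly q a" using pq by (simp add: re_poly)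
    then show ?thesis using pq(4) by simp
  qed
  then have "dual_hom (adjoin K a) \<tau>" using \<tau> L by (simp add: dual_hom_def)
  then show ?thesis using \<tau> that by blast
qed

lemma dual_hom_extend_transcendental:
  assumes "dual_hom K h" "\<not> alg_over K a"
  obtains \<tau> where "dual_hom (adjoin K a) \<tau>" "\<And>x. x \<in> K \<Longrightarrow> \<tau> x = h x" "\<tau> a = Dual a w"
proof (rule dual_hom_extend_step[OF assms(1), of a w])
  fix p assume "p \<in> poly_over K" "poly p a = 0"
  then have "p = 0" using assms(2) by (auto simp: alg_over_def)
  then show "poly (map_poly h p) (Dual a w) = 0" by simp
qed (use that in blast)

lemma dual_hom_extend:
  fixes a :: "'a::field_char_0"
  assumes "dual_hom K h"
  obtains \<tau> where "dual_hom (adjoin K a) \<tau>" "\<And>x. x \<in> K \<Longrightarrow> \<tau> x = h x"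
proof (cases "alg_over K a")
  case True
  from assms have h: "is_subfield K" "hom_on K h" by (auto simp: dual_hom_def)
  obtain m where m: "is_minpoly K a m" using minpoly_exists[OF h(1) True] by blast
  define w where "w = - ep (poly (map_poly h m) (Dual a 0)) / poly (pderiv m) a"
  have mK: "m \<in> poly_over K" and m': "poly (pderiv m) a \<noteq> 0" and m0: "poly m a = 0"
    using m by (auto simp: is_minpoly_def)
  have root: "poly (map_poly h m) (Dual a w) = 0"
    using dual_hom_poly[OF assms mK, of a w] m' m0 by (intro dual_eqI) (simp_all add: w_def)
  show ?thesis
  proof (rule dual_hom_extend_step[OF assms(1), of a w])
    fix p assume "p \<in> poly_over K" "poly p a = 0"
    then obtain q where "q \<in> poly_over K" "p = m * q" using m unfolding is_minpoly_def by blast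
    then show "poly (map_poly h p) (Dual a w) = 0" using root by (simp add: hom_map_mult[OF h] mK)
  qed (use that in blast)
next
  case False
  then show ?thesis using dual_hom_extend_transcendental[OF assms, of a 0] that by blast
qed

text \<open>The image of such a homomorphism determines it, and is a property of finite character.\<close>

definition dual_graph :: "'a::field dual set \<Rightarrow> bool" where
  "dual_graph G \<longleftrightarrow> 1 \<in> G \<and> (\<forall>x\<in>G. \<forall>y\<in>G. x - y \<in> G \<and> x * y \<in> G) \<and>
     (\<forall>x\<in>G. \<exists>y\<in>G. re y = inverse (re x)) \<and> (\<forall>x\<in>G. re x = 0 \<longrightarrow> x = 0)"

lemma dual_graph_image:
  assumes "dual_hom K h"
  shows "dual_graph (h ` K)"
proof -
  from assms have h: "is_subfield K" "hom_on K h" and re: "\<And>x. x \<in> K \<Longrightarrow> re (h x) = x"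
    by (auto simp: dual_hom_def)
  have "h 1 = 1" by (rule hom_one[OF h(2)])
  then have "1 \<in> h ` K" using sf_one[OF h(1)] by (metis imageI)
  moreover have "h x - h y \<in> h ` K \<and> h x * h y \<in> h ` K" if "x \<in> K" "y \<in> K" for x y
    using that by (auto simp: hom_diff[OF h, symmetric] hom_mult[OF h(2), symmetric] intro!: imageI sf_intros h)
  moreover have "\<exists>y\<in>h ` K. re y = inverse (re (h x))" if "x \<in> K" for x
    using that by (auto simp: re sf_inverse[OF h(1)])
  moreover have "h x = 0" if "x \<in> K" "re (h x) = 0" for x
    using that by (simp add: re hom_zero[OF h])
  ultimately show ?thesis unfolding dual_graph_def by blast
qed

lemma dual_graph_hom:
  assumes G: "dual_graph G"
  obtains h where "dual_hom (re ` G) h" "h ` re ` G = G"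
proof -
  define h where "h x = (THE z. z \<in> G \<and> re z = x)" for x
  have h: "h (re z) = z" if z: "z \<in> G" for z
    unfolding h_def
  proof (rule the_equality)
    fix y assume y: "y \<in> G \<and> re y = re z"
    then have "y - z \<in> G" "re (y - z) = 0" using G z by (auto simp: dual_graph_def)
    then have "y - z = 0" using G unfolding dual_graph_def by blast
    then show "y = z" by simp
  qed (use z in simp)
  have one: "1 \<in> G" and diff: "\<And>x y. x \<in> G \<Longrightarrow> y \<in> G \<Longrightarrow> x - y \<in> G" 
    and mult: "\<And>x y. x \<in> G \<Longrightarrow> y \<in> G \<Longrightarrow> x * y \<in> G"
    and inv: "\<And>x. x \<in> G \<Longrightarrow> \<exists>y\<in>G. re y = inverse (re x)" using G by (auto simp: dual_graph_def)
  have add: "x + y \<in> G" if "x \<in> G" "y \<in> G" for x y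
    using diff[OF that(1) diff[OF diff[OF that(2) that(2)] that(2)]] by simp
  have "is_subfield (re ` G)"
    unfolding is_subfield_def
  proof (intro conjI ballI)
    show "1 \<in> re ` G" using imageI[OF one, of re] by simp
  next
    fix x y assume "x \<in> re ` G" "y \<in> re ` G"
    then obtain z w where "z \<in> G" "w \<in> G" "x = re z" "y = re w" by blast
    then show "x - y \<in> re ` G" "x * y \<in> re ` G"
      using imageI[OF diff[of z w], of re] imageI[OF mult[of z w], of re] by simp_all
  next
    fix x assume "x \<in> re ` G"
    then obtain z where "z \<in> G" "x = re z" by blast
    then show "inverse x \<in> re ` G" using inv[of z] by (auto intro: rev_image_eqI)
  qed
  moreover have "hom_on (re ` G) h"
    unfolding hom_on_def
  proof (intro conjI ballI)
    show "h 1 = 1" using h[OF one] by simp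
  next
    fix x y assume "x \<in> re ` G" "y \<in> re ` G"
    then obtain z w where "z \<in> G" "w \<in> G" "x = re z" "y = re w" by blast
    then show "h (x + y) = h x + h y" "h (x * y) = h x * h y"
      using h[OF add[of z w]] h[OF mult[of z w]] h by simp_all
  qed
  ultimately have "dual_hom (re ` G) h" using h by (auto simp: dual_hom_def)
  moreover have "h ` re ` G = G" using h by force
  ultimately show ?thesis by (rule that)
qed

text \<open>
  One step prescribes the value at \<open>c\<close>; Zorn's lemma, applied to the images of homomorphisms into the
  dual numbers, does the rest.
\<close>

theorem derivation_extend:
  fixes E0 :: "'a::field_char_0 \<Rightarrow> 'a"
  assumes K: "is_subfield K" and E0: "derivation E0" and c: "\<not> alg_over K c"
  obtains E where "derivation E" "\<And>x. x \<in> K \<Longrightarrow> E x = E0 x" "E c = w"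
proof -
  have "dual_hom K (\<lambda>x. Dual x (E0 x))"
    unfolding dual_hom_def hom_on_def using K
    by (auto intro!: dual_eqI simp: derivation_add[OF E0] derivation_mult[OF E0] derivation_one[OF E0])
  from dual_hom_extend_transcendental[OF this c, of w] obtain \<tau>
    where \<tau>: "dual_hom (adjoin K c) \<tau>" "\<And>x. x \<in> K \<Longrightarrow> \<tau> x = Dual x (E0 x)" "\<tau> c = Dual c w" by metis
  define G0 where "G0 = \<tau> ` adjoin K c"
  define \<A> where "\<A> = {G. dual_graph G \<and> G0 \<subseteq> G}"
  have "G0 \<in> \<A>" using dual_graph_image[OF \<tau>(1)] by (simp add: \<A>_def G0_def)
  have "\<exists>M\<in>\<A>. \<forall>X\<in>\<A>. M \<subseteq> X \<longrightarrow> X = M"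
  proof (rule subset_Zorn_nonempty)
    show "\<A> \<noteq> {}" using \<open>G0 \<in> \<A>\<close> by blast
    fix \<C> assume C: "\<C> \<noteq> {}" "subset.chain \<A> \<C>"
    then have CA: "\<And>G. G \<in> \<C> \<Longrightarrow> dual_graph G \<and> G0 \<subseteq> G"
      by (auto simp: subset.chain_def \<A>_def)
    have two: "\<exists>G\<in>\<C>. x \<in> G \<and> y \<in> G" if xy: "x \<in> \<Union>\<C>" "y \<in> \<Union>\<C>" for x y
    proof -
      from xy obtain G1 G2 where G: "G1 \<in> \<C>" "x \<in> G1" "G2 \<in> \<C>" "y \<in> G2" by blast
      then have "G1 \<subseteq> G2 \<or> G2 \<subseteq> G1" using C(2) unfolding subset_chain_def by blast
      then show ?thesis using G by blast
    qed
    have "dual_graph (\<Union>\<C>)"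
      unfolding dual_graph_def
    proof (intro conjI ballI impI)
      show "1 \<in> \<Union>\<C>" using C(1) CA by (auto simp: dual_graph_def)
    next
      fix x y assume "x \<in> \<Union>\<C>" "y \<in> \<Union>\<C>"
      from two[OF this] obtain G where "G \<in> \<C>" "x \<in> G" "y \<in> G" by blast
      then show "x - y \<in> \<Union>\<C>" "x * y \<in> \<Union>\<C>" using CA[of G] by (auto simp: dual_graph_def)
    next
      fix x assume "x \<in> \<Union>\<C>"
      then obtain G where G: "G \<in> \<C>" "x \<in> G" by blast
      then obtain y where "y \<in> G" "re y = inverse (re x)" using CA[of G] by (auto simp: dual_graph_def)
      then show "\<exists>y\<in>\<Union>\<C>. re y = inverse (re x)" using G by blast
      show "x = 0" if "re x = 0" using that G CA[of G] by (auto simp: dual_graph_def)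
    qed
    moreover have "G0 \<subseteq> \<Union>\<C>" using C(1) CA by blast
    ultimately show "\<Union>\<C> \<in> \<A>" by (simp add: \<A>_def)
  qed
  then obtain M where MA: "M \<in> \<A>" and maxA: "\<forall>X\<in>\<A>. M \<subseteq> X \<longrightarrow> X = M" by blast
  then have M: "dual_graph M" "G0 \<subseteq> M" by (simp_all add: \<A>_def)
  have max: "G = M" if "dual_graph G" "M \<subseteq> G" for G
    using maxA that M(2) by (simp add: \<A>_def)
  from dual_graph_hom[OF M(1)] obtain h where h: "dual_hom (re ` M) h" "h ` re ` M = M" .
  have "a \<in> re ` M" for a
  proof -
    from dual_hom_extend[OF h(1), of a] obtain \<sigma> where \<sigma>: "dual_hom (adjoin (re ` M) a) \<sigma>"
      "\<And>x. x \<in> re ` M \<Longrightarrow> \<sigma> x = h x" by blast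
    have sf: "is_subfield (re ` M)" using h by (simp add: dual_hom_def)
    have "\<sigma> ` re ` M = h ` re ` M" by (rule image_cong) (simp_all add: \<sigma>(2))
    then have "M = \<sigma> ` re ` M" using h(2) by simp
    also have "\<dots> \<subseteq> \<sigma> ` adjoin (re ` M) a" by (intro image_mono subsetI adjoin_base sf)
    finally have "\<sigma> ` adjoin (re ` M) a = M" by (intro max dual_graph_image \<sigma>)
    then have "\<sigma> a \<in> M" using adjoin_gen[OF sf, of a] by blast
    moreover have "re (\<sigma> a) = a" using \<sigma>(1) adjoin_gen[OF sf, of a] by (simp add: dual_hom_def)
    ultimately show ?thesis using imageI[of "\<sigma> a" M re] by simp
  qed
  then have U: "re ` M = UNIV" by blast
  then have hU: "hom_on UNIV h" "\<And>x. re (h x) = x" using h by (auto simp: dual_hom_def)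
  have "derivation (\<lambda>x. ep (h x))"
    unfolding derivation_def using hom_add[OF hU(1)] hom_mult[OF hU(1)] hU(2) by simp
  moreover have hG: "h x = \<tau> x" if "x \<in> adjoin K c" for x
  proof -
    have "\<tau> x \<in> M" using that M(2) by (auto simp: G0_def)
    then obtain y where y: "h y = \<tau> x" using h(2) by (metis imageE)
    moreover have "re (\<tau> x) = x" using \<tau>(1) that by (simp add: dual_hom_def)
    ultimately show ?thesis using hU(2)[of y] by simp
  qed
  ultimately show ?thesis
    using that[of "\<lambda>x. ep (h x)"] \<tau>(2,3) hG adjoin_base[OF K] adjoin_gen[OF K] by simp
qed

section \<open>Rational functions and their residues\<close>

abbreviation const_eval :: "'a::field poly \<Rightarrow> 'a fls \<Rightarrow> 'a fls" where
  "const_eval p Y \<equiv> poly (map_poly fls_const p) Y"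

lemma hom_fls_const: "hom_on K (fls_const :: 'a::field \<Rightarrow> _)"
  by (simp add: hom_on_def fls_plus_const)

lemma const_eval_pCons: "const_eval (pCons c p) Y = fls_const c + Y * const_eval p Y"
  by (simp add: hom_map_pCons[OF is_subfield_UNIV hom_fls_const])

lemma const_eval_mult: "const_eval (p * q) Y = const_eval p Y * const_eval q Y"
  by (simp add: hom_map_mult[OF is_subfield_UNIV hom_fls_const])

lemma fls_deriv_const_eval: "fls_deriv (const_eval p Y) = const_eval (pderiv p) Y * fls_deriv Y"
proof (induction p)
  case (pCons c p)
  have "const_eval (pderiv (pCons c p)) Y = const_eval p Y + Y * const_eval (pderiv p) Y"
    by (simp add: pderiv_pCons hom_map_add[OF is_subfield_UNIV hom_fls_const] const_eval_pCons)
  then show ?case using pCons by (simp add: const_eval_pCons algebra_simps)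
qed simp

text \<open>Differentiating a relation of least degree satisfied by \<open>Y\<close> gives one of smaller degree.\<close>

lemma const_eval_eq_0:
  fixes p :: "'a::field_char_0 poly"
  assumes "fls_deriv Y \<noteq> 0"
  shows "const_eval p Y = 0 \<Longrightarrow> p = 0"
proof (induction "degree p" arbitrary: p rule: less_induct)
  case less
  show ?case
  proof (cases "degree p = 0")
    case True
    then obtain c where "p = [:c:]" by (rule degree_eq_zeroE)
    then show ?thesis using less.prems by (simp add: const_eval_pCons)
  next
    case False
    have "const_eval (pderiv p) Y * fls_deriv Y = 0"
      using less.prems fls_deriv_const_eval[of p Y] by simp
    then have "const_eval (pderiv p) Y = 0" using assms by simp
    then have "pderiv p = 0" using less.hyps[of "pderiv p"] False by (simp add: degree_pderiv)
    then show ?thesis using False by (simp add: pderiv_eq_0_iff)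
  qed
qed

lemma const_eval_at_point:
  fixes p :: "'a::field poly" and a :: 'a
  defines "Y \<equiv> fls_const a + fls_X"
  shows "low 0 (const_eval p Y) \<and> const_eval p Y $$ 0 = poly p a \<and> const_eval p Y $$ 1 = poly (pderiv p) a"
proof (induction p)
  case (pCons c p)
  have Y: "const_eval (pCons c p) Y = fls_const (c) + fls_const a * const_eval p Y + fls_X * const_eval p Y"
    by (simp add: const_eval_pCons Y_def algebra_simps)
  have nth: "const_eval (pCons c p) Y $$ i = (if i = 0 then c else 0) + a * const_eval p Y $$ i + const_eval p Y $$ (i - 1)" for i
    unfolding Y by (simp add: fls_X_times_conv_shift)
  show ?case
    using pCons.IH by (auto simp: nth low_def pderiv_pCons algebra_simps)
qed simp

lemma const_eval_at_infinity:
  "const_eval p fls_X_inv $$ i = (if i \<le> 0 then coeff p (nat (- i)) else 0)"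
proof (induction p arbitrary: i)
  case (pCons c p)
  have "const_eval (pCons c p) fls_X_inv $$ i = (if i = 0 then c else 0) + const_eval p fls_X_inv $$ (i + 1)"
    by (simp add: const_eval_pCons fls_X_inv_times_conv_shift)
  then show ?case unfolding pCons.IH
    by (cases "i = 0"; cases "i < 0") (auto simp: coeff_pCons nat_eq_iff split: nat.splits intro!: arg_cong[of _ _ "coeff p"])
qed simp

lemma fls_deriv_place: "fls_deriv (fls_const a + fls_X :: 'a::field_char_0 fls) \<noteq> 0"
  "fls_deriv (fls_X_inv :: 'a::field_char_0 fls) \<noteq> 0"
  by simp_all

lemma card_simple_roots:
  fixes Q :: "'a::field poly"
  assumes AC: "alg_closed_type TYPE('a)"
  shows "Q \<noteq> 0 \<Longrightarrow> (\<And>a. poly Q a = 0 \<Longrightarrow> poly (pderiv Q) a \<noteq> 0) \<Longrightarrow> card {a. poly Q a = 0} = degree Q"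
proof (induction "degree Q" arbitrary: Q)
  case 0
  then obtain c where "Q = [:c:]" by (metis degree_eq_zeroE)
  then show ?case using 0 by auto
next
  case (Suc n)
  then obtain a where a: "poly Q a = 0" using AC unfolding alg_closed_type_def by (metis zero_less_Suc)
  then have "[:-a, 1:] dvd Q" by (simp only: poly_eq_0_iff_dvd)
  then obtain R where R: "Q = [:-a, 1:] * R" by (rule dvdE)
  have R0: "R \<noteq> 0" using R Suc by auto
  have dR: "degree R = n" using Suc(2) R0 unfolding R by (subst (asm) degree_mult_eq) auto
  have pd: "poly (pderiv Q) b = poly R b + (b - a) * poly (pderiv R) b" for b
    unfolding R pderiv_mult by (simp add: pderiv_pCons algebra_simps)
  have "poly R a \<noteq> 0" using Suc(4)[OF a] pd[of a] by simp
  moreover have "{b. poly Q b = 0} = insert a {b. poly R b = 0}" unfolding R by auto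
  moreover have "card {b. poly R b = 0} = n"
    unfolding dR[symmetric]
  proof (rule Suc(1))
    fix b assume b: "poly R b = 0"
    then have "poly Q b = 0" unfolding R by simp
    then show "poly (pderiv R) b \<noteq> 0" using Suc(4)[of b] pd[of b] b by auto
  qed (use dR R0 in auto)
  ultimately show ?case using Suc(2) poly_roots_finite[OF R0] by simp
qed

text \<open>Lagrange interpolation, compared in the top coefficient.\<close>

lemma sum_of_residues:
  fixes Q N :: "'a::field poly"
  assumes AC: "alg_closed_type TYPE('a)" and Q: "Q \<noteq> 0" "degree Q = Suc D"
    and simple: "\<And>a. poly Q a = 0 \<Longrightarrow> poly (pderiv Q) a \<noteq> 0" and N: "degree N \<le> D"
  shows "coeff N D = lead_coeff Q * (\<Sum>a | poly Q a = 0. poly N a / poly (pderiv Q) a)"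
proof -
  define A where "A = {a. poly Q a = 0}"
  have fin: "finite A" unfolding A_def by (rule poly_roots_finite[OF Q(1)])
  have "\<exists>R. Q = [:-a, 1:] * R" if "a \<in> A" for a
    using that unfolding A_def by (metis mem_Collect_eq poly_eq_0_iff_dvd dvdE)
  then obtain R where R: "\<And>a. a \<in> A \<Longrightarrow> Q = [:-a, 1:] * R a" by metis
  have dR: "degree (R a) = D" and lR: "coeff (R a) D = lead_coeff Q" if "a \<in> A" for a
  proof -
    have R0: "R a \<noteq> 0" using R[OF that] Q by auto
    have "degree Q = 1 + degree (R a)" using R0 by (subst R[OF that], subst degree_mult_eq) auto
    then show d: "degree (R a) = D" using Q by simp
    have "lead_coeff Q = lead_coeff [:-a,1:] * lead_coeff (R a)"
      using arg_cong[OF R[OF that], of lead_coeff] by (simp only: lead_coeff_mult)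
    then show "coeff (R a) D = lead_coeff Q" using d by simp
  qed
  have off: "poly (R a) b = 0" if "a \<in> A" "b \<in> A" "a \<noteq> b" for a b
  proof -
    have "poly Q b = (b - a) * poly (R a) b" by (subst R[OF that(1)]) (simp add: algebra_simps)
    then show ?thesis using that by (simp add: A_def)
  qed
  have on: "poly (R a) a = poly (pderiv Q) a" if "a \<in> A" for a
    by (subst R[OF that], subst pderiv_mult) (simp add: pderiv_pCons)
  define M where "M = N - (\<Sum>a\<in>A. smult (poly N a / poly (pderiv Q) a) (R a))"
  have "poly M b = 0" if b: "b \<in> A" for b
  proof -
    have "(\<Sum>a\<in>A. poly N a / poly (pderiv Q) a * poly (R a) b) = (\<Sum>a\<in>{b}. poly N a / poly (pderiv Q) a * poly (R a) b)"
      by (rule sum.mono_neutral_right) (use fin b off in auto)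
    then show ?thesis using on[OF b] simple b by (simp add: M_def poly_sum A_def)
  qed
  moreover have "degree M \<le> D" unfolding M_def
    by (intro degree_diff_le N degree_sum_le fin) (use dR in \<open>auto intro: order.trans[OF degree_smult_le]\<close>)
  moreover have "card A = Suc D" unfolding A_def using card_simple_roots[OF AC Q(1) simple] Q(2) by simp
  ultimately have "M = 0"
    using card_mono[of "{x. poly M x = 0}" A] poly_roots_finite[of M] card_poly_roots_bound[of M]
    by (metis (mono_tags, lifting) Suc_n_not_le_n le_trans mem_Collect_eq subsetI)
  then have "N = (\<Sum>a\<in>A. smult (poly N a / poly (pderiv Q) a) (R a))" by (simp add: M_def)
  then have "coeff N D = (\<Sum>a\<in>A. poly N a / poly (pderiv Q) a * coeff (R a) D)"
    by (metis (no_types, lifting) coeff_smult coeff_sum sum.cong)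
  also have "\<dots> = lead_coeff Q * (\<Sum>a\<in>A. poly N a / poly (pderiv Q) a)"
    unfolding sum_distrib_left by (rule sum.cong) (simp_all add: lR mult.commute)
  finally show ?thesis by (simp add: A_def)
qed

text \<open>
  Here \<open>T a\<close> and \<open>Ti\<close> are the expansions of \<open>N0/Q0\<close> at \<open>a\<close> and at infinity. In lowest terms \<open>N/Q\<close>, the
  bounds on the orders say that \<open>Q\<close> has simple roots and that \<open>N\<close> has smaller degree than \<open>Q\<close>; the residue at
  a root \<open>a\<close> is \<open>N(a)/Q'(a)\<close>.
\<close>

lemma residue_theorem:
  fixes N0 Q0 :: "'a::field_char_0 poly"
  assumes AC: "alg_closed_type TYPE('a)" and Q0: "Q0 \<noteq> 0"
    and T: "\<And>a. const_eval Q0 (fls_const a + fls_X) * T a = const_eval N0 (fls_const a + fls_X)"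
    and Ti: "const_eval Q0 fls_X_inv * Ti = const_eval N0 fls_X_inv"
    and low: "\<And>a. low (-1) (T a)" "low 1 Ti"
  shows "finite {a. T a $$ (-1) \<noteq> 0}" "Ti $$ 1 = (\<Sum>a | T a $$ (-1) \<noteq> 0. T a $$ (-1))"
    "(\<And>a. T a $$ (-1) = 0) \<Longrightarrow> N0 = 0"
proof -
  define P where "P NQ \<longleftrightarrow> snd NQ \<noteq> 0 \<and> fst NQ * Q0 = N0 * snd NQ" for NQ
  have "P (N0, Q0)" using Q0 by (simp add: P_def)
  from ex_has_least_nat[of P "(N0, Q0)" "\<lambda>NQ. degree (snd NQ)", OF this]
  obtain N Q where NQ: "Q \<noteq> 0" "N * Q0 = N0 * Q"
    and min: "\<And>N' Q'. Q' \<noteq> 0 \<Longrightarrow> N' * Q0 = N0 * Q' \<Longrightarrow> degree Q \<le> degree Q'"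
    unfolding P_def by (metis fst_conv snd_conv prod.collapse)
  have eq: "const_eval Q Y * t = const_eval N Y"
    if "fls_deriv Y \<noteq> 0" "const_eval Q0 Y * t = const_eval N0 Y" for Y t
  proof -
    have nz: "const_eval Q0 Y \<noteq> 0" using const_eval_eq_0[OF that(1)] Q0 by blast
    have "const_eval Q0 Y * (const_eval Q Y * t) = const_eval N0 Y * const_eval Q Y"
      using that(2) by (metis mult.assoc mult.commute)
    also have "\<dots> = const_eval Q0 Y * const_eval N Y"
      using NQ(2) by (metis const_eval_mult mult.commute)
    finally show ?thesis using nz by simp
  qed
  have coprime: "poly N a \<noteq> 0" if "poly Q a = 0" for a
  proof
    assume "poly N a = 0"
    then have "[:-a, 1:] dvd N" "[:-a, 1:] dvd Q" using that by (simp_all only: poly_eq_0_iff_dvd)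
    then obtain N' Q' where NQ': "N = [:-a, 1:] * N'" "Q = [:-a, 1:] * Q'" by (auto elim!: dvdE)
    have "[:-a, 1:] * (N' * Q0) = [:-a, 1:] * (N0 * Q')"
      using NQ(2) unfolding NQ' by (simp only: mult_ac)
    then have "N' * Q0 = N0 * Q'" by (metis mult_left_cancel pCons_eq_0_iff zero_neq_one)
    moreover have "Q' \<noteq> 0" using NQ NQ' by auto
    moreover from this have "degree Q = 1 + degree Q'" unfolding NQ'(2) by (subst degree_mult_eq) auto
    ultimately show False using min[of Q' N'] by simp
  qed
  have at: "(if poly Q a = 0 then poly (pderiv Q) a * T a $$ (-1) = poly N a else T a $$ (-1) = 0)" for a
  proof -
    let ?Y = "fls_const a + fls_X"
    have e: "const_eval Q ?Y * T a = const_eval N ?Y" by (rule eq[OF fls_deriv_place(1) T])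
    note q = const_eval_at_point[of Q a] and n = const_eval_at_point[of N a]
    show ?thesis
    proof (cases "poly Q a = 0")
      case True
      then have "low 1 (const_eval Q ?Y)" using low_Suc[of 0 "const_eval Q ?Y"] q by simp
      from low_mult(2)[OF this low(1)[of a]] show ?thesis using True q n by (simp add: e)
    next
      case False
      have "low 0 (T a)" by (rule low_cancel[of 0 0 "const_eval Q ?Y"]) (use e q n False in auto)
      then show ?thesis using False by (simp add: low_def)
    qed
  qed
  then have res: "T a $$ (-1) = poly N a / poly (pderiv Q) a" "poly (pderiv Q) a \<noteq> 0" "T a $$ (-1) \<noteq> 0"
    if "poly Q a = 0" for a
    using that coprime[OF that] by (metis (full_types) mult_zero_left nonzero_mult_div_cancel_left, metis (full_types) mult_zero_left, metis (full_types) mult_zero_right)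
  have A: "{a. T a $$ (-1) \<noteq> 0} = {a. poly Q a = 0}" using at res(3) by (metis (full_types))
  show fin: "finite {a. T a $$ (-1) \<noteq> 0}" unfolding A by (rule poly_roots_finite[OF NQ(1)])
  define D where "D = degree Q"
  have e: "const_eval Q fls_X_inv * Ti = const_eval N fls_X_inv" by (rule eq[OF fls_deriv_place(2) Ti])
  have lQ: "low (- int D) (const_eval Q fls_X_inv)"
    by (auto simp: low_def const_eval_at_infinity D_def intro!: coeff_eq_0)
  have lN: "low (1 - int D) (const_eval N fls_X_inv)"
    unfolding e[symmetric] by (rule low_mult_eq(1)[OF lQ low(2)]) simp
  have topN: "const_eval N fls_X_inv $$ (1 - int D) = lead_coeff Q * Ti $$ 1"
    unfolding e[symmetric] by (subst low_mult_eq(2)[OF lQ low(2)]) (simp_all add: const_eval_at_infinity D_def)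
  have cN: "coeff N i = 0" if "D \<le> i" for i
    using low_nth[OF lN, of "- int i"] that by (simp add: const_eval_at_infinity)
  have "Ti $$ 1 = (\<Sum>a | poly Q a = 0. T a $$ (-1))"
  proof (cases D)
    case 0
    then have "{a. poly Q a = 0} = {}" using NQ(1) unfolding D_def by (metis (mono_tags, lifting) degree_eq_zeroE empty_Collect_eq pCons_eq_0_iff poly_0 poly_pCons add.right_neutral mult_zero_right)
    moreover have "lead_coeff Q * Ti $$ 1 = 0" using topN 0 by (simp add: const_eval_at_infinity)
    ultimately show ?thesis using NQ(1) by simp
  next
    case (Suc D')
    have dN: "degree N \<le> D'" by (rule degree_le) (use cN Suc in auto)
    have "nat (- (1 - int (Suc D'))) = D'" by simp
    then have "coeff N D' = lead_coeff Q * Ti $$ 1" using topN Suc by (simp add: const_eval_at_infinity)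
    also have "coeff N D' = lead_coeff Q * (\<Sum>a | poly Q a = 0. poly N a / poly (pderiv Q) a)"
      by (rule sum_of_residues[OF AC NQ(1) _ res(2) dN]) (use Suc in \<open>simp_all add: D_def\<close>)
    finally show ?thesis using NQ(1) res(1) by simp
  qed
  then show "Ti $$ 1 = (\<Sum>a | T a $$ (-1) \<noteq> 0. T a $$ (-1))" by (simp add: A)
  show "N0 = 0" if "\<And>a. T a $$ (-1) = 0"
  proof -
    have "{a. poly Q a = 0} = {}" using A that by simp
    then have "D = 0" using card_simple_roots[OF AC NQ(1) res(2)] by (simp add: D_def)
    then have "N = 0" using cN by (intro poly_eqI) simp
    then show ?thesis using NQ by simp
  qed
qed

section \<open>Embedding algebraic functions into Puiseux series\<close>

lemma coeff_prod_linear: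
  fixes rs :: "'a::comm_ring_1 list"
  defines "P \<equiv> \<lambda>rs. \<Prod>r\<leftarrow>rs. [:-r, 1:]"
  shows "degree (P rs) \<le> length rs" "coeff (P rs) (length rs) = 1"
    "coeff (P rs) 0 = (\<Prod>r\<leftarrow>rs. - r)" "rs \<noteq> [] \<Longrightarrow> coeff (P rs) (length rs - 1) = - sum_list rs"
proof -
  have "coeff (P rs) (length rs) = 1 \<and> (\<forall>i>length rs. coeff (P rs) i = 0) \<and> coeff (P rs) 0 = (\<Prod>r\<leftarrow>rs. - r) \<and>
    (rs \<noteq> [] \<longrightarrow> coeff (P rs) (length rs - 1) = - sum_list rs)"
  proof (induction rs)
    case Nil
    then show ?case by (simp add: P_def)
  next
    case (Cons r rs)
    have PC: "P (r # rs) = [:-r, 1:] * P rs" by (simp add: P_def)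
    have c: "coeff (P (r # rs)) (Suc i) = coeff (P rs) i - r * coeff (P rs) (Suc i)" 
      "coeff (P (r # rs)) 0 = - r * coeff (P rs) 0" for i
      unfolding PC by (simp_all add: algebra_simps)
    show ?case
    proof (cases "rs = []")
      case True
      then show ?thesis by (auto simp: P_def coeff_pCons split: nat.splits)
    next
      case False
      then obtain n where n: "length rs = Suc n" by (cases rs) auto
      have "\<forall>i>length (r # rs). coeff (P (r # rs)) i = 0"
      proof (intro allI impI)
        fix i assume "i > length (r # rs)"
        then obtain j where "i = Suc j" "j > length rs" by (cases i) auto
        then show "coeff (P (r # rs)) i = 0" using Cons by (simp add: c)
      qed
      then show ?thesis using Cons False n by (simp add: c)
    qed
  qed
  then show "degree (P rs) \<le> length rs" "coeff (P rs) (length rs) = 1"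
    "coeff (P rs) 0 = (\<Prod>r\<leftarrow>rs. - r)" "rs \<noteq> [] \<Longrightarrow> coeff (P rs) (length rs - 1) = - sum_list rs"
    by (auto intro: degree_le)
qed

lemma hom_comp_ramify:
  fixes \<Psi> :: "'a::field \<Rightarrow> 'b::field fls"
  assumes "hom_on K \<Psi>" "e > 0"
  shows "hom_on K (\<lambda>x. ramify e (\<Psi> x))"
  using assms by (simp add: hom_on_def)

text \<open>
  Every Puiseux root of the minimal polynomial of \<open>z\<close> is the image of \<open>z\<close> under an embedding, so
  differential equations satisfied by \<open>z\<close> can be read off in each root separately.
\<close>

lemma puiseux_embeddings:
  fixes \<Psi> :: "'a::field \<Rightarrow> 'b::field_char_0 fls"
  assumes AC: "alg_closed_type TYPE('b)" and K: "is_subfield K" and \<Psi>: "hom_on K \<Psi>" and m: "is_minpoly K z m"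
  obtains e rs where "e > 0" "length rs = degree m" "map_poly (\<lambda>x. ramify e (\<Psi> x)) m = (\<Prod>r\<leftarrow>rs. [:-r, 1:])"
    "\<And>r. r \<in> set rs \<Longrightarrow> \<exists>\<tau>. hom_on (adjoin K z) \<tau> \<and> (\<forall>x\<in>K. \<tau> x = ramify e (\<Psi> x)) \<and> \<tau> z = r"
proof -
  have mK: "m \<in> poly_over K" and lm: "lead_coeff m = 1" using m by (auto simp: is_minpoly_def)
  have "map_poly \<Psi> m \<noteq> 0" using hom_map_eq_0_iff[OF K \<Psi> mK] lm by auto
  from newton_puiseux[OF AC this] obtain e c rs where e: "e > 0"
    and split: "map_poly (ramify e) (map_poly \<Psi> m) = smult c (\<Prod>r\<leftarrow>rs. [:-r, 1:])" by blast
  let ?\<Psi> = "\<lambda>x. ramify e (\<Psi> x)" and ?P = "\<Prod>r\<leftarrow>rs. [:-r, 1:]"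
  note \<Psi>e = hom_comp_ramify[OF \<Psi> e]
  have me: "map_poly ?\<Psi> m = smult c ?P"
    unfolding split[symmetric] by (rule poly_eqI) (simp add: coeff_map_poly hom_zero[OF K \<Psi>])
  have dP: "degree ?P = length rs"
    using coeff_prod_linear(1,2)[of rs] le_degree[of ?P "length rs"] by simp
  have lm': "lead_coeff (map_poly ?\<Psi> m) = 1"
    using hom_degree[OF K \<Psi>e mK] by (simp add: hom_coeff[OF K \<Psi>e] lm hom_one[OF \<Psi>e])
  have "c = 1" using lm' coeff_prod_linear(2)[of rs] unfolding me by (cases "c = 0") (simp_all add: dP)
  then have me: "map_poly ?\<Psi> m = ?P" using me by simp
  have "length rs = degree m" using hom_degree[OF K \<Psi>e mK] dP by (simp add: me)
  moreover have "\<exists>\<tau>. hom_on (adjoin K z) \<tau> \<and> (\<forall>x\<in>K. \<tau> x = ?\<Psi> x) \<and> \<tau> z = r" if "r \<in> set rs" for r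
  proof -
    have "poly ?P r = 0" using that by (induction rs) auto
    then have "poly (map_poly ?\<Psi> m) r = 0" by (simp add: me)
    from hom_extend_algebraic[OF K \<Psi>e m this] show ?thesis by metis
  qed
  ultimately show ?thesis using that e me by blast
qed

section \<open>Closure of simple extensions under derivations\<close>

lemma derivation_divide:
  assumes D: "derivation D" and y: "y \<noteq> 0"
  shows "D (x / y) = (D x - (x / y) * D y) / y"
proof -
  have "D x = D ((x / y) * y)" using y by simp
  also have "\<dots> = D (x / y) * y + (x / y) * D y" by (rule derivation_mult[OF D])
  finally show ?thesis using y by (simp add: field_simps)
qed

lemma derivation_poly:
  assumes D: "derivation D"
  shows "D (poly p a) = poly (map_poly D p) a + poly (pderiv p) a * D a"
  by (induction p) (simp_all add: derivation_zero[OF D] map_poly_pCons derivation_add[OF D] derivation_mult[OF D]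
    pderiv_pCons algebra_simps)

lemma derivation_poly_in:
  assumes D: "derivation D" and L: "is_subfield L" "K \<subseteq> L" and DK: "\<And>x. x \<in> K \<Longrightarrow> D x \<in> L"
    and a: "a \<in> L" and p: "p \<in> poly_over K"
  shows "poly (map_poly D p) a \<in> L" "poly p a \<in> L" "poly (pderiv p) a \<in> L"
proof -
  have "map_poly D p \<in> poly_over L"
    using DK p by (auto simp: poly_over_def coeff_map_poly derivation_zero[OF D])
  moreover have "p \<in> poly_over L" by (rule poly_over_mono[OF L(2) p])
  ultimately show "poly (map_poly D p) a \<in> L" "poly p a \<in> L" "poly (pderiv p) a \<in> L"
    by (auto intro!: poly_over_eval[OF L(1)] po_pderiv[OF L(1)] a)
qed

lemma derivation_adjoin:
  assumes D: "derivation D" and L: "is_subfield L" "K \<subseteq> L" and DK: "\<And>x. x \<in> K \<Longrightarrow> D x \<in> L"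
    and a: "a \<in> L" "D a \<in> L" and x: "x \<in> adjoin K a"
  shows "D x \<in> L"
proof -
  note P = derivation_poly_in[OF D L DK a(1)]
  have Dp: "D (poly p a) \<in> L" if "p \<in> poly_over K" for p
    unfolding derivation_poly[OF D] using P[OF _ that] by (intro sf_intros L a)
  from x obtain p q where pq: "x = poly p a / poly q a" "p \<in> poly_over K" "q \<in> poly_over K" "poly q a \<noteq> 0"
    unfolding adjoin_def by blast
  show ?thesis unfolding pq(1) derivation_divide[OF D pq(4)]
    using P[OF _ pq(2)] P[OF _ pq(3)] Dp[OF pq(2)] Dp[OF pq(3)] by (intro sf_intros L)
qed

text \<open>Differentiating \<open>m(a) = 0\<close> expresses \<open>D a\<close> rationally through \<open>a\<close>.\<close>

lemma derivation_algebraic: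
  fixes D :: "'a::field_char_0 \<Rightarrow> 'a"
  assumes D: "derivation D" and K: "is_subfield K" and a: "alg_over K a"
    and DK: "\<And>x. x \<in> K \<Longrightarrow> D x \<in> adjoin K a" and x: "x \<in> adjoin K a"
  shows "D x \<in> adjoin K a"
proof -
  note L = is_subfield_adjoin[OF K, of a]
  have sub: "K \<subseteq> adjoin K a" by (auto intro: adjoin_base[OF K])
  note ga = adjoin_gen[OF K, of a]
  obtain m where m: "is_minpoly K a m" using minpoly_exists[OF K a] by blast
  then have mK: "m \<in> poly_over K" and m': "poly (pderiv m) a \<noteq> 0" and m0: "poly m a = 0"
    by (auto simp: is_minpoly_def)
  have "0 = poly (map_poly D m) a + poly (pderiv m) a * D a"
    using derivation_poly[OF D, of m a] by (simp add: m0 derivation_zero[OF D])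
  then have "D a = - poly (map_poly D m) a / poly (pderiv m) a" using m' by (simp add: field_simps add_eq_0_iff)
  moreover have "- poly (map_poly D m) a / poly (pderiv m) a \<in> adjoin K a"
    by (intro sf_divide sf_minus L derivation_poly_in[OF D L sub _ ga mK] DK)
  ultimately have "D a \<in> adjoin K a" by simp
  from derivation_adjoin[OF D L sub DK ga this x] show ?thesis .
qed

text \<open>
  The difference of the two sides is a derivation along \<open>\<tau>\<close>, to which \<open>deriv_along_zero\<close> applies first
  on \<open>K(y)\<close> and then on \<open>K(y)(z)\<close>.
\<close>

lemma derivations_agree:
  fixes \<tau> :: "'a::field_char_0 \<Rightarrow> 'b::field"
  assumes K: "is_subfield K" and z: "alg_over (adjoin K y) z"
    and \<tau>: "hom_on (adjoin (adjoin K y) z) \<tau>"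
    and D: "derivation D" and DF: "\<And>x. x \<in> adjoin (adjoin K y) z \<Longrightarrow> D x \<in> adjoin (adjoin K y) z"
    and D': "derivation D'" and eqK: "\<And>x. x \<in> K \<Longrightarrow> D' (\<tau> x) = \<tau> (D x)" and eqy: "D' (\<tau> y) = \<tau> (D y)"
    and x: "x \<in> adjoin (adjoin K y) z"
  shows "D' (\<tau> x) = \<tau> (D x)"
proof -
  let ?k = "adjoin K y" let ?F = "adjoin ?k z"
  define \<Delta> where "\<Delta> x = D' (\<tau> x) - \<tau> (D x)" for x
  have k: "is_subfield ?k" by (rule is_subfield_adjoin[OF K])
  have F: "is_subfield ?F" by (rule is_subfield_adjoin[OF k])
  have kF: "?k \<subseteq> ?F" by (auto intro: adjoin_base[OF k])
  have \<Delta>: "deriv_along ?F \<tau> \<Delta>"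
    unfolding deriv_along_def \<Delta>_def
    using hom_add[OF \<tau>] hom_mult[OF \<tau>] sf_mult[OF F] DF
    by (simp add: derivation_add[OF D] derivation_add[OF D'] derivation_mult[OF D] derivation_mult[OF D'] algebra_simps)
  have \<Delta>k: "\<Delta> x = 0" if "x \<in> ?k" for x
  proof (rule deriv_along_zero[OF K hom_on_subset[OF \<tau> kF] _ _ _ that])
    show "deriv_along ?k \<tau> \<Delta>" using \<Delta> kF by (auto simp: deriv_along_def)
  qed (auto simp: \<Delta>_def eqK eqy)
  have "\<Delta> x = 0" by (rule deriv_along_zero[OF k \<tau> \<Delta> \<Delta>k _ x]) (use z in auto)
  then show ?thesis by (simp add: \<Delta>_def)
qed

section \<open>Local analysis of the Schwarzian equation\<close>

text \<open>
  The coefficient of the equation in terms of the squares \<open>A, B, C\<close> of the exponent differences at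
  \<open>\<infinity>, 0, 1\<close>.
\<close>

definition fuchs_R :: "'a::field \<Rightarrow> 'a \<Rightarrow> 'a \<Rightarrow> 'a \<Rightarrow> 'a" where
  "fuchs_R A B C y = 1 / 2 * ((1 - B) / y\<^sup>2 + (1 - C) / (y - 1)\<^sup>2 + (B + C - A - 1) / (y * (y - 1)))"

lemma hom_fuchs_R:
  fixes \<tau> :: "'a::field \<Rightarrow> 'b::field"
  assumes "is_subfield F" "hom_on F \<tau>" "A \<in> F" "B \<in> F" "C \<in> F" "y \<in> F"
  shows "\<tau> (fuchs_R A B C y) = fuchs_R (\<tau> A) (\<tau> B) (\<tau> C) (\<tau> y)" "fuchs_R A B C y \<in> F"
  unfolding fuchs_R_def using assms
  by (simp_all add: hom_mult[OF assms(2)] hom_divide[OF assms(1,2)] hom_add[OF assms(2)] hom_diff[OF assms(1,2)]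
    hom_power[OF assms(1,2)] hom_numeral[OF assms(1,2)] hom_one[OF assms(2)] sf_intros)

text \<open>The point \<open>y = a\<close>, or \<open>y = \<infinity>\<close>, in a parameter of ramification index \<open>e\<close>.\<close>

definition place :: "bool \<Rightarrow> 'a \<Rightarrow> nat \<Rightarrow> 'a::field fls" where
  "place fin a e = (if fin then fls_const a + fls_X_intpow (int e) else fls_X_intpow (- int e))"

text \<open>The order of \<open>y - a\<close>, respectively of \<open>y\<close> at infinity, is \<open>psgn fin * e\<close>.\<close>

definition psgn :: "bool \<Rightarrow> int" where
  "psgn fin = (if fin then 1 else -1)"

lemma place_1: "place True a 1 = fls_const a + fls_X" "place False a 1 = fls_X_inv"
  by (simp_all add: place_def fls_X_conv_shift_1 fls_X_inv_conv_shift_1)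

lemma ramify_place: "e > 0 \<Longrightarrow> ramify e (place fin a 1) = place fin a e" for a :: "'a::field"
  by (simp add: place_def)

lemma euler_nth: "(fls_X * fls_deriv f) $$ n = of_int n * f $$ n" for f :: "'a::comm_ring_1 fls"
  by (simp add: fls_X_times_conv_shift)

lemma low_euler: "low N f \<Longrightarrow> low N (fls_X * fls_deriv f)" for f :: "'a::comm_ring_1 fls"
  by (simp add: low_def euler_nth)

lemma X_intpow_mult: "fls_X_intpow i * fls_X_intpow j = (fls_X_intpow (i + j) :: 'a::comm_ring_1 fls)"
  by (simp add: fls_shifted_times_simps add.commute)

lemma low_X_intpow [simp]: "low N (fls_X_intpow N :: 'a::zero_neq_one fls)"
  by (simp add: low_def)

text \<open>The form that the derivation of a differential field takes in Puiseux expansions.\<close>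

definition dhat :: "('a \<Rightarrow> 'a) \<Rightarrow> 'a fls \<Rightarrow> 'a fls \<Rightarrow> 'a::field fls" where
  "dhat D \<kappa> f = fls_map D f + \<kappa> * (fls_X * fls_deriv f)"

lemma derivation_dhat:
  assumes "derivation D"
  shows "derivation (dhat D \<kappa>)"
  using derivation_fls_map[OF assms]
  by (simp add: derivation_def dhat_def algebra_simps)

lemma fls_map_const: "D 0 = 0 \<Longrightarrow> fls_map D (fls_const c) = fls_const (D c)"
  by (rule fls_eqI) (simp add: fls_map_nth)

lemma fls_map_X_intpow: "D 0 = 0 \<Longrightarrow> D 1 = 0 \<Longrightarrow> fls_map D (fls_X_intpow n) = 0"
  by (rule fls_eqI) (simp add: fls_map_nth)

lemma dhat_const: "D 0 = 0 \<Longrightarrow> dhat D \<kappa> (fls_const c) = fls_const (D c)"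
  by (simp add: dhat_def fls_map_const)

lemma low_dhat:
  assumes D: "derivation D" and k: "k < 0" "low k \<kappa>" and f: "low m f"
  shows "low (m + k) (dhat D \<kappa> f)" "dhat D \<kappa> f $$ (m + k) = \<kappa> $$ k * (of_int m * f $$ m)"
proof -
  have 1: "low m (fls_map D f)" by (rule low_map[of D, OF derivation_zero[OF D] f])
  have 2: "low (m + k) (\<kappa> * (fls_X * fls_deriv f))"
    by (rule low_mult_eq(1)[OF k(2) low_euler[OF f]]) simp
  show "low (m + k) (dhat D \<kappa> f)"
    unfolding dhat_def by (rule low_add[OF low_mono[OF 1] 2]) (use k in simp)
  have "(\<kappa> * (fls_X * fls_deriv f)) $$ (m + k) = \<kappa> $$ k * (of_int m * f $$ m)"
    using low_mult_eq(2)[OF k(2) low_euler[OF f], of "m + k"] by (simp add: euler_nth)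
  then show "dhat D \<kappa> f $$ (m + k) = \<kappa> $$ k * (of_int m * f $$ m)"
    unfolding dhat_def using low_nth[OF 1, of "m + k"] k by simp
qed

text \<open>The factor \<open>\<kappa>\<close> for which \<open>\<kappa> X d/dX\<close> maps the function \<open>y\<close> to \<open>w\<close>.\<close>

definition kap :: "bool \<Rightarrow> nat \<Rightarrow> 'a fls \<Rightarrow> 'a::field_char_0 fls" where
  "kap fin e w = fls_const (of_int (psgn fin) / of_nat e) * (fls_X_intpow (- psgn fin * int e) * w)"

lemma kap_place:
  assumes "e > 0"
  shows "kap fin e w * (fls_X * fls_deriv (place fin a e)) = w"
proof -
  define s where "s = psgn fin"
  have s: "s * s = 1" by (simp add: s_def psgn_def)
  have "fls_X * fls_deriv (place fin a e) = fls_const (of_int s * of_nat e) * fls_X_intpow (s * int e)"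
    by (rule fls_eqI) (auto simp: euler_nth place_def s_def psgn_def)
  then have "kap fin e w * (fls_X * fls_deriv (place fin a e)) =
      (fls_const (of_int s / of_nat e) * fls_const (of_int s * of_nat e)) * ((fls_X_intpow (- s * int e) * fls_X_intpow (s * int e)) * w)"
    by (simp only: kap_def s_def mult_ac)
  also have "fls_X_intpow (- s * int e) * fls_X_intpow (s * int e) = (1 :: 'a fls)"
    by (simp only: X_intpow_mult) simp
  also have "fls_const (of_int s / of_nat e) * fls_const (of_int s * of_nat e) = (1 :: 'a fls)"
    using assms s by (simp flip: of_int_mult)
  finally show ?thesis by simp
qed

lemma low_kap:
  assumes "low m w"
  shows "low (m - psgn fin * int e) (kap fin e w)"
    "kap fin e w $$ (m - psgn fin * int e) = of_int (psgn fin) / of_nat e * w $$ m"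
proof -
  have l: "low (- psgn fin * int e) (fls_X_intpow (- psgn fin * int e) :: 'a fls)" by (rule low_X_intpow)
  have c: "low 0 (fls_const (of_int (psgn fin) / of_nat e :: 'a))" by simp
  have m1: "low (m - psgn fin * int e) (fls_X_intpow (- psgn fin * int e) * w)"
    by (rule low_mult_eq(1)[OF l assms]) simp
  have m2: "(fls_X_intpow (- psgn fin * int e) * w) $$ (m - psgn fin * int e) = w $$ m"
    by (subst low_mult_eq(2)[OF l assms]) simp_all
  show "low (m - psgn fin * int e) (kap fin e w)"
    unfolding kap_def by (rule low_mult_eq(1)[OF c m1]) simp
  show "kap fin e w $$ (m - psgn fin * int e) = of_int (psgn fin) / of_nat e * w $$ m"
    unfolding kap_def using m2 by simp
qed

lemma low_inverse:
  fixes f :: "'a::field fls"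
  assumes "low a f" "f $$ a \<noteq> 0"
  shows "low (- a) (inverse f)" "inverse f $$ (- a) = inverse (f $$ a)"
proof -
  have f0: "f \<noteq> 0" using assms by auto
  show l: "low (- a) (inverse f)"
    by (rule low_cancel[OF _ assms]) (use f0 in simp)
  have "f $$ a * inverse f $$ (- a) = 1"
    using low_mult(2)[OF assms(1) l] f0 by simp
  then show "inverse f $$ (- a) = inverse (f $$ a)" by (metis inverse_unique)
qed

text \<open>The coefficient of \<open>1/(y - c)\<close> at the order of \<open>1/(y - a)\<close>, respectively of \<open>1/y\<close> at infinity.\<close>

definition pol :: "bool \<Rightarrow> 'a \<Rightarrow> 'a \<Rightarrow> 'a::field" where
  "pol fin a c = (if fin \<and> a \<noteq> c then 0 else 1)"

lemma place_inverse:
  fixes a c :: "'a::field" and fin :: bool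
  assumes e: "e > 0"
  defines "N \<equiv> - psgn fin * int e"
  shows "low N (inverse (place fin a e - fls_const c))" "inverse (place fin a e - fls_const c) $$ N = pol fin a c"
proof -
  let ?f = "place fin a e - fls_const c"
  have "low N (inverse ?f) \<and> inverse ?f $$ N = pol fin a c"
  proof (cases "fin \<and> a \<noteq> c")
    case True
    have "low 0 ?f" "?f $$ 0 = a - c" using True e by (auto simp: place_def low_def)
    then have "low 0 (inverse ?f)" using low_inverse[of 0 ?f] True by simp
    then show ?thesis using e True low_mono[of 0 "inverse ?f" N] low_nth[of 0 "inverse ?f" N]
      by (simp add: N_def psgn_def pol_def)
  next
    case False
    have "low (- N) ?f" "?f $$ (- N) = 1" using False e by (auto simp: place_def low_def N_def psgn_def)
    then show ?thesis using low_inverse[of "- N" ?f] False by (auto simp: pol_def)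
  qed
  then show "low N (inverse ?f)" "inverse ?f $$ N = pol fin a c" by auto
qed

text \<open>The square of the exponent difference at the place; it is \<open>1\<close> at ordinary points.\<close>

definition expo2 :: "'a \<Rightarrow> 'a \<Rightarrow> 'a \<Rightarrow> bool \<Rightarrow> 'a \<Rightarrow> 'a::field" where
  "expo2 A B C fin a = (if fin then if a = 0 then B else if a = 1 then C else 1 else A)"

text \<open>
  If \<open>\<rho>\<close> is the coefficient of the double pole of \<open>R\<close>, the indicial equation \<open>r\<^sup>2/2 - r + \<rho> = 0\<close> reads
  \<open>(r - 1)\<^sup>2 = 1 - 2\<rho>\<close>.
\<close>

lemma place_fuchs_R:
  fixes A B C a :: "'a::field_char_0" and fin :: bool
  assumes e: "e > 0"
  defines "R \<equiv> fuchs_R (fls_const A) (fls_const B) (fls_const C) (place fin a e)"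
    and "N \<equiv> - psgn fin * int e"
  shows "low (2 * N) R" "1 - 2 * R $$ (2 * N) = expo2 A B C fin a"
proof -
  let ?Y = "inverse (place fin a e)" and ?Z = "inverse (place fin a e - 1)"
  have Y: "low N ?Y" "?Y $$ N = pol fin a 0" and Z: "low N ?Z" "?Z $$ N = pol fin a 1"
    using place_inverse[OF e, of fin a 0] place_inverse[OF e, of fin a 1] by (simp_all add: N_def)
  have h: "(1 / 2 :: 'a fls) = fls_const (1 / 2)"
    using hom_divide[OF is_subfield_UNIV hom_fls_const, of "1::'a" 2] by simp
  have R: "R = fls_const (1/2) * (fls_const (1 - B) * (?Y * ?Y) + fls_const (1 - C) * (?Z * ?Z) + fls_const (B + C - A - 1) * (?Y * ?Z))"
    unfolding R_def fuchs_R_def h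
    by (simp only: divide_inverse[of _ "place fin a e * _"] divide_inverse[of _ "_\<^sup>2"]
      divide_inverse[of _ "(place fin a e - 1) * _"] power2_eq_square
      inverse_mult_distrib fls_plus_const[symmetric] fls_minus_const[symmetric] fls_const_1)
  have l: "low (2 * N) (?Y * ?Y)" "low (2 * N) (?Z * ?Z)" "low (2 * N) (?Y * ?Z)"
    using low_mult(1)[OF Y(1) Y(1)] low_mult(1)[OF Z(1) Z(1)] low_mult(1)[OF Y(1) Z(1)] by (simp_all only: mult_2)
  have n: "(?Y * ?Y) $$ (2 * N) = pol fin a 0 * pol fin a 0" "(?Z * ?Z) $$ (2 * N) = pol fin a 1 * pol fin a 1"
    "(?Y * ?Z) $$ (2 * N) = pol fin a 0 * pol fin a 1"
    using low_mult(2)[OF Y(1) Y(1)] low_mult(2)[OF Z(1) Z(1)] low_mult(2)[OF Y(1) Z(1)]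
    by (simp_all only: mult_2 Y(2) Z(2))
  show "low (2 * N) R"
    using l unfolding R by (auto simp: low_def)
  have "R $$ (2 * N) = 1 / 2 * ((1 - B) * (pol fin a 0 * pol fin a 0) + (1 - C) * (pol fin a 1 * pol fin a 1) + (B + C - A - 1) * (pol fin a 0 * pol fin a 1))"
    unfolding R by (simp add: n)
  then have "2 * R $$ (2 * N) = (1 - B) * (pol fin a 0 * pol fin a 0) + (1 - C) * (pol fin a 1 * pol fin a 1) + (B + C - A - 1) * (pol fin a 0 * pol fin a 1)"
    by (simp add: mult.commute)
  then show "1 - 2 * R $$ (2 * N) = expo2 A B C fin a"
    by (cases fin; cases "a = 0"; cases "a = 1") (simp_all only: expo2_def pol_def, simp_all)
qed

text \<open>Order one: \<open>m/e\<close> is the exponent of \<open>y'\<close> as a function of the local parameter. When it is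
  so small that \<open>y' d/dy\<close> dominates the derivation of the coefficients, the equation forces an
  indicial equation on it.\<close>

lemma order1_leading:
  fixes \<phi> R :: "'a::field_char_0 fls"
  assumes D: "derivation D" and e: "e > 0" and s: "s * s = 1" and \<phi>: "low m \<phi>" "\<phi> $$ m \<noteq> 0" and neg: "m - s * int e < 0"
    and \<kappa>: "low (m - s * int e) \<kappa>" "\<kappa> $$ (m - s * int e) = of_int s / of_nat e * \<phi> $$ m"
    and R: "low (- 2 * s * int e) R"
    and eq: "\<phi> * dhat D \<kappa> (dhat D \<kappa> \<phi>) = fls_const (3/2) * (dhat D \<kappa> \<phi> * dhat D \<kappa> \<phi>) - ((\<phi> * \<phi>) * (\<phi> * \<phi>)) * R"
  shows "(of_int (m - s * int e))\<^sup>2 = (of_nat e)\<^sup>2 * (1 - 2 * R $$ (- 2 * s * int e))"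
proof -
  define k where "k = m - s * int e"
  define c where "c = \<phi> $$ m"
  define \<kappa>0 where "\<kappa>0 = \<kappa> $$ k"
  have k: "k < 0" "low k \<kappa>" using neg \<kappa> by (simp_all add: k_def)
  note 1 = low_dhat[OF D k \<phi>(1)]
  note 2 = low_dhat[OF D k 1(1)]
  have L: "(\<phi> * dhat D \<kappa> (dhat D \<kappa> \<phi>)) $$ (2 * m + 2 * k) = c * (\<kappa>0 * (of_int (m + k) * (\<kappa>0 * (of_int m * c))))"
    by (subst low_mult_eq(2)[OF \<phi>(1) 2(1)], simp) (simp only: 1(2) 2(2) c_def \<kappa>0_def)
  have R1: "(dhat D \<kappa> \<phi> * dhat D \<kappa> \<phi>) $$ (2 * m + 2 * k) = (\<kappa>0 * (of_int m * c)) * (\<kappa>0 * (of_int m * c))"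
    by (subst low_mult_eq(2)[OF 1(1) 1(1)], simp) (simp only: 1(2) c_def \<kappa>0_def)
  have p2: "low (2 * m) (\<phi> * \<phi>)" "(\<phi> * \<phi>) $$ (2 * m) = c * c"
    using low_mult_eq[OF \<phi>(1) \<phi>(1), of "2 * m"] by (simp_all add: c_def)
  have p4: "low (4 * m) ((\<phi> * \<phi>) * (\<phi> * \<phi>))" "((\<phi> * \<phi>) * (\<phi> * \<phi>)) $$ (4 * m) = (c * c) * (c * c)"
    using low_mult_eq[OF p2(1) p2(1), of "4 * m"] by (simp_all add: p2(2))
  have "(((\<phi> * \<phi>) * (\<phi> * \<phi>)) * R) $$ (2 * m + 2 * k) = (c * c) * (c * c) * R $$ (- 2 * s * int e)"
    by (subst low_mult_eq(2)[OF p4(1) R], simp add: k_def) (simp only: p4(2))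
  with L R1 have main: "c * (\<kappa>0 * (of_int (m + k) * (\<kappa>0 * (of_int m * c)))) =
      3/2 * ((\<kappa>0 * (of_int m * c)) * (\<kappa>0 * (of_int m * c))) - (c * c) * (c * c) * R $$ (- 2 * s * int e)"
    using arg_cong[OF eq, of "\<lambda>f. f $$ (2 * m + 2 * k)"] by simp
  have \<kappa>0: "\<kappa>0 * of_nat e = of_int s * c" using \<kappa>(2) e by (simp add: \<kappa>0_def k_def c_def)
  define E :: 'a where "E = of_nat e"
  define S :: 'a where "S = of_int s"
  define M :: 'a where "M = of_int m"
  define r where "r = R $$ (- 2 * s * int e)"
  have S: "S * S = 1" using s unfolding S_def by (metis of_int_1 of_int_mult)
  have E: "E \<noteq> 0" using e by (simp add: E_def)
  have c: "c \<noteq> 0" using \<phi> by (simp add: c_def)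
  have \<kappa>E: "\<kappa>0 * E = S * c" using \<kappa>0 by (simp add: E_def S_def)
  have Mk: "of_int (m + k) = 2 * M - S * E" by (simp add: k_def M_def S_def E_def)
  have eq0: "c * (\<kappa>0 * ((2 * M - S * E) * (\<kappa>0 * (M * c)))) = 3/2 * ((\<kappa>0 * (M * c)) * (\<kappa>0 * (M * c))) - (c * c) * (c * c) * r"
    using main unfolding Mk r_def M_def by simp
  have "(\<kappa>0 * E) * (\<kappa>0 * E) * ((2 * M - S * E) * M * 2 * (c * c)) =
      (c * (\<kappa>0 * ((2 * M - S * E) * (\<kappa>0 * (M * c))))) * (2 * (E * E))"
    by (simp add: algebra_simps)
  also have "\<dots> = (\<kappa>0 * E) * (\<kappa>0 * E) * (3 * (M * M) * (c * c)) - 2 * (E * E) * ((c * c) * (c * c)) * r"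
    unfolding eq0 by (simp add: algebra_simps)
  finally have "(c * c) * (c * c) * ((S * S) * (2 * M - S * E) * M * 2) = (c * c) * (c * c) * (3 * (S * S) * (M * M) - 2 * (E * E) * r)"
    unfolding \<kappa>E by (simp add: algebra_simps)
  then have "(S * S) * (2 * M - S * E) * M * 2 = 3 * (S * S) * (M * M) - 2 * (E * E) * r" using c by simp
  then have "(2 * M - S * E) * M * 2 = 3 * (M * M) - 2 * (E * E) * r" unfolding S by simp
  then have "M * M - 2 * (S * E) * M + (S * S) * (E * E) = E * E * (1 - 2 * r)"
    unfolding S by (simp add: algebra_simps)
  then have "(M - S * E)\<^sup>2 = E\<^sup>2 * (1 - 2 * r)" by (simp add: power2_eq_square algebra_simps)
  then show ?thesis by (simp add: M_def S_def E_def r_def)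
qed

text \<open>
  A pole of \<open>\<phi>\<close> that exceeds the order of \<open>\<kappa>\<close> would leave \<open>\<phi>\<^sup>2\<close> uncancelled; at that order the equation is
  quadratic in the leading coefficient.
\<close>

lemma riccati_leading:
  fixes \<phi> R :: "'a::field_char_0 fls"
  assumes D: "derivation D" and e: "e > 0" and s: "s * s = 1"
    and D0: "\<And>x. D x = 0"
    and \<kappa>: "low (- s * int e) \<kappa>" "\<kappa> $$ (- s * int e) = of_int s / of_nat e"
    and R: "low (- 2 * s * int e) R"
    and eq: "dhat D \<kappa> \<phi> = fls_const (-1/2) * (\<phi> * \<phi>) - R"
  shows "low (- s * int e) \<phi>" "(\<phi> $$ (- s * int e) - 1)\<^sup>2 = 1 - 2 * R $$ (- 2 * s * int e)"
proof -
  define N where "N = - s * int e"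
  have \<kappa>N: "low N \<kappa>" and RN: "low (2 * N) R" using \<kappa> R by (simp_all add: N_def mult.assoc)
  have m0: "fls_map D \<phi> = 0" by (rule fls_eqI) (simp add: fls_map_nth D0)
  then have eq': "\<kappa> * (fls_X * fls_deriv \<phi>) = fls_const (-1/2) * (\<phi> * \<phi>) - R" using eq by (simp add: dhat_def)
  show l: "low (- s * int e) \<phi>"
  proof (rule ccontr)
    assume a: "\<not> low (- s * int e) \<phi>"
    define m where "m = fls_subdegree \<phi>"
    have \<phi>0: "\<phi> \<noteq> 0" using a by auto
    have m: "m < N" "low m \<phi>" "\<phi> $$ m \<noteq> 0"
      using a \<phi>0 by (auto simp: low_subdegree N_def m_def)
    have "(\<kappa> * (fls_X * fls_deriv \<phi>)) $$ (2 * m) = 0"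
      by (rule low_nth[OF low_mult(1)[OF \<kappa>N low_euler[OF m(2)]]]) (use m in simp)
    moreover have "R $$ (2 * m) = 0" by (rule low_nth[OF RN]) (use m in simp)
    moreover have "(\<phi> * \<phi>) $$ (2 * m) = \<phi> $$ m * \<phi> $$ m" by (rule low_mult_eq(2)[OF m(2) m(2)]) simp
    ultimately show False using arg_cong[OF eq', of "\<lambda>f. f $$ (2 * m)"] m(3) by simp
  qed
  define x where "x = \<phi> $$ N"
  have lN: "low N \<phi>" using l by (simp add: N_def)
  have "(\<kappa> * (fls_X * fls_deriv \<phi>)) $$ (2 * N) = \<kappa> $$ N * (of_int N * x)"
    by (subst low_mult_eq(2)[OF \<kappa>N low_euler[OF lN]]) (simp_all add: euler_nth x_def)
  moreover have "(\<phi> * \<phi>) $$ (2 * N) = x * x" by (subst low_mult_eq(2)[OF lN lN]) (simp_all add: x_def)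
  ultimately have 1: "\<kappa> $$ N * (of_int N * x) = -1/2 * (x * x) - R $$ (2 * N)"
    using arg_cong[OF eq', of "\<lambda>f. f $$ (2 * N)"] by simp
  have "(of_int s * of_int s :: 'a) = 1" using s by (metis of_int_1 of_int_mult)
  then have "\<kappa> $$ N * of_int N = -1" using \<kappa>(2) e by (simp add: N_def)
  then have "- x = -1/2 * (x * x) - R $$ (2 * N)" using 1 by (metis mult.assoc mult_minus1)
  then have "2 * R $$ (2 * N) = 2 * x - x * x" by (simp add: field_simps)
  then have "(x - 1)\<^sup>2 = 1 - 2 * R $$ (2 * N)" by (simp add: power2_eq_square algebra_simps)
  moreover have "2 * N = - 2 * s * int e" by (simp add: N_def)
  ultimately show "(\<phi> $$ (- s * int e) - 1)\<^sup>2 = 1 - 2 * R $$ (- 2 * s * int e)"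
    by (simp only: x_def) (simp only: N_def)
qed

text \<open>Order two, expanded at \<open>u = \<infinity>\<close> with \<open>u = X\<^sup>-\<^sup>e\<close>: here \<open>P\<close> and \<open>u E\<close> are the two parts of
  the derivation on functions of \<open>y\<close>, and the coefficient of \<open>u\<^sup>2\<close> in \<open>y''\<close> solves a Riccati equation.\<close>

lemma order2_leading:
  fixes \<phi> :: "'a::field_char_0 fls"
  assumes P: "derivation P" and E: "derivation E" and e: "e > 0"
    and eq: "fls_X_intpow (- int e) * (fls_map P \<phi> + fls_X_intpow (- int e) * fls_map E \<phi> + kap False e \<phi> * (fls_X * fls_deriv \<phi>)) =
      fls_const (3/2) * (\<phi> * \<phi>) - fls_X_intpow (- 4 * int e) * fls_const r"
  shows "E (\<phi> $$ (- 2 * int e)) = -1/2 * (\<phi> $$ (- 2 * int e) * \<phi> $$ (- 2 * int e)) - r"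
proof -
  define N where "N = - int e"
  define X where "X = (fls_X_intpow N :: 'a fls)"
  have N: "N < 0" using e by (simp add: N_def)
  have lX: "low N X" "X $$ N = 1" by (simp_all add: X_def)
  have eq': "X * fls_map P \<phi> + X * (X * fls_map E \<phi>) + X * (kap False e \<phi> * (fls_X * fls_deriv \<phi>)) =
      fls_const (3/2) * (\<phi> * \<phi>) - fls_X_intpow (4 * N) * fls_const r"
    using eq by (simp add: X_def N_def algebra_simps)
  have terms: "low (m + N) (X * fls_map P \<phi>)" "low (m + 2 * N) (X * (X * fls_map E \<phi>))"
      "(X * (X * fls_map E \<phi>)) $$ (m + 2 * N) = E (\<phi> $$ m)"
      "low (2 * m) (X * (kap False e \<phi> * (fls_X * fls_deriv \<phi>)))"
      "(X * (kap False e \<phi> * (fls_X * fls_deriv \<phi>))) $$ (2 * m) = - (\<phi> $$ m / of_nat e) * (of_int m * \<phi> $$ m)"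
      "low (2 * m) (\<phi> * \<phi>)" "(\<phi> * \<phi>) $$ (2 * m) = \<phi> $$ m * \<phi> $$ m"
    if m: "low m \<phi>" for m
  proof -
    note lP = low_map[of P, OF derivation_zero[OF P] m] and lE = low_map[of E, OF derivation_zero[OF E] m]
    have lk: "low (m - N) (kap False e \<phi>)" "kap False e \<phi> $$ (m - N) = - (\<phi> $$ m / of_nat e)"
      using low_kap[OF m, of False e] by (simp_all add: psgn_def N_def)
    show "low (m + N) (X * fls_map P \<phi>)" by (rule low_mult_eq(1)[OF lX(1) lP]) simp
    have 1: "low (m + N) (X * fls_map E \<phi>)" by (rule low_mult_eq(1)[OF lX(1) lE]) simp
    have 2: "(X * fls_map E \<phi>) $$ (m + N) = E (\<phi> $$ m)"
      by (subst low_mult_eq(2)[OF lX(1) lE]) (simp_all add: lX(2) fls_map_nth derivation_zero[OF E])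
    show "low (m + 2 * N) (X * (X * fls_map E \<phi>))" by (rule low_mult_eq(1)[OF lX(1) 1]) simp
    show "(X * (X * fls_map E \<phi>)) $$ (m + 2 * N) = E (\<phi> $$ m)"
      by (subst low_mult_eq(2)[OF lX(1) 1]) (simp_all add: lX(2) 2)
    have 3: "low (2 * m - N) (kap False e \<phi> * (fls_X * fls_deriv \<phi>))"
      by (rule low_mult_eq(1)[OF lk(1) low_euler[OF m]]) simp
    have 4: "(kap False e \<phi> * (fls_X * fls_deriv \<phi>)) $$ (2 * m - N) = - (\<phi> $$ m / of_nat e) * (of_int m * \<phi> $$ m)"
      by (subst low_mult_eq(2)[OF lk(1) low_euler[OF m]]) (simp_all add: lk(2) euler_nth)
    show "low (2 * m) (X * (kap False e \<phi> * (fls_X * fls_deriv \<phi>)))" by (rule low_mult_eq(1)[OF lX(1) 3]) simp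
    show "(X * (kap False e \<phi> * (fls_X * fls_deriv \<phi>))) $$ (2 * m) = - (\<phi> $$ m / of_nat e) * (of_int m * \<phi> $$ m)"
      by (subst low_mult_eq(2)[OF lX(1) 3]) (simp_all add: lX(2) 4)
    show "low (2 * m) (\<phi> * \<phi>)" "(\<phi> * \<phi>) $$ (2 * m) = \<phi> $$ m * \<phi> $$ m"
      using low_mult_eq[OF m m, of "2 * m"] by simp_all
  qed
  have l: "low (2 * N) \<phi>"
  proof (rule ccontr)
    assume a: "\<not> low (2 * N) \<phi>"
    define m where "m = fls_subdegree \<phi>"
    have \<phi>0: "\<phi> \<noteq> 0" using a by auto
    have m: "m < 2 * N" "low m \<phi>" "\<phi> $$ m \<noteq> 0"
      using a \<phi>0 by (auto simp: low_subdegree m_def)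
    note t = terms[OF m(2)]
    have "(X * fls_map P \<phi>) $$ (2 * m) = 0" "(X * (X * fls_map E \<phi>)) $$ (2 * m) = 0"
      using low_nth[OF t(1), of "2 * m"] low_nth[OF t(2), of "2 * m"] m(1) N by auto
    moreover have "2 * m \<noteq> 4 * N" using m(1) by auto
    ultimately have "- (\<phi> $$ m / of_nat e) * (of_int m * \<phi> $$ m) = 3/2 * (\<phi> $$ m * \<phi> $$ m)"
      using arg_cong[OF eq', of "\<lambda>f. f $$ (2 * m)"] t(5,7) by simp
    then have "(\<phi> $$ m * \<phi> $$ m) * of_int (- 2 * m) = (\<phi> $$ m * \<phi> $$ m) * of_int (3 * int e)"
      using e by (simp add: field_simps)
    then have "(of_int (- 2 * m) :: 'a) = of_int (3 * int e)" using m(3) by (simp only: mult_cancel_left mult_eq_0_iff simp_thms)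
    then have "- 2 * m = 3 * int e" by (simp only: of_int_eq_iff)
    then show False using m(1) e by (simp add: N_def)
  qed
  note t = terms[OF l]
  define c where "c = \<phi> $$ (2 * N)"
  have "(X * fls_map P \<phi>) $$ (4 * N) = 0" using low_nth[OF t(1), of "4 * N"] N by auto
  then have "E c - (c / of_nat e) * (of_int (2 * N) * c) = 3/2 * (c * c) - r"
    using arg_cong[OF eq', of "\<lambda>f. f $$ (4 * N)"] t(3,5,7) by (simp add: c_def)
  moreover have "(c / of_nat e) * (of_int (2 * N) * c) = - 2 * (c * c)" using e by (simp add: N_def)
  ultimately have "E c + 2 * (c * c) = 3/2 * (c * c) - r" by (simp only:) simp
  then have "E c = -1/2 * (c * c) - r" by (simp add: field_simps eq_neg_iff_add_eq_0)
  then show ?thesis by (simp add: c_def N_def)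
qed

section \<open>Solutions of order one and two\<close>

text \<open>The order of \<open>y - c\<close> at the place, divided by the ramification index.\<close>

definition pord :: "bool \<Rightarrow> 'a \<Rightarrow> 'a \<Rightarrow> int" where
  "pord fin a c = (if fin then if a = c then 1 else 0 else -1)"

lemma low_place_minus:
  fixes a c :: "'a::field"
  assumes e: "e > 0"
  shows "low (int e * pord fin a c) (place fin a e - fls_const c)"
    "(place fin a e - fls_const c) $$ (int e * pord fin a c) \<noteq> 0"
  using e by (auto simp: place_def pord_def low_def)

lemma sum_exponents:
  fixes p :: "'a::field_char_0"
  assumes "\<And>x. x \<in> set xs \<Longrightarrow> (x - 1)\<^sup>2 = p\<^sup>2"
  shows "\<exists>k::int. sum_list xs = of_nat (length xs) + of_int k * p"
  using assms
proof (induction xs)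
  case Nil
  then show ?case by (intro exI[of _ 0]) simp
next
  case (Cons x xs)
  then obtain k :: int where k: "sum_list xs = of_nat (length xs) + of_int k * p" by auto
  have "x - 1 = p \<or> x - 1 = - p" using Cons.prems[of x] by (simp add: power2_eq_iff)
  then have "x = 1 + p \<or> x = 1 - p" by (auto simp: algebra_simps)
  then show ?case
  proof
    assume "x = 1 + p" then show ?thesis using k by (intro exI[of _ "k + 1"]) (simp add: algebra_simps)
  next
    assume "x = 1 - p" then show ?thesis using k by (intro exI[of _ "k - 1"]) (simp add: algebra_simps)
  qed
qed

lemma sum_even_exponents:
  fixes xs :: "'a::field_char_0 list"
  assumes "\<And>x. x \<in> set xs \<Longrightarrow> (x - 1)\<^sup>2 = 1"
  shows "\<exists>k::nat. sum_list xs = 2 * of_nat k"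
  using assms
proof (induction xs)
  case Nil
  then show ?case by (intro exI[of _ 0]) simp
next
  case (Cons x xs)
  then obtain k :: nat where k: "sum_list xs = 2 * of_nat k" by auto
  have "x - 1 = 1 \<or> x - 1 = - 1" using Cons.prems[of x] power2_eq_iff[of "x - 1" 1] by simp
  then have "x = 2 \<or> x = 0" by (auto simp: algebra_simps)
  then show ?case
  proof
    assume "x = 2" then show ?thesis using k by (intro exI[of _ "k + 1"]) simp
  next
    assume "x = 0" then show ?thesis using k by (intro exI[of _ k]) simp
  qed
qed

lemma low_sum_list: "(\<And>r. r \<in> set rs \<Longrightarrow> low N r) \<Longrightarrow> low N (sum_list rs)" for rs :: "'a::comm_ring_1 fls list"
  by (induction rs) (auto intro: low_add)

lemma nth_sum_list: "sum_list rs $$ i = sum_list (map (\<lambda>r. r $$ i) rs)" for rs :: "'a::comm_ring_1 fls list"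
  by (induction rs) auto

lemma low_prod_list: "(\<And>r. r \<in> set rs \<Longrightarrow> low N r) \<Longrightarrow> low (int (length rs) * N) (\<Prod>r\<leftarrow>rs. - r)" for rs :: "'a::idom fls list"
proof (induction rs)
  case (Cons r rs)
  have "low (N + int (length rs) * N) ((- r) * (\<Prod>r\<leftarrow>rs. - r))"
    by (rule low_mult(1)) (use Cons in \<open>auto intro: low_minus\<close>)
  then show ?case by (simp add: algebra_simps)
qed simp

lemma alg_over_scale:
  assumes K: "is_subfield K" and a: "alg_over K a" and c: "c \<in> K" "c \<noteq> 0"
  shows "alg_over K (a / c)"
proof -
  from a obtain p where p: "p \<in> poly_over K" "p \<noteq> 0" "poly p a = 0" by (auto simp: alg_over_def)
  have "pcompose p [:0, c:] \<in> poly_over K"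
    using p c by (auto simp: poly_over_def coeff_pcompose_linear intro!: sf_intros K)
  moreover have "pcompose p [:0, c:] \<noteq> 0" using p c by (simp add: pcompose_eq_0_iff)
  moreover have "poly (pcompose p [:0, c:]) (a / c) = 0" using p c by (simp add: poly_pcompose)
  ultimately show ?thesis unfolding alg_over_def by blast
qed

text \<open>
  Here \<open>pa, pb, pc\<close> stand for \<open>1/\<alpha>, 1/\<beta>, 1/\<gamma>\<close>, and \<open>y\<close> for a solution that is transcendental
  over the differential field \<open>K\<close>.
\<close>

locale triangle_setting =
  fixes d :: "'u::field_char_0 \<Rightarrow> 'u" and K :: "'u set" and y pa pb pc :: 'u
  assumes AC: "alg_closed_type TYPE('u)" and K: "is_subfield K" and d: "derivation d"
    and dK: "\<And>x. x \<in> K \<Longrightarrow> d x \<in> K" and par: "pa \<in> K" "pb \<in> K" "pc \<in> K"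
    and y: "\<not> alg_over K y"
    and indep: "\<And>i j k l :: int. of_int i + of_int j * pa + of_int k * pb + of_int l * pc = 0 \<Longrightarrow>
      i = 0 \<and> j = 0 \<and> k = 0 \<and> l = 0"
begin

abbreviation "R \<equiv> fuchs_R (pa\<^sup>2) (pb\<^sup>2) (pc\<^sup>2)"
abbreviation "Ky \<equiv> adjoin K y"
abbreviation "expo2' \<equiv> expo2 (pa\<^sup>2) (pb\<^sup>2) (pc\<^sup>2)"

lemma Ky: "is_subfield Ky"
  by (rule is_subfield_adjoin[OF K])

lemma KKy: "x \<in> K \<Longrightarrow> x \<in> Ky"
  by (rule adjoin_base[OF K])

lemma yKy: "y \<in> Ky"
  by (rule adjoin_gen[OF K])

lemma y_notin_K: "y \<notin> K"
proof
  assume "y \<in> K"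
  then have "[:- y, 1:] \<in> poly_over K" by (simp add: po_pCons_iff[OF K] po_zero[OF K] sf_intros K)
  then show False using y unfolding alg_over_def by (auto dest!: bspec[of _ _ "[:- y, 1:]"])
qed

lemma y_neq: "y \<noteq> 0" "y \<noteq> 1" "y * (y - 1) \<in> Ky" "y * (y - 1) \<noteq> 0"
  using y_notin_K sf_zero[OF K] sf_one[OF K] by (auto intro!: sf_mult sf_diff sf_one Ky yKy)

lemma par2: "pa\<^sup>2 \<in> K" "pb\<^sup>2 \<in> K" "pc\<^sup>2 \<in> K"
  using par by (auto intro: sf_power K)

lemma RKy: "R y \<in> Ky"
  unfolding fuchs_R_def using par[THEN KKy] yKy by (intro sf_intros Ky)

text \<open>The indicial equations of order one would make \<open>1/\<alpha>\<close>, \<open>1/\<beta>\<close> or \<open>1/\<gamma>\<close> rational.\<close>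

lemma irrational_exponents:
  assumes "(of_int i)\<^sup>2 = (of_nat e)\<^sup>2 * expo2' fin a" "e > 0" "\<not> fin \<or> a = 0 \<or> a = 1"
  shows False
proof -
  have *: False if "(of_int i)\<^sup>2 = (of_nat e)\<^sup>2 * p\<^sup>2" "p \<in> {pa, pb, pc}" for p
  proof -
    have "(of_int i)\<^sup>2 = (of_nat e * p)\<^sup>2" using that by (simp add: power_mult_distrib)
    then have "of_int i + of_int (- int e) * p = 0 \<or> of_int i + of_int (int e) * p = 0"
      by (auto simp: power2_eq_iff)
    then show False
      using that(2) assms(2) indep[of i "- int e" 0 0] indep[of i 0 "- int e" 0] indep[of i 0 0 "- int e"]
        indep[of i "int e" 0 0] indep[of i 0 "int e" 0] indep[of i 0 0 "int e"] by auto
  qed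
  show False using assms *[of pa] *[of pb] *[of pc] by (auto simp: expo2_def split: if_splits)
qed

lemma place_homs:
  obtains \<Psi> :: "bool \<Rightarrow> 'u \<Rightarrow> 'u \<Rightarrow> 'u fls"
  where "\<And>fin a. hom_on Ky (\<Psi> fin a)" "\<And>fin a x. x \<in> K \<Longrightarrow> \<Psi> fin a x = fls_const x"
    "\<And>fin a. \<Psi> fin a y = place fin a 1"
proof -
  have "\<exists>\<psi>. hom_on Ky \<psi> \<and> (\<forall>x\<in>K. \<psi> x = fls_const x) \<and> \<psi> y = place fin a 1" for fin a
  proof -
    have "fls_deriv (place fin a 1) \<noteq> 0"
      by (cases fin) (simp_all only: place_1 fls_deriv_place simp_thms)
    from hom_extend_transcendental[OF K hom_fls_const y, of "place fin a 1"] const_eval_eq_0[OF this]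
    show ?thesis by metis
  qed
  then show ?thesis using that by metis
qed

lemma const_eval_place:
  assumes "hom_on Ky \<psi>" "\<And>x. x \<in> K \<Longrightarrow> \<psi> x = fls_const x" "p \<in> poly_over K"
  shows "\<psi> (poly p y) = const_eval p (\<psi> y)"
proof -
  have "map_poly \<psi> p = map_poly fls_const p"
    by (rule poly_eqI) (simp add: hom_coeff[OF Ky assms(1)] coeff_map_poly assms(2) poly_overD[OF assms(3)])
  moreover have "p \<in> poly_over Ky" by (rule poly_over_mono[OF _ assms(3)]) (auto intro: KKy)
  ultimately show ?thesis using hom_eval[OF Ky assms(1) _ yKy, of p] by simp
qed

lemma rational_residues:
  assumes \<Psi>: "\<And>fin a. hom_on Ky (\<Psi> fin a)" "\<And>fin a x. x \<in> K \<Longrightarrow> \<Psi> fin a x = fls_const x"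
    "\<And>fin a. \<Psi> fin a y = place fin a 1" and T: "T \<in> Ky"
    and low: "\<And>a. low (-1) (\<Psi> True a T)" "low 1 (\<Psi> False 0 T)"
  shows "finite {a. \<Psi> True a T $$ (-1) \<noteq> 0}"
    "\<Psi> False 0 T $$ 1 = (\<Sum>a | \<Psi> True a T $$ (-1) \<noteq> 0. \<Psi> True a T $$ (-1))"
    "(\<And>a. \<Psi> True a T $$ (-1) = 0) \<Longrightarrow> T = 0"
proof -
  from T obtain N Q where T: "T = poly N y / poly Q y" "N \<in> poly_over K" "Q \<in> poly_over K" "poly Q y \<noteq> 0"
    unfolding adjoin_def by blast
  have Q0: "Q \<noteq> 0" using T by auto
  have *: "const_eval Q (place fin a 1) * \<Psi> fin a T = const_eval N (place fin a 1)" for fin a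
  proof -
    have "poly Q y * T = poly N y" using T by simp
    then have "\<Psi> fin a (poly Q y * T) = \<Psi> fin a (poly N y)" by simp
    moreover have "\<Psi> fin a (poly Q y * T) = \<Psi> fin a (poly Q y) * \<Psi> fin a T"
      using T adjoin_poly[OF K T(3)] assms(4) by (intro hom_mult[OF \<Psi>(1)]) auto
    ultimately show ?thesis
      using const_eval_place[OF \<Psi>(1) \<Psi>(2) T(2), of fin a] const_eval_place[OF \<Psi>(1) \<Psi>(2) T(3), of fin a] by (simp add: \<Psi>(3))
  qed
  have T1: "const_eval Q (fls_const a + fls_X) * \<Psi> True a T = const_eval N (fls_const a + fls_X)" for a
    using *[of True a] by (simp only: place_1)
  have T2: "const_eval Q fls_X_inv * \<Psi> False 0 T = const_eval N fls_X_inv"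
    using *[of False 0] by (simp only: place_1)
  note res = residue_theorem[OF AC Q0, of "\<lambda>a. \<Psi> True a T" N "\<Psi> False 0 T", OF T1 T2 low]
  show "finite {a. \<Psi> True a T $$ (-1) \<noteq> 0}" by (rule res)
  show "\<Psi> False 0 T $$ 1 = (\<Sum>a | \<Psi> True a T $$ (-1) \<noteq> 0. \<Psi> True a T $$ (-1))" by (rule res)
  show "T = 0" if "\<And>a. \<Psi> True a T $$ (-1) = 0" using res(3)[OF that] T by simp
qed

text \<open>
  The derivation \<open>D0\<close> only has to agree with \<open>D\<close> on \<open>K\<close>, although the coefficients of the Puiseux series lie
  outside \<open>K\<close>: the embedding is determined on \<open>K\<close> and at \<open>y\<close>, up to algebraic extension.
\<close>

lemma dhat_embedding:
  assumes z: "alg_over Ky z" and \<tau>: "hom_on (adjoin Ky z) \<tau>" "\<And>x. x \<in> K \<Longrightarrow> \<tau> x = fls_const x" "\<tau> y = place fin a e"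
    and e: "e > 0"
    and D: "derivation D" "\<And>x. x \<in> adjoin Ky z \<Longrightarrow> D x \<in> adjoin Ky z"
    and D0: "derivation D0" "\<And>x. x \<in> K \<Longrightarrow> D0 x = D x" "\<And>x. x \<in> K \<Longrightarrow> D x \<in> K"
    and x: "x \<in> adjoin Ky z"
  shows "dhat D0 (kap fin e (\<tau> (D y) - (if fin then fls_const (D0 a) else 0))) (\<tau> x) = \<tau> (D x)"
proof (rule derivations_agree[OF K z \<tau>(1) D derivation_dhat[OF D0(1)] _ _ x])
  let ?w = "\<tau> (D y) - (if fin then fls_const (D0 a) else 0)"
  note z0 = derivation_zero[OF D0(1)] and z1 = derivation_one[OF D0(1)]
  show "dhat D0 (kap fin e ?w) (\<tau> x) = \<tau> (D x)" if "x \<in> K" for x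
    using that D0 by (simp add: \<tau>(2) dhat_const z0)
  have "fls_map D0 (place fin a e) = (if fin then fls_const (D0 a) else 0)"
    using fls_map_X_intpow[of D0 "int e", OF z0 z1] fls_map_X_intpow[of D0 "- int e", OF z0 z1]
      derivation_add[OF derivation_fls_map[OF D0(1)]]
    by (simp add: place_def fls_map_const[of D0, OF z0])
  then show "dhat D0 (kap fin e ?w) (\<tau> y) = \<tau> (D y)"
    by (simp add: \<tau>(3) dhat_def kap_place[OF e])
qed

lemma fuchs_R_embedding:
  assumes \<tau>: "hom_on F \<tau>" "is_subfield F" "Ky \<subseteq> F" "\<And>x. x \<in> K \<Longrightarrow> \<tau> x = fls_const x"
  shows "\<tau> (R y) = fuchs_R (fls_const (pa\<^sup>2)) (fls_const (pb\<^sup>2)) (fls_const (pc\<^sup>2)) (\<tau> y)"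
  using hom_fuchs_R(1)[OF \<tau>(2,1), of "pa\<^sup>2" "pb\<^sup>2" "pc\<^sup>2" y] par2[THEN \<tau>(4)] par2[THEN KKy] yKy \<tau>(3)
  by auto

subsection \<open>No solutions of order one\<close>

text \<open>A branch of \<open>y'\<close> of order lower than that of \<open>y (y - 1)\<close> satisfies the indicial equation. At an
  ordinary place its solutions are the exponents 0 and 2, neither of them a pole; at
  \<open>0, 1, \<infinity>\<close> they are irrational. So \<open>z = y' / (y (y - 1))\<close> has no poles, and it vanishes at \<open>\<infinity>\<close>.\<close>

lemma order1_root:
  assumes z: "alg_over Ky z" and \<tau>: "hom_on (adjoin Ky z) \<tau>" "\<And>x. x \<in> K \<Longrightarrow> \<tau> x = fls_const x" "\<tau> y = place fin a e"
    and e: "e > 0" and dF: "\<And>x. x \<in> adjoin Ky z \<Longrightarrow> d x \<in> adjoin Ky z"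
    and u: "d y = u" "z = u / (y * (y - 1))"
    and ode: "u * d (d u) = 3/2 * (d u * d u) - (u * u) * (u * u) * R y"
  shows "low (if fin then 0 else int e) (\<tau> z)"
proof -
  let ?F = "adjoin Ky z" and ?Y = "place fin a e"
  have F: "is_subfield ?F" by (rule is_subfield_adjoin[OF Ky])
  have kF: "Ky \<subseteq> ?F" by (auto intro: adjoin_base[OF Ky])
  have zF: "z \<in> ?F" by (rule adjoin_gen[OF Ky])
  have yF: "y \<in> ?F" using kF yKy by blast
  have cF: "x \<in> ?F" if "x \<in> K" for x using that KKy kF by blast
  have uF: "u \<in> ?F" using dF[OF yF] u by simp
  have RF: "R y \<in> ?F" using RKy kF by blast
  define \<phi> where "\<phi> = \<tau> u"
  define s where "s = psgn fin"
  have s: "s * s = 1" by (simp add: s_def psgn_def)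
  define \<kappa> where "\<kappa> = kap fin e (\<phi> - (if fin then fls_const (d a) else 0))"
  have \<tau>d: "\<tau> (d x) = dhat d \<kappa> (\<tau> x)" if "x \<in> ?F" for x
    using dhat_embedding[OF z \<tau> e d dF d _ dK that] u by (simp add: \<kappa>_def \<phi>_def)
  have \<tau>R: "\<tau> (R y) = fuchs_R (fls_const (pa\<^sup>2)) (fls_const (pb\<^sup>2)) (fls_const (pc\<^sup>2)) ?Y" (is "_ = ?R")
    using fuchs_R_embedding[OF \<tau>(1) F kF \<tau>(2)] \<tau>(3) by simp
  have t32: "\<tau> (3/2) = fls_const (3/2)" by (rule \<tau>(2)) (intro sf_intros K)
  have c32: "3/2 \<in> ?F" by (intro sf_intros F)
  note \<tau>m = hom_mult[OF \<tau>(1)] and \<tau>s = hom_diff[OF F \<tau>(1)] and Fm = sf_mult[OF F]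
  have "\<tau> (u * d (d u)) = \<tau> (3/2 * (d u * d u) - (u * u) * (u * u) * R y)" by (simp only: ode)
  then have eq: "\<phi> * dhat d \<kappa> (dhat d \<kappa> \<phi>) = fls_const (3/2) * (dhat d \<kappa> \<phi> * dhat d \<kappa> \<phi>) - ((\<phi> * \<phi>) * (\<phi> * \<phi>)) * ?R"
    using uF dF RF c32
    by (simp add: \<tau>m \<tau>s Fm t32 \<tau>R \<tau>d del: times_divide_eq_left times_divide_eq_right flip: \<phi>_def)
  \<comment> \<open>The order of \<open>y (y - 1)\<close>, raised at infinity by the order of \<open>1/y\<close>.\<close>
  define M where "M = int e * (pord fin a 0 + pord fin a 1) + (if fin then 0 else int e)"
  have lowM: "low M \<phi>"
  proof (rule ccontr)
    assume a: "\<not> low M \<phi>"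
    define m where "m = fls_subdegree \<phi>"
    have \<phi>0: "\<phi> \<noteq> 0" using a by auto
    have m: "m < M" "low m \<phi>" "\<phi> $$ m \<noteq> 0"
      using a \<phi>0 by (auto simp: low_subdegree m_def)
    have "low m (\<phi> - (if fin then fls_const (d a) else 0)) \<and> (\<phi> - (if fin then fls_const (d a) else 0)) $$ m = \<phi> $$ m"
    proof (cases "fin \<and> a \<noteq> 0 \<and> a \<noteq> 1")
      case True
      then have "m < 0" using m(1) by (simp add: M_def pord_def)
      then show ?thesis using m(2) by (auto intro: low_diff)
    next
      case False
      then have "(if fin then fls_const (d a) else 0) = (0 :: 'u fls)"
        using derivation_zero[OF d] derivation_one[OF d] by auto
      then show ?thesis using m(2) by simp
    qed
    then have \<kappa>: "low (m - s * int e) \<kappa>" "\<kappa> $$ (m - s * int e) = of_int s / of_nat e * \<phi> $$ m"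
      using low_kap[of m "\<phi> - (if fin then fls_const (d a) else 0)" fin e] by (auto simp: \<kappa>_def s_def)
    have neg: "m - s * int e < 0" using m(1) e by (auto simp: M_def pord_def s_def psgn_def split: if_splits)
    have lR: "low (- 2 * s * int e) ?R" and nR: "1 - 2 * ?R $$ (- 2 * s * int e) = expo2' fin a"
      using place_fuchs_R[OF e, where fin = fin and A = "pa\<^sup>2" and B = "pb\<^sup>2" and C = "pc\<^sup>2" and a = a] by (simp_all add: s_def mult.assoc)
    have res: "(of_int (m - s * int e))\<^sup>2 = (of_nat e)\<^sup>2 * expo2' fin a"
      using order1_leading[OF d e s m(2,3) neg \<kappa> lR eq] unfolding nR .
    show False
    proof (cases "fin \<and> a \<noteq> 0 \<and> a \<noteq> 1")
      case True
      then have "(of_int ((m - int e)\<^sup>2) :: 'u) = of_int ((int e)\<^sup>2)"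
        using res by (simp add: expo2_def s_def psgn_def)
      then have "(m - int e)\<^sup>2 = (int e)\<^sup>2" by (simp only: of_int_eq_iff)
      then have "m = 2 * int e \<or> m = 0" by (auto simp: power2_eq_iff)
      moreover have "m < 0" using True m(1) by (simp add: M_def pord_def)
      ultimately show False by auto
    next
      case False
      then show False using irrational_exponents[OF res e] by blast
    qed
  qed
  have l0: "low (- (int e * pord fin a 0)) (inverse ?Y)" and l1: "low (- (int e * pord fin a 1)) (inverse (?Y - 1))"
    using low_inverse(1)[OF low_place_minus[OF e, of fin a 0]] low_inverse(1)[OF low_place_minus[OF e, of fin a 1]] by simp_all
  have zu: "z = u * (inverse y * inverse (y - 1))" by (simp add: u(2) divide_inverse)
  have "\<tau> (u * (inverse y * inverse (y - 1))) = \<phi> * (inverse ?Y * inverse (?Y - 1))"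
    using uF yF sf_one[OF F] sf_diff[OF F yF sf_one[OF F]] sf_inverse[OF F]
    by (simp add: \<tau>m Fm hom_inverse[OF F \<tau>(1)] \<tau>s hom_one[OF \<tau>(1)] \<tau>(3) \<phi>_def)
  then have "\<tau> z = \<phi> * (inverse ?Y * inverse (?Y - 1))" by (simp only: zu[symmetric])
  moreover have "low (M + (- (int e * pord fin a 0) + - (int e * pord fin a 1))) (\<phi> * (inverse ?Y * inverse (?Y - 1)))"
    by (intro low_mult lowM l0 l1)
  ultimately show ?thesis by (simp add: M_def algebra_simps)
qed

text \<open>The constant coefficient of the minimal polynomial of \<open>z\<close> is, up to sign, its norm to \<open>K(y)\<close>.\<close>

theorem no_order1:
  assumes u: "d y = u" "u \<noteq> 0" "alg_over Ky u"
    and ode: "u * d (d u) = 3/2 * (d u * d u) - (u * u) * (u * u) * R y"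
  shows False
proof -
  define z where "z = u / (y * (y - 1))"
  have z: "alg_over Ky z" unfolding z_def by (rule alg_over_scale[OF Ky u(3) y_neq(3,4)])
  have z0: "z \<noteq> 0" using u y_neq by (simp add: z_def)
  obtain m where m: "is_minpoly Ky z m" using minpoly_exists[OF Ky z] by blast
  have mK: "m \<in> poly_over Ky" using m by (simp add: is_minpoly_def)
  let ?F = "adjoin Ky z"
  have F: "is_subfield ?F" by (rule is_subfield_adjoin[OF Ky])
  have kF: "Ky \<subseteq> ?F" by (auto intro: adjoin_base[OF Ky])
  have "u = z * (y * (y - 1))" using y_neq by (simp add: z_def)
  then have uF: "u \<in> ?F" using y_neq(3) kF by (metis sf_mult[OF F] adjoin_gen[OF Ky] subsetD)
  have dk: "d x \<in> ?F" if "x \<in> Ky" for x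
    by (rule derivation_adjoin[OF d F _ _ _ _ that]) (use kF KKy dK yKy u(1) uF in auto)
  have dF: "d x \<in> ?F" if "x \<in> ?F" for x by (rule derivation_algebraic[OF d Ky z dk that])
  obtain \<Psi> where \<Psi>: "\<And>fin a. hom_on Ky (\<Psi> fin a)" "\<And>fin a x. x \<in> K \<Longrightarrow> \<Psi> fin a x = fls_const x"
    "\<And>fin a. \<Psi> fin a y = place fin a 1" using place_homs by metis
  define T where "T = coeff m 0"
  have T: "T \<in> Ky" using mK by (simp add: T_def poly_overD)
  have *: "low (if fin then 0 else 1) (\<Psi> fin a T)" and T0: "T \<noteq> 0" for fin a
  proof -
    from puiseux_embeddings[OF AC Ky \<Psi>(1)[of fin a] m] obtain e rs where e: "e > 0" and len: "length rs = degree m"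
      and split: "map_poly (\<lambda>x. ramify e (\<Psi> fin a x)) m = (\<Prod>r\<leftarrow>rs. [:-r, 1:])"
      and emb: "\<And>r. r \<in> set rs \<Longrightarrow> \<exists>\<tau>. hom_on ?F \<tau> \<and> (\<forall>x\<in>Ky. \<tau> x = ramify e (\<Psi> fin a x)) \<and> \<tau> z = r" by metis
    have root: "low (if fin then 0 else int e) r \<and> r \<noteq> 0" if "r \<in> set rs" for r
    proof -
      from emb[OF that] obtain \<tau> where \<tau>: "hom_on ?F \<tau>" "\<And>x. x \<in> Ky \<Longrightarrow> \<tau> x = ramify e (\<Psi> fin a x)" "\<tau> z = r" by blast
      have \<tau>K: "\<tau> x = fls_const x" if "x \<in> K" for x using \<tau>(2)[OF KKy[OF that]] \<Psi>(2)[OF that] e by simp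
      have \<tau>y: "\<tau> y = place fin a e" using \<tau>(2)[OF yKy] \<Psi>(3) ramify_place[OF e] by simp
      have "r \<noteq> 0" using hom_eq_0_iff[OF F \<tau>(1) adjoin_gen[OF Ky]] z0 \<tau>(3) by simp
      then show ?thesis using order1_root[OF z \<tau>(1) \<tau>K \<tau>y e dF u(1) z_def ode] \<tau>(3) by simp
    qed
    have c: "ramify e (\<Psi> fin a T) = (\<Prod>r\<leftarrow>rs. - r)"
      using arg_cong[OF split, of "\<lambda>p. coeff p 0"] coeff_prod_linear(3)[of rs]
      by (simp add: T_def hom_coeff[OF Ky hom_comp_ramify[OF \<Psi>(1) e]])
    have "low (int (length rs) * (if fin then 0 else int e)) (ramify e (\<Psi> fin a T))"
      unfolding c by (rule low_prod_list) (use root in blast)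
    then have "low (int e * (if fin then 0 else int (degree m))) (ramify e (\<Psi> fin a T))"
      by (simp add: len mult.commute split: if_splits)
    then have "low (if fin then 0 else int (degree m)) (\<Psi> fin a T)" by (rule low_ramifyD[OF e])
    then show "low (if fin then 0 else 1) (\<Psi> fin a T)"
      by (rule low_mono) (use minpoly_degree[OF m] in auto)
    have "(\<Prod>r\<leftarrow>rs. - r) \<noteq> 0" using root by (auto simp: prod_list_zero_iff)
    then show "T \<noteq> 0" using c hom_zero[OF Ky \<Psi>(1)] by auto
  qed
  have "T = 0"
  proof (rule rational_residues(3)[OF \<Psi> T])
    show "low (-1) (\<Psi> True a T)" "\<Psi> True a T $$ (-1) = 0" for a
      using *[of True a] low_mono[of 0 "\<Psi> True a T" "-1"] low_nth[of 0 "\<Psi> True a T" "-1"] by simp_all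
    show "low 1 (\<Psi> False 0 T)" using *[of False 0] by simp
  qed
  then show False using T0 by simp
qed

subsection \<open>No algebraic solutions of the Riccati equation\<close>

text \<open>
  As \<open>E\<close> vanishes on \<open>K\<close>, the coefficients of the series may be treated as constants even where \<open>E\<close>
  itself does not vanish on them.
\<close>

lemma riccati_root:
  assumes c: "alg_over Ky c" and \<tau>: "hom_on (adjoin Ky c) \<tau>" "\<And>x. x \<in> K \<Longrightarrow> \<tau> x = fls_const x" "\<tau> y = place fin a e"
    and e: "e > 0" and E: "derivation E" "\<And>x. x \<in> K \<Longrightarrow> E x = 0" "E y = 1" "E c = -1/2 * (c * c) - R y"
  shows "low (- psgn fin * int e) (\<tau> c)" "(\<tau> c $$ (- psgn fin * int e) - 1)\<^sup>2 = expo2' fin a"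
proof -
  let ?F = "adjoin Ky c"
  have F: "is_subfield ?F" by (rule is_subfield_adjoin[OF Ky])
  have kF: "Ky \<subseteq> ?F" by (auto intro: adjoin_base[OF Ky])
  have cF: "c \<in> ?F" by (rule adjoin_gen[OF Ky])
  have yF: "y \<in> ?F" using kF yKy by blast
  have RF: "R y \<in> ?F" using RKy kF by blast
  have hF: "-1/2 \<in> ?F" by (intro sf_intros F)
  have EcF: "E c \<in> ?F" unfolding E(4) using hF cF RF by (intro sf_diff sf_mult F)
  have Ek: "E x \<in> ?F" if "x \<in> Ky" for x
    by (rule derivation_adjoin[OF E(1) F _ _ yF _ that]) (use kF KKy E sf_zero[OF F] sf_one[OF F] in auto)
  have EF: "E x \<in> ?F" if "x \<in> ?F" for x
    by (rule derivation_adjoin[OF E(1) F kF Ek cF EcF that])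
  have Z: "derivation (\<lambda>x::'u. 0)" by (simp add: derivation_def)
  define s where "s = psgn fin"
  have s: "s * s = 1" by (simp add: s_def psgn_def)
  define \<kappa> where "\<kappa> = kap fin e (1 :: 'u fls)"
  have \<tau>E: "\<tau> (E x) = dhat (\<lambda>_. 0) \<kappa> (\<tau> x)" if "x \<in> ?F" for x
    using dhat_embedding[OF c \<tau> e E(1) EF Z _ _ that] E sf_zero[OF K] hom_one[OF \<tau>(1)]
    by (simp add: \<kappa>_def cong: if_cong)
  have \<tau>R: "\<tau> (R y) = fuchs_R (fls_const (pa\<^sup>2)) (fls_const (pb\<^sup>2)) (fls_const (pc\<^sup>2)) (place fin a e)" (is "_ = ?R")
    using fuchs_R_embedding[OF \<tau>(1) F kF \<tau>(2)] \<tau>(3) by simp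
  have th: "\<tau> (-1/2) = fls_const (-1/2)" by (rule \<tau>(2)) (intro sf_intros K)
  have "\<tau> (E c) = \<tau> (-1/2 * (c * c) - R y)" by (simp only: E(4))
  then have eq: "dhat (\<lambda>_. 0) \<kappa> (\<tau> c) = fls_const (-1/2) * (\<tau> c * \<tau> c) - ?R"
    using hom_diff[OF F \<tau>(1) sf_mult[OF F hF sf_mult[OF F cF cF]] RF] hom_mult[OF \<tau>(1) hF sf_mult[OF F cF cF]]
      hom_mult[OF \<tau>(1) cF cF] \<tau>E[OF cF] by (simp only: th \<tau>R)
  have \<kappa>: "low (- s * int e) \<kappa>" "\<kappa> $$ (- s * int e) = of_int s / of_nat e"
    using low_kap[of 0 "1 :: 'u fls" fin e] by (simp_all add: \<kappa>_def s_def)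
  have lR: "low (- 2 * s * int e) ?R" and nR: "1 - 2 * ?R $$ (- 2 * s * int e) = expo2' fin a"
    using place_fuchs_R[OF e, where fin = fin and A = "pa\<^sup>2" and B = "pb\<^sup>2" and C = "pc\<^sup>2" and a = a] by (simp_all add: s_def mult.assoc)
  show "low (- psgn fin * int e) (\<tau> c)" "(\<tau> c $$ (- psgn fin * int e) - 1)\<^sup>2 = expo2' fin a"
    using riccati_leading[OF Z e s refl \<kappa> lR eq] unfolding nR by (simp_all add: s_def)
qed

text \<open>
  The residue theorem for the trace \<open>T\<close> of \<open>c\<close> gives a relation between \<open>1, 1/\<alpha>, 1/\<beta>, 1/\<gamma>\<close> in which the
  coefficient of \<open>1\<close> is at least the degree of \<open>c\<close>.
\<close>

theorem no_algebraic_riccati: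
  assumes c: "alg_over Ky c" and E: "derivation E" "\<And>x. x \<in> K \<Longrightarrow> E x = 0" "E y = 1" "E c = -1/2 * (c * c) - R y"
  shows False
proof -
  obtain m where m: "is_minpoly Ky c m" using minpoly_exists[OF Ky c] by blast
  have mK: "m \<in> poly_over Ky" using m by (simp add: is_minpoly_def)
  let ?F = "adjoin Ky c"
  define n where "n = degree m"
  have n: "n > 0" using minpoly_degree[OF m] by (simp add: n_def)
  obtain \<Psi> where \<Psi>: "\<And>fin a. hom_on Ky (\<Psi> fin a)" "\<And>fin a x. x \<in> K \<Longrightarrow> \<Psi> fin a x = fls_const x"
    "\<And>fin a. \<Psi> fin a y = place fin a 1" using place_homs by metis
  define T where "T = - coeff m (n - 1)"
  have T: "T \<in> Ky" using mK by (auto simp: T_def intro: sf_minus Ky poly_overD)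
  have *: "low (- psgn fin) (\<Psi> fin a T) \<and> (\<exists>xs. length xs = n \<and> \<Psi> fin a T $$ (- psgn fin) = sum_list xs \<and>
      (\<forall>x\<in>set xs. (x - 1)\<^sup>2 = expo2' fin a))" for fin a
  proof -
    from puiseux_embeddings[OF AC Ky \<Psi>(1)[of fin a] m] obtain e rs where e: "e > 0" and len: "length rs = n"
      and split: "map_poly (\<lambda>x. ramify e (\<Psi> fin a x)) m = (\<Prod>r\<leftarrow>rs. [:-r, 1:])"
      and emb: "\<And>r. r \<in> set rs \<Longrightarrow> \<exists>\<tau>. hom_on ?F \<tau> \<and> (\<forall>x\<in>Ky. \<tau> x = ramify e (\<Psi> fin a x)) \<and> \<tau> c = r"
      unfolding n_def by metis
    have root: "low (int e * (- psgn fin)) r \<and> (r $$ (int e * (- psgn fin)) - 1)\<^sup>2 = expo2' fin a" if "r \<in> set rs" for r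
    proof -
      from emb[OF that] obtain \<tau> where \<tau>: "hom_on ?F \<tau>" "\<And>x. x \<in> Ky \<Longrightarrow> \<tau> x = ramify e (\<Psi> fin a x)" "\<tau> c = r" by blast
      have \<tau>K: "\<tau> x = fls_const x" if "x \<in> K" for x using \<tau>(2)[OF KKy[OF that]] \<Psi>(2)[OF that] e by simp
      have \<tau>y: "\<tau> y = place fin a e" using \<tau>(2)[OF yKy] \<Psi>(3) ramify_place[OF e] by simp
      show ?thesis using riccati_root[OF c \<tau>(1) \<tau>K \<tau>y e E] \<tau>(3) by (simp add: mult.commute)
    qed
    have "rs \<noteq> []" using len n by auto
    then have "coeff (map_poly (\<lambda>x. ramify e (\<Psi> fin a x)) m) (n - 1) = - sum_list rs"
      using coeff_prod_linear(4)[of rs] by (simp add: split len)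
    then have "ramify e (\<Psi> fin a (coeff m (n - 1))) = - sum_list rs"
      by (simp add: hom_coeff[OF Ky hom_comp_ramify[OF \<Psi>(1) e]])
    then have sum: "ramify e (\<Psi> fin a T) = sum_list rs"
      using mK by (simp add: T_def hom_minus[OF Ky \<Psi>(1)] poly_overD)
    have "low (int e * (- psgn fin)) (ramify e (\<Psi> fin a T))"
      unfolding sum by (rule low_sum_list) (use root in blast)
    then have "low (- psgn fin) (\<Psi> fin a T)" by (rule low_ramifyD[OF e])
    moreover have "\<Psi> fin a T $$ (- psgn fin) = sum_list (map (\<lambda>r. r $$ (int e * (- psgn fin))) rs)"
      using ramify_nth[OF e, of "\<Psi> fin a T" "- psgn fin"] unfolding sum nth_sum_list by simp
    ultimately show ?thesis using root len
      by (intro conjI exI[of _ "map (\<lambda>r. r $$ (int e * (- psgn fin))) rs"]) auto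
  qed
  have low: "\<And>a. low (-1) (\<Psi> True a T)" "low 1 (\<Psi> False 0 T)"
    using *[of True] *[of False 0] by (auto simp: psgn_def)
  define res where "res a = \<Psi> True a T $$ (-1)" for a
  define S where "S = {a. res a \<noteq> 0}"
  have fin: "finite S" and C: "\<Psi> False 0 T $$ 1 = sum res S"
    using rational_residues(1,2)[OF \<Psi> T low] by (simp_all add: S_def res_def)
  have ex: "\<exists>k::int. \<Psi> fin a T $$ (- psgn fin) = of_nat n + of_int k * p" if "expo2' fin a = p\<^sup>2" for fin a p
    using *[of fin a] sum_exponents[of _ p] that by metis
  obtain k :: int where k: "\<Psi> False 0 T $$ 1 = of_nat n + of_int k * pa"
    using ex[of False 0 pa] by (auto simp: expo2_def psgn_def)
  obtain k0 :: int where k0: "res 0 = of_nat n + of_int k0 * pb"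
    using ex[of True 0 pb] by (auto simp: expo2_def psgn_def res_def)
  obtain k1 :: int where k1: "res 1 = of_nat n + of_int k1 * pc"
    using ex[of True 1 pc] by (auto simp: expo2_def psgn_def res_def)
  have "\<exists>j::nat. res a = 2 * of_nat j" if aS: "a \<in> S - {0, 1}" for a
  proof -
    obtain xs where "res a = sum_list xs" "\<forall>x\<in>set xs. (x - 1)\<^sup>2 = 1"
      using *[of True a] aS by (auto simp: expo2_def psgn_def res_def)
    then show ?thesis using sum_even_exponents[of xs] by auto
  qed
  then obtain j :: "'u \<Rightarrow> nat" where j: "\<And>a. a \<in> S - {0, 1} \<Longrightarrow> res a = 2 * of_nat (j a)" by metis
  define J where "J = (\<Sum>a\<in>S - {0, 1}. j a)"
  \<comment> \<open>The points \<open>0\<close> and \<open>1\<close> are added so that their residues can be split off.\<close>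
  have "sum res S = sum res (S \<union> {0, 1})"
    by (rule sum.mono_neutral_left) (use fin in \<open>auto simp: S_def\<close>)
  also have "S \<union> {0, 1} = insert 0 (insert 1 (S - {0, 1}))" by auto
  also have "sum res \<dots> = res 0 + (res 1 + sum res (S - {0, 1}))" using fin by simp
  also have "sum res (S - {0, 1}) = 2 * of_nat J"
    by (simp add: j of_nat_sum sum_distrib_left J_def)
  finally have "of_int (int (n + 2 * J)) + of_int (- k) * pa + of_int k0 * pb + of_int k1 * pc = 0"
    using C k k0 k1 by (simp add: algebra_simps)
  from indep[OF this] show False using n by simp
qed

subsection \<open>No solutions of order two\<close>

text \<open>
  The leading coefficient \<open>c\<close> of \<open>v\<close> at \<open>u = \<infinity>\<close> is chosen before the derivation \<open>E\<close> that extends \<open>d/dy\<close>.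
  Were \<open>c\<close> transcendental over \<open>K(y)\<close>, its image under \<open>E\<close> could be altered at will, but the Riccati equation
  determines it.
\<close>

theorem no_order2:
  assumes u: "d y = u" "\<not> alg_over Ky u" and v: "d u = v" "alg_over (adjoin Ky u) v"
    and ode: "u * d v = 3/2 * (v * v) - (u * u) * (u * u) * R y"
  shows False
proof -
  let ?k = "adjoin Ky u" and ?F = "adjoin (adjoin Ky u) v"
  have k: "is_subfield ?k" by (rule is_subfield_adjoin[OF Ky])
  have F: "is_subfield ?F" by (rule is_subfield_adjoin[OF k])
  have kF: "?k \<subseteq> ?F" by (auto intro: adjoin_base[OF k])
  have KyF: "x \<in> ?F" if "x \<in> Ky" for x using that adjoin_base[OF Ky, of x u] kF by blast
  have uk: "u \<in> ?k" by (rule adjoin_gen[OF Ky])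
  have uF: "u \<in> ?F" using uk kF by blast
  have vF: "v \<in> ?F" by (rule adjoin_gen[OF k])
  have RF: "R y \<in> ?F" by (rule KyF[OF RKy])
  have u0: "u \<noteq> 0"
  proof
    assume "u = 0"
    then show False using u(2) po_pCons_iff[OF Ky, of 0 1] po_one[OF Ky] sf_zero[OF Ky]
      unfolding alg_over_def by (metis mult_zero_left pCons_eq_0_iff poly_pCons zero_neq_one add_0)
  qed
  have "d v = (3/2 * (v * v) - (u * u) * (u * u) * R y) / u" using ode u0 by (simp add: field_simps)
  also have "\<dots> \<in> ?F" using uF vF RF by (intro sf_intros F)
  finally have dvF: "d v \<in> ?F" .
  have dKy: "d x \<in> ?F" if "x \<in> Ky" for x
    by (rule derivation_adjoin[OF d F _ _ _ _ that]) (use KyF KKy dK yKy u(1) uF in auto)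
  have dk: "d x \<in> ?F" if "x \<in> ?k" for x
    by (rule derivation_adjoin[OF d F _ dKy uF _ that]) (use KyF v vF in auto)
  have dF: "d x \<in> ?F" if "x \<in> ?F" for x by (rule derivation_adjoin[OF d F kF dk vF dvF that])
  obtain \<Psi> where \<Psi>: "hom_on ?k \<Psi>" "\<And>x. x \<in> Ky \<Longrightarrow> \<Psi> x = fls_const x" "\<Psi> u = fls_X_inv"
    using hom_extend_transcendental[OF Ky hom_fls_const u(2), of fls_X_inv] const_eval_eq_0[OF fls_deriv_place(2)] by metis
  obtain m where m: "is_minpoly ?k v m" using minpoly_exists[OF k v(2)] by blast
  from puiseux_embeddings[OF AC k \<Psi>(1) m] obtain e rs where e: "e > 0" and len: "length rs = degree m"
    and emb: "\<And>r. r \<in> set rs \<Longrightarrow> \<exists>\<tau>. hom_on ?F \<tau> \<and> (\<forall>x\<in>?k. \<tau> x = ramify e (\<Psi> x)) \<and> \<tau> v = r" by metis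
  have "hd rs \<in> set rs" using len minpoly_degree[OF m] by (intro hd_in_set) auto
  then obtain \<phi> \<tau> where \<tau>: "hom_on ?F \<tau>" "\<And>x. x \<in> ?k \<Longrightarrow> \<tau> x = ramify e (\<Psi> x)" "\<tau> v = \<phi>" using emb by blast
  have \<tau>Ky: "\<tau> x = fls_const x" if "x \<in> Ky" for x
    using \<tau>(2)[OF adjoin_base[OF Ky that]] \<Psi>(2)[OF that] e by simp
  define X where "X = (fls_X_intpow (- int e) :: 'u fls)"
  have \<tau>u: "\<tau> u = X" using \<tau>(2)[OF uk] \<Psi>(3) e by (simp add: X_def)
  define c where "c = \<phi> $$ (- 2 * int e)"
  have riccati: "E c = -1/2 * (c * c) - R y"
    if E: "derivation E" "\<And>x. x \<in> K \<Longrightarrow> E x = 0" "E y = 1" for E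
  proof -
    \<comment> \<open>On functions of \<open>y\<close> the derivation splits as \<open>P + u E\<close>, and both parts preserve \<open>K(y)\<close>.\<close>
    define P where "P x = d x - u * E x" for x
    have P: "derivation P" unfolding derivation_def P_def
      using derivation_add[OF d] derivation_mult[OF d] derivation_add[OF E(1)] derivation_mult[OF E(1)]
      by (simp add: algebra_simps)
    have Ek: "E x \<in> Ky" if "x \<in> Ky" for x
      by (rule derivation_adjoin[OF E(1) Ky _ _ yKy _ that]) (use KKy E sf_zero[OF Ky] sf_one[OF Ky] in auto)
    have Pk: "P x \<in> Ky" if "x \<in> Ky" for x
      by (rule derivation_adjoin[OF P Ky _ _ yKy _ that]) (use KKy E dK sf_zero[OF Ky] u(1) in \<open>auto simp: P_def\<close>)
    define D' where "D' f = fls_map P f + X * fls_map E f + kap False e \<phi> * (fls_X * fls_deriv f)" for f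
    have D': "derivation D'" unfolding derivation_def D'_def
      using derivation_add[OF derivation_fls_map[OF P]] derivation_mult[OF derivation_fls_map[OF P]]
        derivation_add[OF derivation_fls_map[OF E(1)]] derivation_mult[OF derivation_fls_map[OF E(1)]]
      by (simp add: algebra_simps)
    note z = derivation_zero[OF P] derivation_zero[OF E(1)] derivation_one[OF P] derivation_one[OF E(1)]
    have agree: "D' (\<tau> x) = \<tau> (d x)" if x: "x \<in> ?F" for x
    proof (rule derivations_agree[OF Ky v(2) \<tau>(1) d dF D' _ _ x])
      fix x assume x: "x \<in> Ky"
      have "d x = P x + u * E x" by (simp add: P_def)
      then have "\<tau> (d x) = \<tau> (P x) + \<tau> u * \<tau> (E x)"
        using KyF[OF Pk[OF x]] KyF[OF Ek[OF x]] uF by (simp add: hom_add[OF \<tau>(1)] hom_mult[OF \<tau>(1)] sf_mult[OF F])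
      then show "D' (\<tau> x) = \<tau> (d x)"
        using Pk[OF x] Ek[OF x] x by (simp add: D'_def \<tau>Ky \<tau>u fls_map_const z)
    next
      have "X = place False 0 e" by (simp add: X_def place_def)
      then have "kap False e \<phi> * (fls_X * fls_deriv X) = \<phi>" using kap_place[OF e] by simp
      moreover have "fls_map P X = 0" "fls_map E X = 0" unfolding X_def by (intro fls_map_X_intpow z)+
      ultimately show "D' (\<tau> u) = \<tau> (d u)" by (simp add: \<tau>u D'_def v(1) \<tau>(3))
    qed
    have t32: "\<tau> (3/2) = fls_const (3/2)" by (rule \<tau>Ky) (intro sf_intros Ky)
    have c32: "3/2 \<in> ?F" by (intro sf_intros F)
    have "\<tau> (u * d v) = \<tau> (3/2 * (v * v) - (u * u) * (u * u) * R y)" by (simp only: ode)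
    then have "X * D' \<phi> = fls_const (3/2) * (\<phi> * \<phi>) - (X * X) * (X * X) * fls_const (R y)"
      using uF vF dvF RF c32
      by (simp add: hom_mult[OF \<tau>(1)] hom_diff[OF F \<tau>(1)] sf_mult[OF F] t32 \<tau>u \<tau>(3) \<tau>Ky RKy
          del: times_divide_eq_left times_divide_eq_right flip: agree)
    moreover have "(X * X) * (X * X) = fls_X_intpow (- 4 * int e)" by (simp only: X_def X_intpow_mult) simp
    ultimately have "fls_X_intpow (- int e) * (fls_map P \<phi> + fls_X_intpow (- int e) * fls_map E \<phi> + kap False e \<phi> * (fls_X * fls_deriv \<phi>)) =
      fls_const (3/2) * (\<phi> * \<phi>) - fls_X_intpow (- 4 * int e) * fls_const (R y)"
      by (simp only: D'_def X_def)
    from order2_leading[OF P E(1) e this] show ?thesis by (simp only: c_def)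
  qed
  have Z: "derivation (\<lambda>x::'u. 0)" by (simp add: derivation_def)
  obtain E where E: "derivation E" "\<And>x. x \<in> K \<Longrightarrow> E x = 0" "E y = 1"
    using derivation_extend[OF K Z y, of 1] by metis
  show False
  proof (cases "alg_over Ky c")
    case True
    then show False by (rule no_algebraic_riccati[OF _ E riccati[OF E]])
  next
    case False
    obtain E' where E': "derivation E'" "\<And>x. x \<in> Ky \<Longrightarrow> E' x = E x" "E' c = E c + 1"
      using derivation_extend[OF Ky E(1) False] by metis
    have "E' c = -1/2 * (c * c) - R y"
      by (rule riccati) (use E' E KKy yKy in auto)
    then show False using E'(3) riccati[OF E] by simp
  qed
qed

end

section \<open>Evaluating multivariate polynomials\<close>

definition mono_eval :: "('i \<Rightarrow> 'a::comm_semiring_1) \<Rightarrow> ('i \<Rightarrow>\<^sub>0 nat) \<Rightarrow> 'a" where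
  "mono_eval x m = (\<Prod>i\<in>Poly_Mapping.keys m. x i ^ Poly_Mapping.lookup m i)"

lemma mpol_eval_def': "mpol_eval h x p = (\<Sum>m\<in>Poly_Mapping.keys p. h (Poly_Mapping.lookup p m) * mono_eval x m)"
  by (simp add: mpol_eval_def mono_eval_def)

lemma mono_eval_superset:
  "finite S \<Longrightarrow> Poly_Mapping.keys m \<subseteq> S \<Longrightarrow> mono_eval x m = (\<Prod>i\<in>S. x i ^ Poly_Mapping.lookup m i)"
  unfolding mono_eval_def by (rule prod.mono_neutral_left) (auto simp: in_keys_iff)

lemma mono_eval_add: "mono_eval x (m + m') = mono_eval x m * mono_eval x m'"
proof -
  let ?S = "Poly_Mapping.keys m \<union> Poly_Mapping.keys m'"
  have "mono_eval x (m + m') = (\<Prod>i\<in>?S. x i ^ Poly_Mapping.lookup (m + m') i)"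
    by (rule mono_eval_superset) (use Poly_Mapping.keys_add[of m m'] in auto)
  then show ?thesis
    by (simp add: mono_eval_superset[of ?S m] mono_eval_superset[of ?S m'] lookup_add power_add prod.distrib)
qed

lemma mono_eval_0 [simp]: "mono_eval x 0 = 1"
  by (simp add: mono_eval_def)

lemma mono_eval_single [simp]: "mono_eval x (Poly_Mapping.single i (Suc 0)) = x i"
  by (simp add: mono_eval_def)

lemma mpol_eval_superset:
  assumes "h 0 = 0" "finite S" "Poly_Mapping.keys p \<subseteq> S"
  shows "mpol_eval h x p = (\<Sum>m\<in>S. h (Poly_Mapping.lookup p m) * mono_eval x m)"
  unfolding mpol_eval_def' using assms by (intro sum.mono_neutral_left) (auto simp: in_keys_iff)

lemma mpol_sum_single: "p = (\<Sum>m\<in>Poly_Mapping.keys p. Poly_Mapping.single m (Poly_Mapping.lookup p m))"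
  for p :: "'k \<Rightarrow>\<^sub>0 'c::comm_monoid_add"
proof (rule poly_mapping_eqI)
  fix k
  have "(\<Sum>m\<in>Poly_Mapping.keys p. Poly_Mapping.lookup (Poly_Mapping.single m (Poly_Mapping.lookup p m)) k) =
    (\<Sum>m\<in>Poly_Mapping.keys p. if m = k then Poly_Mapping.lookup p m else 0)"
    by (rule sum.cong) (auto simp: lookup_single when_def)
  also have "\<dots> = Poly_Mapping.lookup p k" by (simp add: in_keys_iff)
  finally show "Poly_Mapping.lookup p k = Poly_Mapping.lookup (\<Sum>m\<in>Poly_Mapping.keys p. Poly_Mapping.single m (Poly_Mapping.lookup p m)) k"
    by (simp add: lookup_sum)
qed

lemma mpol_mult_single: "p * q = (\<Sum>m\<in>Poly_Mapping.keys p. \<Sum>n\<in>Poly_Mapping.keys q.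
    Poly_Mapping.single (m + n) (Poly_Mapping.lookup p m * Poly_Mapping.lookup q n))"
  for p q :: "('i, 'c::comm_ring_1) mpol"
  by (subst (1) mpol_sum_single[of p], subst (1) mpol_sum_single[of q])
    (simp add: sum_distrib_left sum_distrib_right mult_single, rule sum.swap)

abbreviation mX :: "'i \<Rightarrow> ('i, 'c::comm_ring_1) mpol" where
  "mX i \<equiv> Poly_Mapping.single (Poly_Mapping.single i (Suc 0)) 1"

abbreviation mC :: "'c \<Rightarrow> ('i, 'c::comm_ring_1) mpol" where
  "mC c \<equiv> Poly_Mapping.single 0 c"

context
  fixes h :: "'c::field \<Rightarrow> 'a::comm_ring_1"
  assumes h: "hom_on UNIV h"
begin

lemma h_hom: "h 0 = 0" "h 1 = 1" "h (a + b) = h a + h b" "h (a * b) = h a * h b"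
  using hom_zero[OF is_subfield_UNIV h] hom_one[OF h] hom_add[OF h] hom_mult[OF h] by auto

lemma mpol_eval_add: "mpol_eval h x (p + q) = mpol_eval h x p + mpol_eval h x q"
proof -
  let ?S = "Poly_Mapping.keys p \<union> Poly_Mapping.keys q"
  have "mpol_eval h x (p + q) = (\<Sum>m\<in>?S. h (Poly_Mapping.lookup (p + q) m) * mono_eval x m)"
    by (rule mpol_eval_superset) (use Poly_Mapping.keys_add[of p q] h_hom in auto)
  then show ?thesis
    by (simp add: mpol_eval_superset[of h ?S p] mpol_eval_superset[of h ?S q] h_hom lookup_add distrib_right sum.distrib)
qed

lemma mpol_eval_0: "mpol_eval h x 0 = 0"
  by (simp add: mpol_eval_def)

lemma mpol_eval_sum: "mpol_eval h x (sum f A) = (\<Sum>i\<in>A. mpol_eval h x (f i))"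
  by (induction A rule: infinite_finite_induct) (simp_all add: mpol_eval_0 mpol_eval_add)

lemma mpol_eval_single: "mpol_eval h x (Poly_Mapping.single m c) = h c * mono_eval x m"
  by (simp add: mpol_eval_def' h_hom)

lemma mpol_eval_mult: "mpol_eval h x (p * q) = mpol_eval h x p * mpol_eval h x q"
proof -
  have "mpol_eval h x (p * q) = (\<Sum>m\<in>Poly_Mapping.keys p. \<Sum>n\<in>Poly_Mapping.keys q.
      h (Poly_Mapping.lookup p m) * h (Poly_Mapping.lookup q n) * (mono_eval x m * mono_eval x n))"
    unfolding mpol_mult_single[of p q]
    by (simp add: mpol_eval_sum mpol_eval_single mono_eval_add h_hom)
  also have "\<dots> = mpol_eval h x p * mpol_eval h x q"
    by (simp add: mpol_eval_def' sum_product mult_ac)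
  finally show ?thesis .
qed

lemma mpol_eval_1: "mpol_eval h x 1 = 1"
  using mpol_eval_single[of x 0 1] by (simp add: h_hom)

lemma mpol_eval_prod: "mpol_eval h x (prod f A) = (\<Prod>i\<in>A. mpol_eval h x (f i))"
  by (induction A rule: infinite_finite_induct) (simp_all add: mpol_eval_1 mpol_eval_mult)

lemma mpol_eval_power: "mpol_eval h x (p ^ n) = mpol_eval h x p ^ n"
  by (induction n) (simp_all add: mpol_eval_1 mpol_eval_mult)

lemma mpol_eval_mX: "mpol_eval h x (mX i) = x i"
  using mpol_eval_single[of x "Poly_Mapping.single i (Suc 0)" 1] by (simp add: h_hom)

lemma mpol_eval_mC: "mpol_eval h x (mC c) = h c"
  by (simp add: mpol_eval_single)

lemmas mpol_eval_simps = mpol_eval_0 mpol_eval_1 mpol_eval_add mpol_eval_mult mpol_eval_power mpol_eval_mX mpol_eval_mC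

end

lemma mpol_eval_cong: "(\<And>i. i \<in> mpol_vars p \<Longrightarrow> x i = y i) \<Longrightarrow> mpol_eval h x p = mpol_eval h y p"
  unfolding mpol_eval_def' mono_eval_def mpol_vars_def
  by (intro sum.cong refl arg_cong2[of _ _ _ _ "(*)"] prod.cong arg_cong2[of _ _ _ _ "(^)"]) auto

lemma mpol_vars_0 [simp]: "mpol_vars 0 = {}"
  by (simp add: mpol_vars_def)

lemma mpol_vars_add: "mpol_vars (p + q) \<subseteq> mpol_vars p \<union> mpol_vars q"
  using Poly_Mapping.keys_add[of p q] by (auto simp: mpol_vars_def)

lemma mpol_vars_mult: "mpol_vars (p * q) \<subseteq> mpol_vars p \<union> mpol_vars q" for p q :: "('i, 'c::comm_ring_1) mpol"
proof -
  have "Poly_Mapping.keys (p * q) \<subseteq> {a + b |a b. a \<in> Poly_Mapping.keys p \<and> b \<in> Poly_Mapping.keys q}"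
    by (rule keys_mult)
  then show ?thesis unfolding mpol_vars_def using Poly_Mapping.keys_add by fastforce
qed

lemma mpol_vars_single: "mpol_vars (Poly_Mapping.single m c) \<subseteq> Poly_Mapping.keys m"
  by (auto simp: mpol_vars_def split: if_splits)

definition mp_over :: "'c::field set \<Rightarrow> nat \<Rightarrow> (nat, 'c) mpol set" where
  "mp_over K n = {p. (\<forall>m. Poly_Mapping.lookup p m \<in> K) \<and> mpol_vars p \<subseteq> {..<n}}"

context
  fixes K :: "'c::field set"
  assumes K: "is_subfield K"
begin

lemma mp_over_0: "0 \<in> mp_over K n"
  by (simp add: mp_over_def sf_zero[OF K])

lemma mp_over_add: "p \<in> mp_over K n \<Longrightarrow> q \<in> mp_over K n \<Longrightarrow> p + q \<in> mp_over K n"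
  using mpol_vars_add[of p q] by (auto simp: mp_over_def lookup_add intro: sf_add[OF K])

lemma mp_over_sum: "(\<And>i. i \<in> A \<Longrightarrow> f i \<in> mp_over K n) \<Longrightarrow> sum f A \<in> mp_over K n"
  by (induction A rule: infinite_finite_induct) (auto intro: mp_over_0 mp_over_add)

lemma mp_over_single: "c \<in> K \<Longrightarrow> Poly_Mapping.keys m \<subseteq> {..<n} \<Longrightarrow> Poly_Mapping.single m c \<in> mp_over K n"
  using mpol_vars_single[of m c] by (auto simp: mp_over_def lookup_single when_def sf_zero[OF K])

lemma mp_over_mult:
  assumes "p \<in> mp_over K n" "q \<in> mp_over K n"
  shows "p * q \<in> mp_over K n"
proof -
  have "Poly_Mapping.lookup (p * q) m \<in> K" for m
    unfolding mpol_mult_single[of p q] lookup_sum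
    using assms by (intro sf_sum[OF K]) (auto simp: lookup_single when_def mp_over_def intro: sf_zero[OF K] sf_mult[OF K])
  then show ?thesis using assms mpol_vars_mult[of p q] by (auto simp: mp_over_def)
qed

lemma mp_over_1: "1 \<in> mp_over K n"
  using mp_over_single[of 1 0 n] by (simp add: sf_one[OF K])

lemma mp_over_prod: "(\<And>i. i \<in> A \<Longrightarrow> f i \<in> mp_over K n) \<Longrightarrow> prod f A \<in> mp_over K n"
  by (induction A rule: infinite_finite_induct) (auto intro: mp_over_1 mp_over_mult)

lemma mp_over_power: "p \<in> mp_over K n \<Longrightarrow> p ^ j \<in> mp_over K n"
  by (induction j) (auto intro: mp_over_1 mp_over_mult)

lemma mp_over_mX: "i < n \<Longrightarrow> mX i \<in> mp_over K n"
  by (rule mp_over_single) (auto simp: sf_one[OF K] split: if_splits)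

lemma mp_over_mC: "c \<in> K \<Longrightarrow> mC c \<in> mp_over K n"
  by (rule mp_over_single) auto

end

lemma mp_over_mono: "p \<in> mp_over K n \<Longrightarrow> n \<le> n' \<Longrightarrow> p \<in> mp_over K n'"
  by (auto simp: mp_over_def)

abbreviation ev :: "(nat \<Rightarrow> 'u::field) \<Rightarrow> (nat, 'u) mpol \<Rightarrow> 'u" where
  "ev \<equiv> mpol_eval (\<lambda>c. c)"

lemma hom_id: "hom_on UNIV (\<lambda>c. c :: 'u::field)"
  by (simp add: hom_on_def)

lemmas ev_simps = mpol_eval_simps[OF hom_id]

lemma mp_over_cong: "p \<in> mp_over K n \<Longrightarrow> (\<And>i. i < n \<Longrightarrow> x i = y i) \<Longrightarrow> ev x p = ev y p"
  by (rule mpol_eval_cong) (auto simp: mp_over_def)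

definition mp_map :: "('c::field \<Rightarrow> 'c) \<Rightarrow> (nat, 'c) mpol \<Rightarrow> (nat, 'c) mpol" where
  "mp_map \<sigma> p = (\<Sum>m\<in>Poly_Mapping.keys p. Poly_Mapping.single m (\<sigma> (Poly_Mapping.lookup p m)))"

context
  fixes K :: "'c::field set" and \<sigma> :: "'c \<Rightarrow> 'c"
  assumes K: "is_subfield K" and \<sigma>: "hom_on K \<sigma>"
begin

lemma mp_map_lookup: "Poly_Mapping.lookup (mp_map \<sigma> p) k = \<sigma> (Poly_Mapping.lookup p k)"
proof -
  have "Poly_Mapping.lookup (mp_map \<sigma> p) k = (\<Sum>m\<in>Poly_Mapping.keys p. if m = k then \<sigma> (Poly_Mapping.lookup p m) else 0)"
    unfolding mp_map_def lookup_sum by (rule sum.cong) (auto simp: lookup_single when_def)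
  then show ?thesis by (simp add: in_keys_iff hom_zero[OF K \<sigma>])
qed

lemma mp_map_keys: "p \<in> mp_over K n \<Longrightarrow> Poly_Mapping.keys (mp_map \<sigma> p) = Poly_Mapping.keys p"
  by (auto simp: in_keys_iff mp_map_lookup hom_eq_0_iff[OF K \<sigma>] mp_over_def)

lemma mp_map_vars: "p \<in> mp_over K n \<Longrightarrow> mpol_vars (mp_map \<sigma> p) = mpol_vars p"
  by (simp add: mpol_vars_def mp_map_keys)

lemma mp_map_over: "p \<in> mp_over K n \<Longrightarrow> mp_map \<sigma> p \<in> mp_over (\<sigma> ` K) n"
  using mp_map_vars[of p n] by (simp add: mp_over_def mp_map_lookup)

lemma mp_map_add: "p \<in> mp_over K n \<Longrightarrow> q \<in> mp_over K n \<Longrightarrow> mp_map \<sigma> (p + q) = mp_map \<sigma> p + mp_map \<sigma> q"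
  by (rule poly_mapping_eqI) (simp add: mp_map_lookup lookup_add hom_add[OF \<sigma>] mp_over_def)

lemma mp_map_0: "mp_map \<sigma> 0 = 0"
  by (simp add: mp_map_def)

lemma mp_map_sum: "(\<And>i. i \<in> A \<Longrightarrow> f i \<in> mp_over K n) \<Longrightarrow> mp_map \<sigma> (sum f A) = (\<Sum>i\<in>A. mp_map \<sigma> (f i))"
  by (induction A rule: infinite_finite_induct) (simp_all add: mp_map_0 mp_map_add[of _ n] mp_over_sum[OF K])

lemma mp_map_mult_mX:
  assumes "p \<in> mp_over K n"
  shows "mp_map \<sigma> (p * mX i ^ j) = mp_map \<sigma> p * mX i ^ j"
proof (rule poly_mapping_eqI)
  fix k
  have X: "mX i ^ j = Poly_Mapping.single (Poly_Mapping.single i j) (1 :: 'c)"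
    by (induction j) (simp_all add: mult_single single_add[symmetric])
  let ?e = "Poly_Mapping.single i j"
  have l: "Poly_Mapping.lookup (q * Poly_Mapping.single ?e 1) k =
      (\<Sum>m\<in>Poly_Mapping.keys q. if m + ?e = k then Poly_Mapping.lookup q m else 0)" for q :: "(nat, 'c) mpol"
    unfolding mpol_mult_single[of q] by (simp add: lookup_sum lookup_single when_def)
  show "Poly_Mapping.lookup (mp_map \<sigma> (p * mX i ^ j)) k = Poly_Mapping.lookup (mp_map \<sigma> p * mX i ^ j) k"
    unfolding X mp_map_lookup l mp_map_keys[OF assms]
    using assms by (subst hom_sum[OF K \<sigma>]) (auto simp: mp_over_def sf_zero[OF K] hom_zero[OF K \<sigma>] mp_map_lookup intro!: sum.cong)
qed

lemma mp_map_eval: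
  assumes "p \<in> mp_over K n" and L: "is_subfield L" "hom_on L \<tau>" "K \<subseteq> L" "\<And>x. x \<in> K \<Longrightarrow> \<tau> x = \<sigma> x"
    and x: "\<And>i. i < n \<Longrightarrow> x i \<in> L" "\<And>i. i < n \<Longrightarrow> x' i = \<tau> (x i)"
  shows "ev x' (mp_map \<sigma> p) = \<tau> (ev x p)" "ev x p \<in> L"
proof -
  have mono: "mono_eval x m \<in> L \<and> \<tau> (mono_eval x m) = mono_eval x' m" if "m \<in> Poly_Mapping.keys p" for m
  proof -
    have sub: "Poly_Mapping.keys m \<subseteq> {..<n}" using assms(1) that by (auto simp: mp_over_def mpol_vars_def)
    have *: "(\<Prod>i\<in>A. x i ^ f i) \<in> L \<and> \<tau> (\<Prod>i\<in>A. x i ^ f i) = (\<Prod>i\<in>A. x' i ^ f i)" if "finite A" "A \<subseteq> {..<n}" for A f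
      using that by (induction A rule: finite_induct)
        (auto simp: sf_one[OF L(1)] hom_one[OF L(2)] hom_mult[OF L(2)] hom_power[OF L(1,2)] x
          sf_mult[OF L(1)] sf_power[OF L(1)])
    show ?thesis unfolding mono_eval_def by (rule *) (use sub in auto)
  qed
  have co: "Poly_Mapping.lookup p m \<in> L" "\<tau> (Poly_Mapping.lookup p m) = \<sigma> (Poly_Mapping.lookup p m)" for m
    using assms(1) L by (auto simp: mp_over_def)
  show "ev x p \<in> L" unfolding mpol_eval_def' using mono co by (intro sf_sum[OF L(1)] sf_mult[OF L(1)]) auto
  have "\<tau> (ev x p) = (\<Sum>m\<in>Poly_Mapping.keys p. \<tau> (Poly_Mapping.lookup p m * mono_eval x m))"
    unfolding mpol_eval_def' using mono co by (intro hom_sum[OF L(1,2)] sf_mult[OF L(1)]) auto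
  also have "\<dots> = (\<Sum>m\<in>Poly_Mapping.keys p. \<sigma> (Poly_Mapping.lookup p m) * mono_eval x' m)"
    using mono co by (intro sum.cong) (auto simp: hom_mult[OF L(2)])
  also have "\<dots> = ev x' (mp_map \<sigma> p)"
    unfolding mpol_eval_def' mp_map_keys[OF assms(1)] mp_map_lookup ..
  finally show "ev x' (mp_map \<sigma> p) = \<tau> (ev x p)" by simp
qed

end

section \<open>Towers of simple extensions\<close>

primrec tower :: "'u::field set \<Rightarrow> (nat \<Rightarrow> 'u) \<Rightarrow> nat \<Rightarrow> 'u set" where
  "tower K c 0 = K"
| "tower K c (Suc n) = adjoin (tower K c n) (c n)"

lemma is_subfield_tower: "is_subfield K \<Longrightarrow> is_subfield (tower K c n)"
  by (induction n) (simp_all add: is_subfield_adjoin)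

lemma tower_mono: "is_subfield K \<Longrightarrow> m \<le> n \<Longrightarrow> tower K c m \<subseteq> tower K c n"
proof (induction n)
  case (Suc n)
  have "tower K c n \<subseteq> tower K c (Suc n)" using adjoin_base[OF is_subfield_tower[OF Suc.prems(1)]] by auto
  then show ?case using Suc by (cases "m = Suc n") auto
qed simp

lemma tower_base: "is_subfield K \<Longrightarrow> x \<in> K \<Longrightarrow> x \<in> tower K c n"
  using tower_mono[of K 0 n c] by auto

lemma tower_gen: "is_subfield K \<Longrightarrow> i < n \<Longrightarrow> c i \<in> tower K c n"
  using tower_mono[of K "Suc i" n c] adjoin_gen[OF is_subfield_tower[of K c i], of "c i"] by auto

text \<open>
  The hypothesis on fractions holds throughout, by \<open>tower_fractions\<close>, whose induction step in turn
  rests on this lemma.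
\<close>

lemma clear_denominators:
  assumes K: "is_subfield K" and p: "p \<in> poly_over (tower K c n)"
    and frac: "\<And>x. x \<in> tower K c n \<Longrightarrow> \<exists>g\<in>mp_over K n. \<exists>h\<in>mp_over K n. ev c h \<noteq> 0 \<and> x = ev c g / ev c h"
  obtains h G where "h \<in> mp_over K n" "ev c h \<noteq> 0" "\<And>j. G j \<in> mp_over K n" "\<And>j. ev c (G j) = ev c h * coeff p j"
proof -
  have "\<exists>h G. h \<in> mp_over K n \<and> ev c h \<noteq> 0 \<and> (\<forall>j. G j \<in> mp_over K n) \<and> (\<forall>j. ev c (G j) = ev c h * coeff p j)"
    using p
  proof (induction p)
    case 0
    then show ?case by (intro exI[of _ 1] exI[of _ "\<lambda>_. 0"]) (auto simp: ev_simps mp_over_1[OF K] mp_over_0[OF K])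
  next
    case (pCons a p)
    then have a: "a \<in> tower K c n" and p: "p \<in> poly_over (tower K c n)"
      by (auto simp: po_pCons_iff is_subfield_tower K)
    from frac[OF a] obtain g1 h1 where 1: "g1 \<in> mp_over K n" "h1 \<in> mp_over K n" "ev c h1 \<noteq> 0" "a = ev c g1 / ev c h1" by blast
    from pCons.IH[OF p] obtain h G where 2: "h \<in> mp_over K n" "ev c h \<noteq> 0" "\<forall>j. G j \<in> mp_over K n"
      "\<forall>j. ev c (G j) = ev c h * coeff p j" by blast
    show ?case
      using 1 2 by (intro exI[of _ "h * h1"] exI[of _ "\<lambda>j. case j of 0 \<Rightarrow> h * g1 | Suc j \<Rightarrow> h1 * G j"])
        (auto simp: ev_simps coeff_pCons split: nat.splits intro!: mp_over_mult[OF K])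
  qed
  then show ?thesis using that by blast
qed

definition as_mpol :: "nat \<Rightarrow> nat \<Rightarrow> (nat \<Rightarrow> (nat, 'u::field) mpol) \<Rightarrow> (nat, 'u) mpol" where
  "as_mpol N n G = (\<Sum>j\<le>N. G j * mX n ^ j)"

lemma ev_as_mpol: "ev e (as_mpol N n G) = (\<Sum>j\<le>N. ev e (G j) * e n ^ j)"
  unfolding as_mpol_def by (simp add: mpol_eval_sum[OF hom_id] ev_simps)

lemma as_mpol_over: "is_subfield K \<Longrightarrow> (\<And>j. G j \<in> mp_over K n) \<Longrightarrow> as_mpol N n G \<in> mp_over K (Suc n)"
  unfolding as_mpol_def
  by (intro mp_over_sum mp_over_mult mp_over_power mp_over_mX)
    (auto intro: mp_over_mono[OF _ le_SucI[OF order_refl]])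

lemma ev_as_mpol_poly:
  assumes G: "\<And>j. G j \<in> mp_over K n" "\<And>j. ev c (G j) = w * coeff p j"
  shows "ev (c(n := t)) (as_mpol (degree p) n G) = w * poly p t"
proof -
  have "ev (c(n := t)) (G j) = w * coeff p j" for j
    unfolding G(2)[symmetric] by (rule mp_over_cong[OF G(1)]) simp
  then show ?thesis by (simp add: ev_as_mpol poly_altdef sum_distrib_left mult.assoc)
qed

lemma tower_fractions:
  assumes K: "is_subfield K"
  shows "x \<in> tower K c n \<Longrightarrow> \<exists>g\<in>mp_over K n. \<exists>h\<in>mp_over K n. ev c h \<noteq> 0 \<and> x = ev c g / ev c h"
proof (induction n arbitrary: x)
  case 0
  then show ?case
    by (intro bexI[of _ "mC x"] bexI[of _ 1]) (auto simp: ev_simps mp_over_1[OF K] mp_over_mC[OF K])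
next
  case (Suc n)
  then obtain p q where pq: "x = poly p (c n) / poly q (c n)" "p \<in> poly_over (tower K c n)"
    "q \<in> poly_over (tower K c n)" "poly q (c n) \<noteq> 0" unfolding adjoin_def tower.simps by blast
  from clear_denominators[OF K pq(2) Suc.IH] obtain h1 G1 where 1: "h1 \<in> mp_over K n" "ev c h1 \<noteq> 0"
    "\<And>j. G1 j \<in> mp_over K n" "\<And>j. ev c (G1 j) = ev c h1 * coeff p j" by metis
  from clear_denominators[OF K pq(3) Suc.IH] obtain h2 G2 where 2: "h2 \<in> mp_over K n" "ev c h2 \<noteq> 0"
    "\<And>j. G2 j \<in> mp_over K n" "\<And>j. ev c (G2 j) = ev c h2 * coeff q j" by metis
  let ?P = "as_mpol (degree p) n G1" and ?Q = "as_mpol (degree q) n G2"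
  have P: "ev c ?P = ev c h1 * poly p (c n)" and Q: "ev c ?Q = ev c h2 * poly q (c n)"
    using ev_as_mpol_poly[of G1 K n c "ev c h1" p "c n", OF 1(3,4)] ev_as_mpol_poly[of G2 K n c "ev c h2" q "c n", OF 2(3,4)]
    by simp_all
  have "h1 \<in> mp_over K (Suc n)" "h2 \<in> mp_over K (Suc n)" using 1 2 mp_over_mono[of _ K n "Suc n"] by auto
  then have "?P * h2 \<in> mp_over K (Suc n)" "?Q * h1 \<in> mp_over K (Suc n)"
    using 1 2 as_mpol_over[OF K, of G1] as_mpol_over[OF K, of G2] by (auto intro: mp_over_mult[OF K])
  moreover have "ev c (?Q * h1) \<noteq> 0" "x = ev c (?P * h2) / ev c (?Q * h1)"
    using 1 2 pq by (simp_all add: ev_simps P Q)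
  ultimately show ?case by blast
qed

text \<open>
  A relation with coefficients in the tower becomes, after clearing denominators, a polynomial over \<open>K\<close>
  that has to vanish identically; then so does the relation.
\<close>

lemma independent_tower:
  fixes K :: "'u::field_char_0 set"
  assumes K: "is_subfield K" and ind: "\<And>g. g \<in> mp_over K (Suc i) \<Longrightarrow> g \<noteq> 0 \<Longrightarrow> ev c g \<noteq> 0"
  shows "\<not> alg_over (tower K c i) (c i)"
proof
  assume "alg_over (tower K c i) (c i)"
  then obtain p where p: "p \<in> poly_over (tower K c i)" "p \<noteq> 0" "poly p (c i) = 0" by (auto simp: alg_over_def)
  from clear_denominators[OF K p(1) tower_fractions[OF K]] obtain h G where h: "ev c h \<noteq> 0"
    and G: "\<And>j. G j \<in> mp_over K i" "\<And>j. ev c (G j) = ev c h * coeff p j" by metis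
  let ?P = "as_mpol (degree p) i G"
  note eP = ev_as_mpol_poly[of G K i c "ev c h" p, OF G]
  have "?P = 0"
  proof (rule ccontr)
    assume "?P \<noteq> 0"
    then have "ev c ?P \<noteq> 0" by (intro ind as_mpol_over K G)
    then show False using eP[of "c i"] p(3) by simp
  qed
  then have "poly p t = 0" for t using eP[of t] h by (simp add: ev_simps)
  then show False using p(2) poly_all_0_iff_0 by blast
qed

lemma hom_image_adjoin:
  fixes \<tau> :: "'u::field \<Rightarrow> 'v::field"
  assumes K: "is_subfield K" and \<tau>: "hom_on (adjoin K a) \<tau>" and L: "is_subfield L" "\<tau> ` K \<subseteq> L" "\<tau> a \<in> L"
  shows "\<tau> ` adjoin K a \<subseteq> L"
proof
  fix z assume "z \<in> \<tau> ` adjoin K a"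
  then obtain p q where pq: "z = \<tau> (poly p a / poly q a)" "p \<in> poly_over K" "q \<in> poly_over K" "poly q a \<noteq> 0"
    unfolding adjoin_def by blast
  note F = is_subfield_adjoin[OF K, of a]
  have P: "\<tau> (poly p a) \<in> L" if p: "p \<in> poly_over K" for p
  proof -
    have pF: "p \<in> poly_over (adjoin K a)" by (rule poly_over_mono[OF _ p]) (auto intro: adjoin_base[OF K])
    have "map_poly \<tau> p \<in> poly_over L"
      using p L(2) by (auto simp: poly_over_def hom_coeff[OF F \<tau>])
    then show ?thesis unfolding hom_eval[OF F \<tau> pF adjoin_gen[OF K], symmetric]
      by (intro poly_over_eval[OF L(1)] L(3))
  qed
  show "z \<in> L" unfolding pq(1)
    using P pq adjoin_poly[OF K] by (simp add: hom_divide[OF F \<tau>] sf_divide[OF L(1)])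
qed

text \<open>
  The last clause records that the images of polynomials over the first tower lie over the second one,
  where \<open>c' n\<close> will be transcendental.
\<close>

definition tower_hom :: "'u::field set \<Rightarrow> ('u \<Rightarrow> 'u) \<Rightarrow> (nat \<Rightarrow> 'u) \<Rightarrow> (nat \<Rightarrow> 'u) \<Rightarrow> nat \<Rightarrow> ('u \<Rightarrow> 'u) \<Rightarrow> bool" where
  "tower_hom K \<sigma> c c' n \<tau> \<longleftrightarrow> hom_on (tower K c n) \<tau> \<and> (\<forall>x\<in>K. \<tau> x = \<sigma> x) \<and> (\<forall>i<n. \<tau> (c i) = c' i) \<and>
     \<tau> ` tower K c n \<subseteq> tower (\<sigma> ` K) c' n"

lemma is_subfield_image:
  fixes \<sigma> :: "'u::field \<Rightarrow> 'v::field"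
  assumes K: "is_subfield K" and \<sigma>: "hom_on K \<sigma>"
  shows "is_subfield (\<sigma> ` K)"
  unfolding is_subfield_def
proof (intro conjI ballI)
  show "1 \<in> \<sigma> ` K" using hom_one[OF \<sigma>] sf_one[OF K] by (metis imageI)
next
  fix z w assume "z \<in> \<sigma> ` K" "w \<in> \<sigma> ` K"
  then obtain x y where xy: "x \<in> K" "y \<in> K" "z = \<sigma> x" "w = \<sigma> y" by blast
  then have "z - w = \<sigma> (x - y)" "z * w = \<sigma> (x * y)" by (simp_all add: hom_diff[OF K \<sigma>] hom_mult[OF \<sigma>])
  then show "z - w \<in> \<sigma> ` K" "z * w \<in> \<sigma> ` K" using xy sf_diff[OF K] sf_mult[OF K] by auto
next
  fix z assume "z \<in> \<sigma> ` K"
  then obtain x where "x \<in> K" "z = \<sigma> x" by blast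
  then show "inverse z \<in> \<sigma> ` K" using hom_inverse[OF K \<sigma>] sf_inverse[OF K] by (metis imageI)
qed

lemma tower_hom_0: "hom_on K \<sigma> \<Longrightarrow> tower_hom K \<sigma> c c' 0 \<sigma>"
  by (simp add: tower_hom_def)

lemma tower_hom_Suc:
  assumes K: "is_subfield K" and \<sigma>: "hom_on K \<sigma>" and \<tau>: "tower_hom K \<sigma> c c' n \<tau>"
    and c: "\<not> alg_over (tower K c n) (c n)" and c': "\<not> alg_over (tower (\<sigma> ` K) c' n) (c' n)"
  shows "\<exists>\<tau>'. tower_hom K \<sigma> c c' (Suc n) \<tau>' \<and> (\<forall>x\<in>tower K c n. \<tau>' x = \<tau> x)"
proof -
  have h: "is_subfield (tower K c n)" "hom_on (tower K c n) \<tau>"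
    using \<tau> is_subfield_tower[OF K] by (auto simp: tower_hom_def)
  obtain \<tau>' where \<tau>': "hom_on (adjoin (tower K c n) (c n)) \<tau>'" "\<And>x. x \<in> tower K c n \<Longrightarrow> \<tau>' x = \<tau> x" "\<tau>' (c n) = c' n"
  proof (rule hom_extend_transcendental[OF h c, of "c' n"])
    fix p assume p: "p \<in> poly_over (tower K c n)" "p \<noteq> 0"
    have "map_poly \<tau> p \<in> poly_over (tower (\<sigma> ` K) c' n)"
      using p \<tau> by (auto simp: poly_over_def hom_coeff[OF h] tower_hom_def)
    moreover have "map_poly \<tau> p \<noteq> 0" using p by (simp add: hom_map_eq_0_iff[OF h])
    ultimately show "poly (map_poly \<tau> p) (c' n) \<noteq> 0" using c' by (auto simp: alg_over_def)
  qed (use that in blast)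
  have L: "is_subfield (tower (\<sigma> ` K) c' n)" by (intro is_subfield_tower is_subfield_image K \<sigma>)
  have "\<tau>' ` adjoin (tower K c n) (c n) \<subseteq> adjoin (tower (\<sigma> ` K) c' n) (c' n)"
  proof (rule hom_image_adjoin[OF h(1) \<tau>'(1) is_subfield_adjoin[OF L]])
    show "\<tau>' ` tower K c n \<subseteq> adjoin (tower (\<sigma> ` K) c' n) (c' n)"
      using \<tau> \<tau>'(2) adjoin_base[OF L] by (auto simp: tower_hom_def)
    show "\<tau>' (c n) \<in> adjoin (tower (\<sigma> ` K) c' n) (c' n)" using \<tau>'(3) adjoin_gen[OF L] by simp
  qed
  then have "tower_hom K \<sigma> c c' (Suc n) \<tau>'"
    using \<tau> \<tau>' tower_base[OF K, of _ c n] tower_gen[OF K, of _ n c] by (auto simp: tower_hom_def less_Suc_eq)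
  then show ?thesis using \<tau>' by blast
qed

section \<open>Realising types\<close>

definition term_fun :: "('u::field \<Rightarrow> 'u) \<Rightarrow> 'u set \<Rightarrow> ('u \<Rightarrow> 'u) \<Rightarrow> bool" where
  "term_fun d L f \<longleftrightarrow> (\<exists>t. tm_params t \<subseteq> L \<and> tm_vars t \<subseteq> {0} \<and> (\<forall>e. tm_val d e t = f (e 0)))"

lemma term_fun_const: "c \<in> L \<Longrightarrow> term_fun d L (\<lambda>x. c)"
  unfolding term_fun_def by (rule exI[of _ "Par c"]) simp

lemma term_fun_id: "term_fun d L (\<lambda>x. x)"
  unfolding term_fun_def by (rule exI[of _ "Var 0"]) simp

lemma term_fun_add: "term_fun d L f \<Longrightarrow> term_fun d L g \<Longrightarrow> term_fun d L (\<lambda>x. f x + g x)"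
  unfolding term_fun_def by (elim exE, rule_tac x = "Add t ta" in exI) auto

lemma term_fun_mult: "term_fun d L f \<Longrightarrow> term_fun d L g \<Longrightarrow> term_fun d L (\<lambda>x. f x * g x)"
  unfolding term_fun_def by (elim exE, rule_tac x = "Mul t ta" in exI) auto

lemma term_fun_der: "term_fun d L f \<Longrightarrow> term_fun d L (\<lambda>x. d (f x))"
  unfolding term_fun_def by (elim exE, rule_tac x = "Der t" in exI) auto

lemma term_fun_0: "term_fun d L (\<lambda>x. 0)"
  unfolding term_fun_def by (rule exI[of _ Zero]) simp

lemma term_fun_1: "term_fun d L (\<lambda>x. 1)"
  unfolding term_fun_def by (rule exI[of _ One]) simp

lemma term_fun_sum: "(\<And>i. i \<in> A \<Longrightarrow> term_fun d L (f i)) \<Longrightarrow> term_fun d L (\<lambda>x. \<Sum>i\<in>A. f i x)"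
  by (induction A rule: infinite_finite_induct) (simp_all add: term_fun_0 term_fun_add)

lemma term_fun_prod: "(\<And>i. i \<in> A \<Longrightarrow> term_fun d L (f i)) \<Longrightarrow> term_fun d L (\<lambda>x. \<Prod>i\<in>A. f i x)"
  by (induction A rule: infinite_finite_induct) (simp_all add: term_fun_1 term_fun_mult)

lemma term_fun_power: "term_fun d L f \<Longrightarrow> term_fun d L (\<lambda>x. f x ^ n)"
  by (induction n) (simp_all add: term_fun_1 term_fun_mult)

lemma term_fun_iter: "term_fun d L (\<lambda>x. (d ^^ n) x)"
  by (induction n) (simp_all add: term_fun_id term_fun_der)

lemma term_fun_dpol: "(\<And>m. Poly_Mapping.lookup g m \<in> L) \<Longrightarrow> term_fun d L (dpol_eval d g)"
  unfolding dpol_eval_def mpol_eval_def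
  by (intro term_fun_sum term_fun_mult term_fun_prod term_fun_power term_fun_iter term_fun_const)

definition def_pred :: "('u::field \<Rightarrow> 'u) \<Rightarrow> 'u set \<Rightarrow> ('u \<Rightarrow> bool) \<Rightarrow> bool" where
  "def_pred d L P \<longleftrightarrow> (\<exists>\<phi>\<in>unary_fms L. \<forall>x. fm_holds d \<phi> x \<longleftrightarrow> P x)"

lemma def_pred_eq_0: "term_fun d L f \<Longrightarrow> def_pred d L (\<lambda>x. f x = 0)"
  unfolding def_pred_def term_fun_def
  by (elim exE, rule_tac x = "Equ t Zero" in bexI) (auto simp: fm_holds_def unary_fms_def)

lemma def_pred_not: "def_pred d L P \<Longrightarrow> def_pred d L (\<lambda>x. \<not> P x)"
  unfolding def_pred_def
  by (elim bexE, rule_tac x = "Neg \<phi>" in bexI) (auto simp: fm_holds_def unary_fms_def)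

lemma def_pred_conj: "def_pred d L P \<Longrightarrow> def_pred d L Q \<Longrightarrow> def_pred d L (\<lambda>x. P x \<and> Q x)"
  unfolding def_pred_def
  by (elim bexE, rule_tac x = "Conj \<phi> \<phi>'" in bexI) (auto simp: fm_holds_def unary_fms_def)

lemma countable_lesspoll:
  fixes L :: "'u set"
  assumes "countable L" "uncountable (UNIV :: 'u set)"
  shows "L \<prec> (UNIV :: 'u set)"
proof -
  have "L \<lesssim> (UNIV :: 'u set)" unfolding lepoll_def by (rule exI[of _ "\<lambda>x. x"]) simp
  moreover have False if "bij_betw f L (UNIV :: 'u set)" for f
    using that assms countable_image[of L f] by (simp add: bij_betw_def)
  ultimately show ?thesis unfolding lesspoll_def eqpoll_def by blast
qed

lemma saturated_realize:
  fixes d :: "'u::field_char_0 \<Rightarrow> 'u"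
  assumes sat: "saturated d" and unc: "uncountable (UNIV :: 'u set)" and L: "countable L"
    and Ps: "\<And>P. P \<in> Ps \<Longrightarrow> def_pred d L P"
    and fin: "\<And>F. finite F \<Longrightarrow> F \<subseteq> Ps \<Longrightarrow> \<exists>x. \<forall>P\<in>F. P x"
  shows "\<exists>x. \<forall>P\<in>Ps. P x"
proof -
  define \<Sigma> where "\<Sigma> = {\<phi>\<in>unary_fms L. fm_holds d \<phi> \<in> Ps}"
  have finS: "\<exists>x. \<forall>\<phi>\<in>F. fm_holds d \<phi> x" if F: "finite F" "F \<subseteq> \<Sigma>" for F
  proof -
    have "fm_holds d ` F \<subseteq> Ps" using F(2) by (auto simp: \<Sigma>_def)
    from fin[OF finite_imageI[OF F(1)] this] show ?thesis by simp
  qed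
  have "\<Sigma> \<subseteq> unary_fms L" by (auto simp: \<Sigma>_def)
  with sat countable_lesspoll[OF L unc] finS have "\<exists>x. \<forall>\<phi>\<in>\<Sigma>. fm_holds d \<phi> x"
    unfolding saturated_def by simp
  then obtain x where x: "\<And>\<phi>. \<phi> \<in> \<Sigma> \<Longrightarrow> fm_holds d \<phi> x" by blast
  have "P x" if P: "P \<in> Ps" for P
  proof -
    from Ps[OF P] obtain \<phi> where \<phi>: "\<phi> \<in> unary_fms L" "\<And>x. fm_holds d \<phi> x \<longleftrightarrow> P x" unfolding def_pred_def by blast
    then have "fm_holds d \<phi> = P" by (intro ext) simp
    then show ?thesis using x[of \<phi>] \<phi> P by (simp add: \<Sigma>_def)
  qed
  then show ?thesis by blast
qed

lemma dpol_order_less: "g \<in> mp_over L n \<Longrightarrow> dpol_order g < int n"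
  by (auto simp: dpol_order_def mp_over_def mpol_vars_def)

lemma dpol_order_eq:
  assumes "f \<in> mp_over L (Suc n)" "n \<in> mpol_vars f"
  shows "dpol_order f = int n"
proof -
  have "finite (mpol_vars f)" by (simp add: mpol_vars_def)
  then have "Max (mpol_vars f) = n" using assms by (intro Max_eqI) (auto simp: mp_over_def)
  then show ?thesis using assms by (auto simp: dpol_order_def)
qed

lemma ev_dpol: "dpol_eval d g c = ev (\<lambda>i. (d ^^ i) c) g"
  by (simp add: dpol_eval_def)

text \<open>Blum's axiom handles finitely many inequations through their product.\<close>

lemma blum_finite:
  fixes d :: "'u::field_char_0 \<Rightarrow> 'u"
  assumes dc: "differentially_closed d" and L: "is_subfield L" and f: "int n \<le> dpol_order f"
    and N: "finite N" "\<And>g. g \<in> N \<Longrightarrow> g \<in> mp_over L n \<and> g \<noteq> 0"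
  shows "\<exists>a. dpol_eval d f a = 0 \<and> (\<forall>g\<in>N. dpol_eval d g a \<noteq> 0)"
proof -
  define G where "G = prod (\<lambda>g. g) N"
  have "G \<in> mp_over L n" unfolding G_def using N by (intro mp_over_prod[OF L]) auto
  then have "dpol_order G < dpol_order f" using dpol_order_less[of G L n] f by linarith
  moreover have "G \<noteq> 0" using N by (auto simp: G_def prod_zero_iff)
  ultimately obtain a where "dpol_eval d f a = 0" "dpol_eval d G a \<noteq> 0"
    using dc unfolding differentially_closed_def by blast
  then show ?thesis using N(1) by (auto simp: ev_dpol G_def mpol_eval_prod[OF hom_id] prod_zero_iff)
qed

lemma realize_order:
  fixes d :: "'u::field_char_0 \<Rightarrow> 'u"
  assumes dc: "differentially_closed d" and sat: "saturated d" and unc: "uncountable (UNIV :: 'u set)"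
    and L: "is_subfield L" "countable L" and f: "\<And>m. Poly_Mapping.lookup f m \<in> L" "dpol_order f = int n"
  shows "\<exists>a. dpol_eval d f a = 0 \<and> (\<forall>g\<in>mp_over L n. g \<noteq> 0 \<longrightarrow> dpol_eval d g a \<noteq> 0)"
proof -
  let ?N = "{g \<in> mp_over L n. g \<noteq> 0}"
  let ?P = "\<lambda>g a. dpol_eval d g a \<noteq> 0"
  have "\<exists>x. \<forall>P\<in>insert (\<lambda>a. dpol_eval d f a = 0) (?P ` ?N). P x"
  proof (rule saturated_realize[OF sat unc L(2)])
    fix P assume "P \<in> insert (\<lambda>a. dpol_eval d f a = 0) (?P ` ?N)"
    then show "def_pred d L P"
      using f(1) by (auto intro!: def_pred_not def_pred_eq_0 term_fun_dpol simp: mp_over_def)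
  next
    fix F assume F: "finite F" "F \<subseteq> insert (\<lambda>a. dpol_eval d f a = 0) (?P ` ?N)"
    then have "F - {\<lambda>a. dpol_eval d f a = 0} \<subseteq> ?P ` ?N" by blast
    from finite_subset_image[OF _ this] F(1) obtain N where N: "N \<subseteq> ?N" "finite N"
      "F - {\<lambda>a. dpol_eval d f a = 0} = ?P ` N" by blast
    from blum_finite[OF dc L(1) _ N(2), of n f] N(1) f(2) obtain a where
      a: "dpol_eval d f a = 0" "\<forall>g\<in>N. dpol_eval d g a \<noteq> 0" by auto
    have "P a" if PF: "P \<in> F" for P
    proof (cases "P = (\<lambda>a. dpol_eval d f a = 0)")
      case False
      then have "P \<in> ?P ` N" using N(3) PF by blast
      then show ?thesis using a(2) by auto
    qed (use a in simp)
    then show "\<exists>x. \<forall>P\<in>F. P x" by blast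
  qed
  then show ?thesis by auto
qed

lemma realize_transcendental:
  fixes d :: "'u::field_char_0 \<Rightarrow> 'u"
  assumes dc: "differentially_closed d" and sat: "saturated d" and unc: "uncountable (UNIV :: 'u set)"
    and L: "is_subfield L" "countable L"
  shows "\<exists>a. \<forall>n. \<forall>g\<in>mp_over L n. g \<noteq> 0 \<longrightarrow> dpol_eval d g a \<noteq> 0"
proof -
  let ?N = "{g. (\<exists>n. g \<in> mp_over L n) \<and> g \<noteq> 0}"
  let ?P = "\<lambda>g a. dpol_eval d g a \<noteq> 0"
  have "\<exists>x. \<forall>P\<in>?P ` ?N. P x"
  proof (rule saturated_realize[OF sat unc L(2)])
    fix P assume "P \<in> ?P ` ?N"
    then obtain g n where g: "P = ?P g" "g \<in> mp_over L n" by blast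
    have "term_fun d L (dpol_eval d g)" by (rule term_fun_dpol) (use g(2) in \<open>simp add: mp_over_def\<close>)
    then show "def_pred d L P" unfolding g(1) by (intro def_pred_not def_pred_eq_0)
  next
    fix F assume F: "finite F" "F \<subseteq> ?P ` ?N"
    from finite_subset_image[OF this] obtain N where N: "N \<subseteq> ?N" "finite N" "F = ?P ` N" by blast
    from N(2,1) have "\<exists>n. \<forall>g\<in>N. g \<in> mp_over L n"
    proof (induction N rule: finite_induct)
      case (insert g N)
      then obtain n n' where "\<forall>g\<in>N. g \<in> mp_over L n" "g \<in> mp_over L n'" by auto
      then show ?case
        by (intro exI[of _ "max n n'"]) (auto intro: mp_over_mono[of _ L n] mp_over_mono[of _ L n'])
    qed simp
    then obtain n where n: "\<And>g. g \<in> N \<Longrightarrow> g \<in> mp_over L n" by blast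
    have "mpol_vars (mX n :: (nat, 'u) mpol) = {n}" by (auto simp: mpol_vars_def)
    then have o: "int n \<le> dpol_order (mX n :: 'u dpol)" by (simp add: dpol_order_def)
    have Nn: "g \<in> mp_over L n \<and> g \<noteq> 0" if "g \<in> N" for g using n[OF that] N(1) that by blast
    from blum_finite[OF dc L(1) o N(2) Nn] obtain a where a: "\<forall>g\<in>N. dpol_eval d g a \<noteq> 0" by blast
    have "\<forall>P\<in>F. P a" unfolding N(3) using a by simp
    then show "\<exists>x. \<forall>P\<in>F. P x" ..
  qed
  then obtain a where a: "\<forall>P\<in>?P ` ?N. P a" ..
  have "dpol_eval d g a \<noteq> 0" if "g \<in> mp_over L n" "g \<noteq> 0" for n g
    using bspec[OF a imageI[of g ?N ?P]] that by auto
  then show ?thesis by blast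
qed

section \<open>Back and forth between countable differential fields\<close>

lemma countable_adjoin:
  assumes "countable K"
  shows "countable (adjoin K a)"
proof -
  have "poly_over K \<subseteq> Poly ` lists K"
  proof
    fix p assume p: "p \<in> poly_over K"
    have "set (coeffs p) \<subseteq> K" using p by (auto simp: coeffs_def poly_over_def)
    then show "p \<in> Poly ` lists K" by (intro image_eqI[of _ _ "coeffs p"]) auto
  qed
  then have "countable (poly_over K)"
    using assms by (meson countable_image countable_lists countable_subset)
  then have "countable ((\<lambda>(p, q). poly p a / poly q a) ` (poly_over K \<times> poly_over K))" by blast
  then show ?thesis by (rule countable_subset[rotated]) (auto simp: adjoin_def)
qed

lemma countable_tower: "countable K \<Longrightarrow> countable (tower K c n)"
  by (induction n) (simp_all add: countable_adjoin)

definition diff_iso :: "('u::field \<Rightarrow> 'u) \<Rightarrow> 'u set \<Rightarrow> ('u \<Rightarrow> 'u) \<Rightarrow> bool" where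
  "diff_iso d K \<sigma> \<longleftrightarrow> is_subfield K \<and> countable K \<and> (\<forall>x\<in>K. d x \<in> K) \<and> hom_on K \<sigma> \<and> (\<forall>x\<in>K. \<sigma> (d x) = d (\<sigma> x))"

text \<open>
  The difference of \<open>\<tau> d\<close> and \<open>d \<tau>\<close> is a derivation along \<open>\<tau>\<close>, so it suffices to look at the generators
  that are not algebraic.
\<close>

lemma tower_commutes:
  fixes d :: "'u::field_char_0 \<Rightarrow> 'u"
  assumes d: "derivation d" and K: "is_subfield K" and F: "is_subfield F" "hom_on F \<tau>" "\<And>z. z \<in> F \<Longrightarrow> d z \<in> F"
    and base: "\<And>z. z \<in> K \<Longrightarrow> \<tau> (d z) = d (\<tau> z)"
    and gen: "\<And>i. i < N \<Longrightarrow> alg_over (tower K x i) (x i) \<or> \<tau> (d (x i)) = d (\<tau> (x i))"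
  shows "n \<le> N \<Longrightarrow> tower K x n \<subseteq> F \<Longrightarrow> z \<in> tower K x n \<Longrightarrow> \<tau> (d z) = d (\<tau> z)"
proof (induction n arbitrary: z)
  case (Suc n)
  let ?T = "tower K x n" and ?A = "adjoin (tower K x n) (x n)"
  have T: "is_subfield ?T" by (rule is_subfield_tower[OF K])
  have TA: "?T \<subseteq> ?A" by (auto intro: adjoin_base[OF T])
  have AF: "?A \<subseteq> F" using Suc.prems by simp
  define \<Delta> where "\<Delta> z = \<tau> (d z) - d (\<tau> z)" for z
  have "deriv_along F \<tau> \<Delta>"
    unfolding deriv_along_def \<Delta>_def using F(3)
    by (simp add: derivation_add[OF d] derivation_mult[OF d] hom_add[OF F(2)] hom_mult[OF F(2)] sf_mult[OF F(1)] algebra_simps)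
  then have "deriv_along ?A \<tau> \<Delta>" using AF by (auto simp: deriv_along_def)
  then have "\<Delta> z = 0"
  proof (rule deriv_along_zero[OF T hom_on_subset[OF F(2) AF]])
    show "\<Delta> z = 0" if "z \<in> ?T" for z
      using Suc.IH[of z] that Suc.prems TA AF by (auto simp: \<Delta>_def)
    show "alg_over ?T (x n) \<or> \<Delta> (x n) = 0" using gen[of n] Suc.prems by (auto simp: \<Delta>_def)
    show "z \<in> ?A" using Suc.prems by simp
  qed
  then show ?case by (simp add: \<Delta>_def)
qed (use base in simp)

lemma tower_homs_exist:
  assumes K: "is_subfield K" and \<sigma>: "hom_on K \<sigma>"
    and c: "\<And>i. i < n \<Longrightarrow> \<not> alg_over (tower K c i) (c i)"
    and c': "\<And>i. i < n \<Longrightarrow> \<not> alg_over (tower (\<sigma> ` K) c' i) (c' i)"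
  shows "\<exists>\<tau>. tower_hom K \<sigma> c c' n \<tau>"
  using c c'
proof (induction n)
  case 0
  then show ?case using tower_hom_0[OF \<sigma>] by blast
next
  case (Suc n)
  then obtain \<tau> where "tower_hom K \<sigma> c c' n \<tau>" by auto
  from tower_hom_Suc[OF K \<sigma> this] Suc.prems show ?case by blast
qed

lemma derivation_tower:
  assumes d: "derivation d" and K: "is_subfield K" "\<And>x. x \<in> K \<Longrightarrow> d x \<in> K"
  shows "z \<in> tower K (\<lambda>i. (d ^^ i) c) n \<Longrightarrow> d z \<in> tower K (\<lambda>i. (d ^^ i) c) (Suc n)"
proof (induction n arbitrary: z)
  case 0
  then show ?case using K by (simp add: adjoin_base)
next
  case (Suc n)
  let ?x = "\<lambda>i. (d ^^ i) c"
  let ?T = "tower K ?x n" and ?U = "tower K ?x (Suc (Suc n))"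
  show ?case
  proof (rule derivation_adjoin[OF d, of ?U ?T])
    show "is_subfield ?U" by (rule is_subfield_tower[OF K(1)])
    show "?T \<subseteq> ?U" by (rule tower_mono[OF K(1)]) simp
    show "d w \<in> ?U" if "w \<in> ?T" for w      by (rule subsetD[OF tower_mono[OF K(1) le_SucI[OF order_refl]] Suc.IH[OF that]])
    show "?x n \<in> ?U" by (rule tower_gen[OF K(1)]) simp
    show "d (?x n) \<in> ?U" using tower_gen[OF K(1), of "Suc n" "Suc (Suc n)" ?x] by simp
    show "z \<in> adjoin ?T (?x n)" using Suc.prems by simp
  qed
qed

text \<open>
  If \<open>n\<close> is least such that the \<open>n\<close>-th derivative of \<open>c\<close> is algebraic over the lower ones, the
  image of \<open>c\<close> must satisfy the image of that equation and no equation of lower order.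
\<close>

lemma diff_iso_extend:
  fixes d :: "'u::field_char_0 \<Rightarrow> 'u"
  assumes dc: "differentially_closed d" and sat: "saturated d" and unc: "uncountable (UNIV :: 'u set)"
    and iso: "diff_iso d K \<sigma>"
  shows "\<exists>K' \<sigma>'. diff_iso d K' \<sigma>' \<and> K \<subseteq> K' \<and> c \<in> K' \<and> (\<forall>x\<in>K. \<sigma>' x = \<sigma> x)"
proof -
  have d: "derivation d" using dc by (simp add: differentially_closed_def)
  from iso have K: "is_subfield K" "countable K" and dK: "\<And>x. x \<in> K \<Longrightarrow> d x \<in> K" and \<sigma>: "hom_on K \<sigma>"
    and comm: "\<And>x. x \<in> K \<Longrightarrow> \<sigma> (d x) = d (\<sigma> x)" by (auto simp: diff_iso_def)
  define x where "x = (\<lambda>i. (d ^^ i) c)"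
  let ?T = "tower K x" and ?L = "\<sigma> ` K"
  have L: "is_subfield ?L" "countable ?L" using is_subfield_image[OF K(1) \<sigma>] K(2) by auto
  have T: "is_subfield (?T n)" for n by (rule is_subfield_tower[OF K(1)])
  have dT: "d z \<in> ?T (Suc n)" if "z \<in> ?T n" for z n
    using derivation_tower[OF d K(1) dK, of z c n] that unfolding x_def by blast
  have x0: "x 0 = c" and xS: "d (x i) = x (Suc i)" for i by (simp_all add: x_def)
  have cT: "c \<in> ?T (Suc n)" for n using tower_gen[OF K(1), of 0 "Suc n" x] by (simp add: x0)
  show ?thesis
  proof (cases "\<exists>n. alg_over (?T n) (x n)")
    case True
    define n where "n = (LEAST n. alg_over (?T n) (x n))"
    have alg: "alg_over (?T n) (x n)" unfolding n_def by (rule LeastI_ex[OF True])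
    have trans: "\<not> alg_over (?T i) (x i)" if "i < n" for i using not_less_Least that unfolding n_def by blast
    obtain m where m: "is_minpoly (?T n) (x n) m" using minpoly_exists[OF T alg] by blast
    then have mT: "m \<in> poly_over (?T n)" and m0: "poly m (x n) = 0" and lm: "lead_coeff m = 1"
      by (auto simp: is_minpoly_def)
    obtain h G where h: "h \<in> mp_over K n" "ev x h \<noteq> 0" and G: "\<And>j. G j \<in> mp_over K n"
      "\<And>j. ev x (G j) = ev x h * coeff m j"
      using clear_denominators[OF K(1) mT tower_fractions[OF K(1)]] by metis
    define P where "P = as_mpol (degree m) n G"
    have PK: "P \<in> mp_over K (Suc n)" unfolding P_def by (rule as_mpol_over[OF K(1) G(1)])
    have eP: "ev (x(n := t)) P = ev x h * poly m t" for t
      unfolding P_def by (rule ev_as_mpol_poly[OF G])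
    have nP: "n \<in> mpol_vars P"
    proof (rule ccontr)
      assume "n \<notin> mpol_vars P"
      then have "ev (x(n := t)) P = ev x P" for t by (intro mpol_eval_cong) auto
      then have "ev x h * poly m t = ev x h * poly m (x n)" for t using eP[of t] eP[of "x n"] by simp
      then have "poly m t = 0" for t using h m0 by simp
      then have "m = 0" using poly_all_0_iff_0 by blast
      then show False using lm by simp
    qed
    let ?f = "mp_map \<sigma> P"
    have f: "?f \<in> mp_over ?L (Suc n)" by (rule mp_map_over[OF K(1) \<sigma> PK])
    have "dpol_order ?f = int n"
      by (rule dpol_order_eq[OF f]) (simp add: mp_map_vars[OF K(1) \<sigma> PK] nP)
    then obtain a where a: "dpol_eval d ?f a = 0" "\<And>g. g \<in> mp_over ?L n \<Longrightarrow> g \<noteq> 0 \<Longrightarrow> dpol_eval d g a \<noteq> 0"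
      using realize_order[OF dc sat unc L, of ?f n] f by (auto simp: mp_over_def)
    define x' where "x' = (\<lambda>i. (d ^^ i) a)"
    have xS': "d (x' i) = x' (Suc i)" for i by (simp add: x'_def)
    have fa: "ev x' ?f = 0" and ga: "\<And>g. g \<in> mp_over ?L n \<Longrightarrow> g \<noteq> 0 \<Longrightarrow> ev x' g \<noteq> 0"
      using a by (simp_all add: ev_dpol x'_def)
    have trans': "\<not> alg_over (tower ?L x' i) (x' i)" if "i < n" for i
      by (rule independent_tower[OF L(1)]) (use ga mp_over_mono[of _ ?L "Suc i" n] that in auto)
    obtain \<tau> where \<tau>: "tower_hom K \<sigma> x x' n \<tau>" using tower_homs_exist[OF K(1) \<sigma> trans trans'] by blast
    then have \<tau>h: "hom_on (?T n) \<tau>" "\<And>z. z \<in> K \<Longrightarrow> \<tau> z = \<sigma> z" "\<And>i. i < n \<Longrightarrow> \<tau> (x i) = x' i"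
      by (auto simp: tower_hom_def)
    have ev\<tau>: "ev x' (mp_map \<sigma> g) = \<tau> (ev x g)" "ev x g \<in> ?T n" if "g \<in> mp_over K n" for g
      using mp_map_eval[OF K(1) \<sigma> that T \<tau>h(1), of x x'] tower_base[OF K(1)] tower_gen[OF K(1)] \<tau>h by auto
    have "ev x' ?f = (\<Sum>j\<le>degree m. ev x' (mp_map \<sigma> (G j)) * x' n ^ j)"
      unfolding P_def as_mpol_def
      by (subst mp_map_sum[OF K(1) \<sigma>, of _ _ "Suc n"])
        (auto simp: mp_map_mult_mX[OF K(1) \<sigma> G(1)] mpol_eval_sum[OF hom_id] ev_simps
          intro!: mp_over_mult[OF K(1)] mp_over_power[OF K(1)] mp_over_mX[OF K(1)] mp_over_mono[OF G(1)])
    also have "\<dots> = (\<Sum>j\<le>degree m. \<tau> (ev x h) * (\<tau> (coeff m j) * x' n ^ j))"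
      by (intro sum.cong refl)
        (simp add: ev\<tau>(1)[OF G(1)] G(2) hom_mult[OF \<tau>h(1) ev\<tau>(2)[OF h(1)] poly_overD[OF mT]] mult.assoc)
    also have "\<dots> = \<tau> (ev x h) * poly (map_poly \<tau> m) (x' n)"
      by (simp add: poly_altdef hom_degree[OF T \<tau>h(1) mT] hom_coeff[OF T \<tau>h(1)] sum_distrib_left)
    finally have "\<tau> (ev x h) * poly (map_poly \<tau> m) (x' n) = 0" using fa by simp
    moreover have "\<tau> (ev x h) \<noteq> 0" using hom_eq_0_iff[OF T \<tau>h(1) ev\<tau>(2)[OF h(1)]] h(2) by simp
    ultimately have "poly (map_poly \<tau> m) (x' n) = 0" by simp
    from hom_extend_algebraic[OF T \<tau>h(1) m this] obtain \<sigma>' where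
      \<sigma>': "hom_on (?T (Suc n)) \<sigma>'" "\<And>z. z \<in> ?T n \<Longrightarrow> \<sigma>' z = \<tau> z" "\<sigma>' (x n) = x' n" by auto
    have \<sigma>'K: "\<sigma>' z = \<sigma> z" if "z \<in> K" for z using \<sigma>'(2) \<tau>h(2) tower_base[OF K(1) that] that by simp
    have \<sigma>'x: "\<sigma>' (x i) = x' i" if "i \<le> n" for i
      using \<sigma>'(2,3) \<tau>h(3)[of i] tower_gen[OF K(1), of i n x] that by (cases "i = n") auto
    have dS: "d z \<in> ?T (Suc n)" if "z \<in> ?T (Suc n)" for z
    proof -
      have "d w \<in> adjoin (?T n) (x n)" if "w \<in> ?T n" for w using dT[OF that] by simp
      from derivation_algebraic[OF d T alg this] that show ?thesis by simp
    qed
    have KT: "K \<subseteq> ?T (Suc n)" using tower_base[OF K(1)] by blast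
    have "\<sigma>' (d z) = d (\<sigma>' z)" if "z \<in> ?T (Suc n)" for z
    proof (rule tower_commutes[OF d K(1) T \<sigma>'(1) dS, of "Suc n" x "Suc n"])
      show "\<sigma>' (d z) = d (\<sigma>' z)" if "z \<in> K" for z using that \<sigma>'K dK comm by simp
      show "alg_over (?T i) (x i) \<or> \<sigma>' (d (x i)) = d (\<sigma>' (x i))" if "i < Suc n" for i
        using alg \<sigma>'x[of i] \<sigma>'x[of "Suc i"] that by (cases "i = n") (auto simp: xS xS')
    qed (use that in auto)
    then have "diff_iso d (?T (Suc n)) \<sigma>'"
      unfolding diff_iso_def using T dS \<sigma>'(1) countable_tower[OF K(2)] by blast
    then show ?thesis using KT cT \<sigma>'K by blast
  next
    case False
    then have trans: "\<not> alg_over (?T i) (x i)" for i by blast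
    obtain a where a: "\<And>n g. g \<in> mp_over ?L n \<Longrightarrow> g \<noteq> 0 \<Longrightarrow> dpol_eval d g a \<noteq> 0"
      using realize_transcendental[OF dc sat unc L] by blast
    define x' where "x' = (\<lambda>i. (d ^^ i) a)"
    have xS': "d (x' i) = x' (Suc i)" for i by (simp add: x'_def)
    have trans': "\<not> alg_over (tower ?L x' i) (x' i)" for i
      by (rule independent_tower[OF L(1)]) (use a in \<open>simp add: ev_dpol x'_def\<close>)
    have "\<exists>s. \<forall>n. tower_hom K \<sigma> x x' n (s n) \<and> (\<forall>z\<in>?T n. s (Suc n) z = s n z)"
    proof (rule dependent_nat_choice)
      show "\<exists>\<tau>. tower_hom K \<sigma> x x' 0 \<tau>" using tower_hom_0[OF \<sigma>] by blast
      show "\<exists>\<tau>'. tower_hom K \<sigma> x x' (Suc n) \<tau>' \<and> (\<forall>z\<in>?T n. \<tau>' z = \<tau> z)" if "tower_hom K \<sigma> x x' n \<tau>" for \<tau> n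
        by (rule tower_hom_Suc[OF K(1) \<sigma> that trans trans'])
    qed
    then obtain s where s: "\<And>n. tower_hom K \<sigma> x x' n (s n)" "\<And>n z. z \<in> ?T n \<Longrightarrow> s (Suc n) z = s n z" by blast
    have mono: "s (k + n) z = s n z" if "z \<in> ?T n" for k n z
    proof (induction k)
      case (Suc k)
      have "z \<in> ?T (k + n)" using that tower_mono[OF K(1), of n "k + n" x] by auto
      then show ?case using s(2) Suc by simp
    qed simp
    define \<sigma>' where "\<sigma>' z = s (LEAST n. z \<in> ?T n) z" for z
    have \<sigma>': "\<sigma>' z = s n z" if "z \<in> ?T n" for z n
    proof -
      have "(LEAST n. z \<in> ?T n) \<le> n" by (rule Least_le[of "\<lambda>n. z \<in> ?T n", OF that])
      then obtain k where "n = k + (LEAST n. z \<in> ?T n)" by (metis le_add_diff_inverse2)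
      moreover have "z \<in> ?T (LEAST n. z \<in> ?T n)" by (rule LeastI[of "\<lambda>n. z \<in> ?T n", OF that])
      ultimately show ?thesis using mono[of z "LEAST n. z \<in> ?T n" k] by (simp add: \<sigma>'_def)
    qed
    define F where "F = (\<Union>n. ?T n)"
    have two: "\<exists>n. z \<in> ?T n \<and> w \<in> ?T n" if zw: "z \<in> F" "w \<in> F" for z w
    proof -
      from zw obtain i j where "z \<in> ?T i" "w \<in> ?T j" by (auto simp: F_def)
      then have "z \<in> ?T (max i j)" "w \<in> ?T (max i j)"
        using tower_mono[OF K(1), of i "max i j" x] tower_mono[OF K(1), of j "max i j" x] by auto
      then show ?thesis by blast
    qed
    have F: "is_subfield F"
      unfolding is_subfield_def
    proof (intro conjI ballI)
      show "1 \<in> F" using sf_one[OF T] by (auto simp: F_def)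
    next
      fix z w assume "z \<in> F" "w \<in> F"
      from two[OF this] obtain n where "z \<in> ?T n" "w \<in> ?T n" by blast
      then have "z - w \<in> ?T n" "z * w \<in> ?T n" by (simp_all add: sf_diff[OF T] sf_mult[OF T])
      then show "z - w \<in> F" "z * w \<in> F" unfolding F_def by blast+
    next
      fix z assume "z \<in> F" then show "inverse z \<in> F" using sf_inverse[OF T] by (auto simp: F_def)
    qed
    have hF: "hom_on F \<sigma>'"
      unfolding hom_on_def
    proof (intro conjI ballI)
      show "\<sigma>' 1 = 1" using \<sigma>'[OF sf_one[OF T[of 0]]] s(1)[of 0] by (simp add: tower_hom_def hom_on_def)
    next
      fix z w assume "z \<in> F" "w \<in> F"
      from two[OF this] obtain n where n: "z \<in> ?T n" "w \<in> ?T n" by blast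
      have h: "hom_on (?T n) (s n)" using s(1) by (simp add: tower_hom_def)
      show "\<sigma>' (z + w) = \<sigma>' z + \<sigma>' w" "\<sigma>' (z * w) = \<sigma>' z * \<sigma>' w"
        using n by (simp_all add: \<sigma>'[of _ n] sf_add[OF T] sf_mult[OF T] hom_add[OF h] hom_mult[OF h])
    qed
    have dF: "d z \<in> F" if "z \<in> F" for z using that dT unfolding F_def by blast
    have \<sigma>'K: "\<sigma>' z = \<sigma> z" if "z \<in> K" for z using \<sigma>'[of z 0] that s(1)[of 0] by (simp add: tower_hom_def)
    have \<sigma>'x: "\<sigma>' (x i) = x' i" for i
      using \<sigma>'[of "x i" "Suc i"] tower_gen[OF K(1), of i "Suc i" x] s(1)[of "Suc i"] by (simp add: tower_hom_def del: tower.simps)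
    have comm': "\<sigma>' (d z) = d (\<sigma>' z)" if "z \<in> F" for z
    proof -
      from that obtain n where n: "z \<in> ?T n" by (auto simp: F_def)
      show ?thesis
      proof (rule tower_commutes[OF d K(1) F hF dF, of n x n])
        show "\<sigma>' (d z) = d (\<sigma>' z)" if "z \<in> K" for z using that \<sigma>'K dK comm by simp
      qed (use n in \<open>auto simp: F_def \<sigma>'x xS xS'\<close>)
    qed
    have "countable F" unfolding F_def using countable_tower[OF K(2)] by blast
    then have "diff_iso d F \<sigma>'" unfolding diff_iso_def using F dF hF comm' by blast
    moreover have "K \<subseteq> F" unfolding F_def using tower_base[OF K(1)] by blast
    moreover have "c \<in> F" unfolding F_def using cT by blast
    ultimately show ?thesis using \<sigma>'K by blast
  qed
qed

lemma diff_iso_inverse: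
  assumes "diff_iso d K \<sigma>"
  shows "diff_iso d (\<sigma> ` K) (inv_into K \<sigma>)"
proof -
  from assms have K: "is_subfield K" "countable K" and dK: "\<And>x. x \<in> K \<Longrightarrow> d x \<in> K" and \<sigma>: "hom_on K \<sigma>"
    and comm: "\<And>x. x \<in> K \<Longrightarrow> \<sigma> (d x) = d (\<sigma> x)" by (auto simp: diff_iso_def)
  have inv: "inv_into K \<sigma> (\<sigma> x) = x" if "x \<in> K" for x by (rule inv_into_f_f[OF hom_inj[OF K(1) \<sigma>] that])
  show ?thesis unfolding diff_iso_def hom_on_def
  proof (intro conjI ballI)
    show "inv_into K \<sigma> 1 = 1" using inv[OF sf_one[OF K(1)]] hom_one[OF \<sigma>] by simp
  next
    fix z assume "z \<in> \<sigma> ` K"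
    then obtain x where "x \<in> K" "z = \<sigma> x" by blast
    then show "d z \<in> \<sigma> ` K" "inv_into K \<sigma> (d z) = d (inv_into K \<sigma> z)"
      using comm dK inv by (auto simp flip: comm)
  next
    fix z w assume "z \<in> \<sigma> ` K" "w \<in> \<sigma> ` K"
    then obtain x y where xy: "x \<in> K" "y \<in> K" "z = \<sigma> x" "w = \<sigma> y" by blast
    have "z + w = \<sigma> (x + y)" "z * w = \<sigma> (x * y)" using xy by (simp_all add: hom_add[OF \<sigma>] hom_mult[OF \<sigma>])
    then show "inv_into K \<sigma> (z + w) = inv_into K \<sigma> z + inv_into K \<sigma> w"
      "inv_into K \<sigma> (z * w) = inv_into K \<sigma> z * inv_into K \<sigma> w"
      using xy by (simp_all add: inv sf_add[OF K(1)] sf_mult[OF K(1)])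
  qed (use is_subfield_image[OF K(1) \<sigma>] K(2) in auto)
qed

lemma diff_iso_extend_back:
  fixes d :: "'u::field_char_0 \<Rightarrow> 'u"
  assumes dc: "differentially_closed d" and sat: "saturated d" and unc: "uncountable (UNIV :: 'u set)"
    and iso: "diff_iso d K \<sigma>"
  shows "\<exists>K' \<sigma>' c. diff_iso d K' \<sigma>' \<and> K \<subseteq> K' \<and> c \<in> K' \<and> \<sigma>' c = z \<and> (\<forall>x\<in>K. \<sigma>' x = \<sigma> x)"
proof -
  from iso have K: "is_subfield K" "hom_on K \<sigma>" by (auto simp: diff_iso_def)
  from diff_iso_extend[OF dc sat unc diff_iso_inverse[OF iso], of z] obtain L \<rho> where
    \<rho>: "diff_iso d L \<rho>" "\<sigma> ` K \<subseteq> L" "z \<in> L" "\<And>w. w \<in> \<sigma> ` K \<Longrightarrow> \<rho> w = inv_into K \<sigma> w" by blast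
  then have L: "is_subfield L" "hom_on L \<rho>" by (auto simp: diff_iso_def)
  have \<rho>\<sigma>: "\<rho> (\<sigma> x) = x" if "x \<in> K" for x
    using \<rho>(4)[of "\<sigma> x"] inv_into_f_f[OF hom_inj[OF K] that] that by auto
  have inv: "inv_into L \<rho> (\<rho> w) = w" if "w \<in> L" for w by (rule inv_into_f_f[OF hom_inj[OF L] that])
  have "x \<in> \<rho> ` L" if "x \<in> K" for x using \<rho>\<sigma>[OF that] \<rho>(2) that by (metis imageI image_subset_iff)
  moreover have "inv_into L \<rho> x = \<sigma> x" if "x \<in> K" for x
    using inv[of "\<sigma> x"] \<rho>\<sigma>[OF that] \<rho>(2) that by auto
  ultimately show ?thesis
    using diff_iso_inverse[OF \<rho>(1)] inv[OF \<rho>(3)] \<rho>(3)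
    by (intro exI[of _ "\<rho> ` L"] exI[of _ "inv_into L \<rho>"] exI[of _ "\<rho> z"]) auto
qed

lemma tm_val_iso:
  assumes "diff_iso d K \<sigma>" "\<And>n. e n \<in> K" 
  shows "tm_params t \<subseteq> K \<Longrightarrow> tm_val d e t \<in> K \<and> tm_val d (\<lambda>n. \<sigma> (e n)) (map_tm \<sigma> t) = \<sigma> (tm_val d e t)"
proof -
  from assms have K: "is_subfield K" "hom_on K \<sigma>" "\<And>x. x \<in> K \<Longrightarrow> d x \<in> K" "\<And>x. x \<in> K \<Longrightarrow> \<sigma> (d x) = d (\<sigma> x)"
    by (auto simp: diff_iso_def)
  show "tm_params t \<subseteq> K \<Longrightarrow> ?thesis"
    by (induction t) (auto simp: assms(2) hom_zero[OF K(1,2)] hom_one[OF K(2)] hom_add[OF K(2)] hom_mult[OF K(2)] K(4)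
      intro: sf_zero[OF K(1)] sf_one[OF K(1)] sf_add[OF K(1)] sf_mult[OF K(1)] K(3))
qed

text \<open>
  Only the quantifier step has content: a witness on either side is moved to the other one by
  extending the isomorphism.
\<close>

theorem fm_sat_iso:
  fixes d :: "'u::field_char_0 \<Rightarrow> 'u"
  assumes dc: "differentially_closed d" and sat: "saturated d" and unc: "uncountable (UNIV :: 'u set)"
  shows "diff_iso d K \<sigma> \<Longrightarrow> (\<And>n. e n \<in> K) \<Longrightarrow> fm_params \<phi> \<subseteq> K \<Longrightarrow>
    fm_sat d e \<phi> \<longleftrightarrow> fm_sat d (\<lambda>n. \<sigma> (e n)) (map_fm \<sigma> \<phi>)"
proof (induction \<phi> arbitrary: K \<sigma> e)
  case (Equ s t)
  then have "inj_on \<sigma> K" by (auto simp: diff_iso_def intro: hom_inj)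
  then show ?case
    using tm_val_iso[OF Equ(1,2), of s] tm_val_iso[OF Equ(1,2), of t] Equ(3) by (auto dest: inj_onD)
next
  case (Neg \<phi>)
  then show ?case by simp
next
  case (Conj \<phi> \<psi>)
  then show ?case by simp
next
  case (Exi n \<phi>)
  have step: "fm_sat d (e(n := c)) \<phi> \<longleftrightarrow> fm_sat d ((\<lambda>i. \<sigma> (e i))(n := \<sigma>' c)) (map_fm \<sigma> \<phi>)"
    if iso: "diff_iso d K' \<sigma>'" "K \<subseteq> K'" "c \<in> K'" "\<And>x. x \<in> K \<Longrightarrow> \<sigma>' x = \<sigma> x" for K' \<sigma>' c
  proof -
    have "fm_sat d (e(n := c)) \<phi> \<longleftrightarrow> fm_sat d (\<lambda>i. \<sigma>' ((e(n := c)) i)) (map_fm \<sigma>' \<phi>)"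
      by (rule Exi.IH[OF iso(1)]) (use iso Exi.prems in auto)
    also have "(\<lambda>i. \<sigma>' ((e(n := c)) i)) = (\<lambda>i. \<sigma> (e i))(n := \<sigma>' c)"
      using iso(4) Exi.prems(2) by auto
    also have "map_fm \<sigma>' \<phi> = map_fm \<sigma> \<phi>"
      by (rule fm.map_cong[OF refl]) (use iso(4) Exi.prems(3) in auto)
    finally show ?thesis .
  qed
  show ?case
  proof
    assume "fm_sat d e (Exi n \<phi>)"
    then obtain c where "fm_sat d (e(n := c)) \<phi>" by auto
    moreover from diff_iso_extend[OF dc sat unc Exi.prems(1), of c] obtain K' \<sigma>' where
      "diff_iso d K' \<sigma>'" "K \<subseteq> K'" "c \<in> K'" "\<And>x. x \<in> K \<Longrightarrow> \<sigma>' x = \<sigma> x" by blast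
    ultimately show "fm_sat d (\<lambda>n. \<sigma> (e n)) (map_fm \<sigma> (Exi n \<phi>))" using step by auto
  next
    assume "fm_sat d (\<lambda>n. \<sigma> (e n)) (map_fm \<sigma> (Exi n \<phi>))"
    then obtain z where "fm_sat d ((\<lambda>i. \<sigma> (e i))(n := z)) (map_fm \<sigma> \<phi>)" by auto
    moreover from diff_iso_extend_back[OF dc sat unc Exi.prems(1), of z] obtain K' \<sigma>' c where
      iso: "diff_iso d K' \<sigma>'" "K \<subseteq> K'" "c \<in> K'" "\<And>x. x \<in> K \<Longrightarrow> \<sigma>' x = \<sigma> x" "\<sigma>' c = z" by blast
    ultimately have "fm_sat d (e(n := c)) \<phi>" using step[OF iso(1-4)] by simp
    then show "fm_sat d e (Exi n \<phi>)" by auto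
  qed
qed

section \<open>Countable differential subfields\<close>

primrec dgen :: "('u::field \<Rightarrow> 'u) \<Rightarrow> 'u set \<Rightarrow> nat \<Rightarrow> 'u set" where
  "dgen d B 0 = insert 1 B"
| "dgen d B (Suc n) = dgen d B n \<union> (\<lambda>(x, y). x - y) ` (dgen d B n \<times> dgen d B n) \<union>
     (\<lambda>(x, y). x * y) ` (dgen d B n \<times> dgen d B n) \<union> inverse ` dgen d B n \<union> d ` dgen d B n"

lemma countable_differential_subfield:
  assumes "countable B"
  obtains K where "is_subfield K" "countable K" "B \<subseteq> K" "\<And>x. x \<in> K \<Longrightarrow> d x \<in> K"
proof -
  let ?S = "dgen d B"
  define K where "K = (\<Union>n. ?S n)"
  have mono: "?S n \<subseteq> ?S (k + n)" for k n by (induction k) auto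
  have two: "\<exists>n. x \<in> ?S n \<and> y \<in> ?S n" if "x \<in> K" "y \<in> K" for x y
  proof -
    from that obtain i j where "x \<in> ?S i" "y \<in> ?S j" by (auto simp: K_def)
    then have "x \<in> ?S (j + i) \<and> y \<in> ?S (j + i)" using mono[of i j] mono[of j i] by (auto simp: add.commute)
    then show ?thesis by blast
  qed
  have up: "x \<in> K" if "x \<in> ?S (Suc n)" for x n using that by (auto simp only: K_def)
  have "is_subfield K"
    unfolding is_subfield_def
  proof (intro conjI ballI)
    have "1 \<in> ?S 0" by simp
    then show "1 \<in> K" by (auto simp only: K_def)
  next
    fix x y assume "x \<in> K" "y \<in> K"
    from two[OF this] obtain n where n: "x \<in> ?S n" "y \<in> ?S n" by blast
    then have "(x, y) \<in> ?S n \<times> ?S n" by simp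
    from imageI[OF this, of "\<lambda>(x, y). x - y"] imageI[OF this, of "\<lambda>(x, y). x * y"]
    have "x - y \<in> ?S (Suc n)" "x * y \<in> ?S (Suc n)" by simp_all
    then show "x - y \<in> K" "x * y \<in> K" using up by blast+
  next
    fix x assume "x \<in> K"
    then obtain n where "x \<in> ?S n" by (auto simp: K_def)
    then have "inverse x \<in> ?S (Suc n)" by simp
    then show "inverse x \<in> K" by (rule up)
  qed
  moreover have "d x \<in> K" if xK: "x \<in> K" for x
  proof -
    from xK obtain n where "x \<in> ?S n" by (auto simp: K_def)
    then have "d x \<in> ?S (Suc n)" by simp
    then show ?thesis by (rule up)
  qed
  moreover have "countable (?S n)" for n by (induction n) (use assms in auto)
  then have "countable K" unfolding K_def by blast
  moreover have "B \<subseteq> ?S 0" by auto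
  then have "B \<subseteq> K" by (auto simp only: K_def)
  ultimately show ?thesis using that by blast
qed

section \<open>The Schwarzian equation as a differential polynomial\<close>

lemma schwarzian_solutions_iff:
  fixes d :: "'u::field_char_0 \<Rightarrow> 'u"
  assumes d: "derivation d"
  shows "y \<in> schwarzian_solutions d \<alpha> \<beta> \<gamma> \<longleftrightarrow> d y \<noteq> 0 \<and>
    d y * d (d (d y)) = 3/2 * (d (d y) * d (d y)) -
      (d y * d y) * (d y * d y) * fuchs_R ((inverse \<alpha>)\<^sup>2) ((inverse \<beta>)\<^sup>2) ((inverse \<gamma>)\<^sup>2) y"
proof (cases "d y = 0")
  case False
  define u v w r where "u = d y" and "v = d u" and "w = d v"
    and "r = fuchs_R ((inverse \<alpha>)\<^sup>2) ((inverse \<beta>)\<^sup>2) ((inverse \<gamma>)\<^sup>2) y"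
  have u: "u \<noteq> 0" using False by (simp add: u_def)
  have r: "triangle_R \<alpha> \<beta> \<gamma> y = r"
    by (simp add: triangle_R_def r_def fuchs_R_def power_int_minus power_inverse)
  have "schwarzian d y + (d y)\<^sup>2 * triangle_R \<alpha> \<beta> \<gamma> y = (w - (v / u) * v) / u - 1/2 * (v / u)\<^sup>2 + u\<^sup>2 * r"
    unfolding r schwarzian_def u_def[symmetric] v_def[symmetric] derivation_divide[OF d u] w_def[symmetric] ..
  also have "\<dots> = (u * w - 3/2 * (v * v) + (u * u) * (u * u) * r) / (u * u)"
    using u by (simp add: field_simps power2_eq_square)
  finally have "schwarzian d y + (d y)\<^sup>2 * triangle_R \<alpha> \<beta> \<gamma> y = 0 \<longleftrightarrow> u * w - 3/2 * (v * v) + (u * u) * (u * u) * r = 0"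
    using u by simp
  also have "\<dots> \<longleftrightarrow> u * w = 3/2 * (v * v) - (u * u) * (u * u) * r"
    by (metis (no_types, lifting) add_diff_eq diff_add_eq eq_iff_diff_eq_0 diff_diff_eq2)
  finally show ?thesis using False
    by (simp only: schwarzian_solutions_def mem_Collect_eq u_def v_def w_def r_def simp_thms)
qed (simp add: schwarzian_solutions_def)

text \<open>
  The equation multiplied by \<open>y\<^sup>2 (y - 1)\<^sup>2\<close> and by \<open>(y')\<^sup>2\<close>, with \<open>A, B, C\<close> the inverse squares of
  \<open>\<alpha>, \<beta>, \<gamma>\<close>.
\<close>

definition schwarzian_dpol :: "'u::field_char_0 \<Rightarrow> 'u \<Rightarrow> 'u \<Rightarrow> (nat, 'u) mpol" where
  "schwarzian_dpol A B C =
     mX 0 ^ 2 * (mX 0 + mC (-1)) ^ 2 * (mX 1 * mX 3 + mC (-3/2) * mX 2 ^ 2) +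
     mX 1 ^ 4 * (mC ((1 - B) / 2) * (mX 0 + mC (-1)) ^ 2 + mC ((1 - C) / 2) * mX 0 ^ 2 +
       mC ((B + C - A - 1) / 2) * (mX 0 * (mX 0 + mC (-1))))"

lemma schwarzian_dpol_over:
  assumes K: "is_subfield K" and "A \<in> K" "B \<in> K" "C \<in> K"
  shows "schwarzian_dpol A B C \<in> mp_over K 4"
  unfolding schwarzian_dpol_def
  by (intro mp_over_add mp_over_mult mp_over_power mp_over_mX mp_over_mC sf_intros assms) simp_all

lemma ev_schwarzian_dpol:
  "ev e (schwarzian_dpol A B C) =
     e 0 ^ 2 * (e 0 - 1) ^ 2 * (e 1 * e 3 - 3/2 * e 2 ^ 2) +
     e 1 ^ 4 * ((1 - B) / 2 * (e 0 - 1) ^ 2 + (1 - C) / 2 * e 0 ^ 2 + (B + C - A - 1) / 2 * (e 0 * (e 0 - 1)))"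
  by (simp add: schwarzian_dpol_def ev_simps)

lemma schwarzian_dpol_order:
  fixes A B C :: "'u::field_char_0"
  shows "dpol_order (schwarzian_dpol A B C) = 3"
proof -
  have "3 \<in> mpol_vars (schwarzian_dpol A B C)"
  proof (rule ccontr)
    assume a: "3 \<notin> mpol_vars (schwarzian_dpol A B C)"
    define e :: "'u \<Rightarrow> nat \<Rightarrow> 'u" where "e t = ((\<lambda>_. 0)(0 := 2, 1 := 1, 3 := t))" for t
    have "ev (e 1) (schwarzian_dpol A B C) = ev (e 0) (schwarzian_dpol A B C)"
      by (rule mpol_eval_cong) (use a in \<open>auto simp: e_def\<close>)
    then show False by (simp add: ev_schwarzian_dpol e_def)
  qed
  moreover have "schwarzian_dpol A B C \<in> mp_over UNIV (Suc 3)" using schwarzian_dpol_over[of UNIV] by simp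
  ultimately show ?thesis using dpol_order_eq[of _ UNIV 3] by simp
qed

lemma schwarzian_solutions_dpol:
  fixes d :: "'u::field_char_0 \<Rightarrow> 'u"
  assumes d: "derivation d"
  shows "y \<in> schwarzian_solutions d \<alpha> \<beta> \<gamma> \<longleftrightarrow> d y \<noteq> 0 \<and>
    dpol_eval d (schwarzian_dpol ((inverse \<alpha>)\<^sup>2) ((inverse \<beta>)\<^sup>2) ((inverse \<gamma>)\<^sup>2)) y = 0"
proof (cases "d y = 0")
  case False
  define A B C where "A = (inverse \<alpha>)\<^sup>2" and "B = (inverse \<beta>)\<^sup>2" and "C = (inverse \<gamma>)\<^sup>2"
  define u v w where "u = d y" and "v = d u" and "w = d v"
  have y: "y \<noteq> 0" "y - 1 \<noteq> 0"
    using False derivation_zero[OF d] derivation_one[OF d] by auto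
  define M where "M = y ^ 2 * (y - 1) ^ 2"
  define S where "S = (1 - B) / 2 * (y - 1) ^ 2 + (1 - C) / 2 * y ^ 2 + (B + C - A - 1) / 2 * (y * (y - 1))"
  have M: "M \<noteq> 0" using y by (simp add: M_def)
  have "1 / 2 * ((1 - B) / y\<^sup>2 + (1 - C) / z\<^sup>2 + E / (y * z)) =
      ((1 - B) / 2 * z\<^sup>2 + (1 - C) / 2 * y\<^sup>2 + E / 2 * (y * z)) / (y\<^sup>2 * z\<^sup>2)" if "z \<noteq> 0" for z E
    using y(1) that by (simp add: field_simps power2_eq_square)
  from this[OF y(2)] have "fuchs_R A B C y = S / M"
    unfolding fuchs_R_def S_def M_def .
  then have R: "M * fuchs_R A B C y = S" using M by simp
  have "dpol_eval d (schwarzian_dpol A B C) y = M * (u * w - 3/2 * v ^ 2) + u ^ 4 * S"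
    by (simp add: ev_dpol ev_schwarzian_dpol M_def S_def u_def v_def w_def numeral_2_eq_2 numeral_3_eq_3)
  also have "\<dots> = M * (u * w - (3/2 * (v * v) - (u * u) * (u * u) * fuchs_R A B C y))"
    unfolding R[symmetric] by (simp add: algebra_simps power2_eq_square power4_eq_xxxx)
  finally have "dpol_eval d (schwarzian_dpol A B C) y = 0 \<longleftrightarrow> u * w = 3/2 * (v * v) - (u * u) * (u * u) * fuchs_R A B C y"
    using M by simp
  then show ?thesis
    unfolding schwarzian_solutions_iff[OF d] by (simp only: A_def B_def C_def u_def v_def w_def)
qed (simp add: schwarzian_solutions_def)

lemma schwarzian_def_pred:
  fixes d :: "'u::field_char_0 \<Rightarrow> 'u"
  assumes d: "derivation d" and K: "is_subfield K" "inverse \<alpha> \<in> K" "inverse \<beta> \<in> K" "inverse \<gamma> \<in> K"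
  shows "def_pred d K (\<lambda>y. y \<in> schwarzian_solutions d \<alpha> \<beta> \<gamma>)"
proof -
  have "schwarzian_dpol ((inverse \<alpha>)\<^sup>2) ((inverse \<beta>)\<^sup>2) ((inverse \<gamma>)\<^sup>2) \<in> mp_over K 4"
    by (intro schwarzian_dpol_over sf_power K)
  then show ?thesis unfolding schwarzian_solutions_dpol[OF d]
    by (intro def_pred_conj def_pred_not def_pred_eq_0 term_fun_dpol term_fun_der term_fun_id)
      (simp add: mp_over_def)
qed

text \<open>
  Given finitely many solutions, Blum's axiom yields another one: the equation has order three, and
  avoiding the given solutions and the constants is an inequation of order one.
\<close>

lemma infinite_schwarzian_solutions:
  fixes d :: "'u::field_char_0 \<Rightarrow> 'u"
  assumes dc: "differentially_closed d"
  shows "infinite (schwarzian_solutions d \<alpha> \<beta> \<gamma>)"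
proof
  assume fin: "finite (schwarzian_solutions d \<alpha> \<beta> \<gamma>)" (is "finite ?X")
  have d: "derivation d" using dc by (simp add: differentially_closed_def)
  let ?f = "schwarzian_dpol ((inverse \<alpha>)\<^sup>2) ((inverse \<beta>)\<^sup>2) ((inverse \<gamma>)\<^sup>2)"
  let ?N = "insert (mX 1) ((\<lambda>a. mX 0 + mC (- a)) ` ?X) :: (nat, 'u) mpol set"
  have N: "g \<in> mp_over UNIV 2 \<and> g \<noteq> 0" if gN: "g \<in> ?N" for g
  proof
    show "g \<in> mp_over UNIV 2"
      using gN by (auto intro!: mp_over_add[OF is_subfield_UNIV] mp_over_mX[OF is_subfield_UNIV] mp_over_mC[OF is_subfield_UNIV])
    have "\<exists>e. ev e g = 1"
    proof (cases "g = mX 1")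
      case True
      then show ?thesis by (intro exI[of _ "\<lambda>_. 1"]) (simp add: ev_simps)
    next
      case False
      then obtain a where "g = mX 0 + mC (- a)" using gN by blast
      then show ?thesis by (intro exI[of _ "\<lambda>_. a + 1"]) (simp add: ev_simps)
    qed
    then show "g \<noteq> 0" by (auto simp: ev_simps)
  qed
  have "finite ?N" using fin by simp
  from blum_finite[OF dc is_subfield_UNIV _ this N, of ?f] obtain a where
    a: "dpol_eval d ?f a = 0" "\<forall>g\<in>?N. dpol_eval d g a \<noteq> 0" by (auto simp: schwarzian_dpol_order)
  have "d a \<noteq> 0" using a(2) by (simp add: ev_dpol ev_simps)
  then have aX: "a \<in> ?X" using a(1) schwarzian_solutions_dpol[OF d] by blast
  then have "mX 0 + mC (- a) \<in> ?N" by blast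
  then have "dpol_eval d (mX 0 + mC (- a)) a \<noteq> 0" using a(2) by blast
  then show False by (simp add: ev_dpol ev_simps)
qed

lemma alg_closed_differentially_closed:
  fixes d :: "'u::field_char_0 \<Rightarrow> 'u"
  assumes dc: "differentially_closed d"
  shows "alg_closed_type TYPE('u)"
  unfolding alg_closed_type_def
proof (intro allI impI)
  fix p :: "'u poly" assume p: "degree p > 0"
  let ?f = "as_mpol (degree p) 0 (\<lambda>j. mC (coeff p j)) :: (nat, 'u) mpol"
  have e: "ev e ?f = poly p (e 0)" for e by (simp add: ev_as_mpol ev_simps poly_altdef)
  have f: "?f \<in> mp_over UNIV (Suc 0)"
    by (intro as_mpol_over[OF is_subfield_UNIV] mp_over_mC[OF is_subfield_UNIV]) simp
  have "0 \<in> mpol_vars ?f"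
  proof (rule ccontr)
    assume a: "0 \<notin> mpol_vars ?f"
    have "poly p t = poly p 0" for t
    proof -
      have "ev ((\<lambda>_. 0)(0 := t)) ?f = ev (\<lambda>_. 0) ?f" by (rule mpol_eval_cong) (use a in auto)
      then show ?thesis by (simp add: e)
    qed
    then have "poly (p - [:poly p 0:]) t = 0" for t by simp
    then have "p - [:poly p 0:] = 0" using poly_all_0_iff_0 by blast
    then have "p = [:poly p 0:]" by simp
    then show False using p by (metis degree_pCons_0 less_irrefl)
  qed
  from blum_finite[OF dc is_subfield_UNIV, of 0 ?f "{}"] dpol_order_eq[OF f this]
  obtain a where "dpol_eval d ?f a = 0" by auto
  then show "\<exists>x. poly p x = 0" using e by (auto simp: ev_dpol)
qed

section \<open>Arithmetic of the parameters\<close>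

lemma hom_of_rat: "hom_on UNIV (of_rat :: rat \<Rightarrow> 'a::field_char_0)"
  by (simp add: hom_on_def of_rat_add of_rat_mult)

text \<open>
  Multiplied by \<open>\<alpha> \<beta> \<gamma>\<close>, a linear relation becomes a polynomial one; the coefficients of that polynomial
  are recovered from its values at points with coordinates \<open>0\<close> and \<open>1\<close>.
\<close>

lemma alg_indep_reciprocals:
  fixes \<alpha> \<beta> \<gamma> :: "'a::field_char_0" and i j k l :: int
  assumes ind: "alg_indep_over_rat [\<alpha>, \<beta>, \<gamma>]"
    and rel: "of_int i + of_int j * inverse \<alpha> + of_int k * inverse \<beta> + of_int l * inverse \<gamma> = 0"
  shows "i = 0 \<and> j = 0 \<and> k = 0 \<and> l = 0"
proof -
  let ?xs = "\<lambda>n. [\<alpha>, \<beta>, \<gamma>] ! n"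
  note e = mpol_eval_simps[OF hom_of_rat, of ?xs]
  have zero: "p = 0" if "p \<in> mp_over UNIV 3" "mpol_eval of_rat ?xs p = 0" for p :: "(nat, rat) mpol"
  proof -
    have "mpol_vars p \<subseteq> {..<length [\<alpha>, \<beta>, \<gamma>]}" using that(1) by (simp add: mp_over_def numeral_3_eq_3)
    then show ?thesis using ind that(2) unfolding alg_indep_over_rat_def by blast
  qed
  have X: "mX n \<in> mp_over UNIV 3" if "n < 3" for n :: nat
    using that by (rule mp_over_mX[OF is_subfield_UNIV])
  have nz: "?xs n \<noteq> 0" if "n < 3" for n
  proof
    assume "?xs n = 0"
    then have "mX n = (0 :: (nat, rat) mpol)" using zero[OF X[OF that]] by (simp add: e(6))
    then have "ev (\<lambda>_. 1) (mX n :: (nat, rat) mpol) = ev (\<lambda>_. 1) 0" by simp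
    then show False by (simp only: ev_simps)
  qed
  have nz: "\<alpha> \<noteq> 0" "\<beta> \<noteq> 0" "\<gamma> \<noteq> 0" using nz[of 0] nz[of 1] nz[of 2] by simp_all
  define ri rj rk rl where "ri = rat_of_int i" and "rj = rat_of_int j" and "rk = rat_of_int k" and "rl = rat_of_int l"
  have r: "of_rat ri = (of_int i :: 'a)" "of_rat rj = (of_int j :: 'a)" "of_rat rk = (of_int k :: 'a)" "of_rat rl = (of_int l :: 'a)"
    by (simp_all add: ri_def rj_def rk_def rl_def)
  define p :: "(nat, rat) mpol" where
    "p = mC ri * (mX 0 * (mX 1 * mX 2)) + mC rj * (mX 1 * mX 2) + mC rk * (mX 0 * mX 2) + mC rl * (mX 0 * mX 1)"
  have "p \<in> mp_over UNIV 3" unfolding p_def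
    by (intro mp_over_add mp_over_mult mp_over_mC X is_subfield_UNIV) simp_all
  moreover have "mpol_eval of_rat ?xs p =
      (\<alpha> * (\<beta> * \<gamma>)) * (of_int i + of_int j * inverse \<alpha> + of_int k * inverse \<beta> + of_int l * inverse \<gamma>)"
    using nz by (simp add: p_def e r field_simps)
  ultimately have "p = 0" using zero rel by simp
  then have "ev x p = 0" for x by (simp add: ev_simps)
  then have *: "ri * (x 0 * (x 1 * x 2)) + rj * (x 1 * x 2) + rk * (x 0 * x 2) + rl * (x 0 * x 1) = 0"
    for x :: "nat \<Rightarrow> rat" by (simp add: p_def ev_simps)
  have "ri = 0 \<and> rj = 0 \<and> rk = 0 \<and> rl = 0"
    using *[of "\<lambda>n. if n = 0 then 0 else 1"] *[of "\<lambda>n. if n = 1 then 0 else 1"] *[of "\<lambda>n. if n = 2 then 0 else 1"]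
      *[of "\<lambda>n. 1"] by simp
  then show ?thesis by (simp add: ri_def rj_def rk_def rl_def)
qed

section \<open>Strong minimality\<close>

lemma finite_tm_params: "finite (tm_params t)"
  by (induction t) auto

lemma finite_fm_params: "finite (fm_params \<phi>)"
  by (induction \<phi>) (auto simp: finite_tm_params)

text \<open>An infinite set is not covered by the roots of finitely many polynomials, so saturation applies.\<close>

lemma generic_element:
  fixes d :: "'u::field_char_0 \<Rightarrow> 'u"
  assumes sat: "saturated d" and unc: "uncountable (UNIV :: 'u set)" and K: "is_subfield K" "countable K"
    and S: "def_pred d K (\<lambda>x. x \<in> S)" "infinite S"
  obtains y where "y \<in> S" "\<not> alg_over K y"
proof -
  let ?N = "{p \<in> poly_over K. p \<noteq> 0}" and ?P = "\<lambda>p x. poly p x \<noteq> (0 :: 'u)" and ?S = "\<lambda>x. x \<in> S"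
  have "\<exists>x. \<forall>P\<in>insert ?S (?P ` ?N). P x"
  proof (rule saturated_realize[OF sat unc K(2)])
    fix P assume "P \<in> insert ?S (?P ` ?N)"
    moreover have "def_pred d K (?P p)" if "p \<in> poly_over K" for p
    proof (intro def_pred_not def_pred_eq_0)
      show "term_fun d K (\<lambda>x. poly p x)" unfolding poly_altdef
        using that by (intro term_fun_sum term_fun_mult term_fun_const term_fun_power term_fun_id) (simp add: poly_overD)
    qed
    ultimately show "def_pred d K P" using S(1) by auto
  next
    fix F assume F: "finite F" "F \<subseteq> insert ?S (?P ` ?N)"
    then have "F - {?S} \<subseteq> ?P ` ?N" by blast
    from finite_subset_image[OF _ this] F(1) obtain N where N: "N \<subseteq> ?N" "finite N" "F - {?S} = ?P ` N" by blast
    have "finite (\<Union>p\<in>N. {x. poly p x = 0})"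
    proof (rule finite_UN_I[OF N(2)])
      fix p assume "p \<in> N"
      then show "finite {x. poly p x = 0}" using N(1) by (intro poly_roots_finite) auto
    qed
    then have "infinite (S - (\<Union>p\<in>N. {x. poly p x = 0}))" by (rule Diff_infinite_finite[OF _ S(2)])
    then obtain x where x: "x \<in> S" "x \<notin> (\<Union>p\<in>N. {x. poly p x = 0})" using infinite_imp_nonempty by blast
    have "P x" if P: "P \<in> F" for P
    proof (cases "P = ?S")
      case False
      then have "P \<in> ?P ` N" using N(3) P by blast
      then show ?thesis using x(2) by auto
    qed (use x in simp)
    then show "\<exists>x. \<forall>P\<in>F. P x" by blast
  qed
  then obtain y where y: "\<forall>P\<in>insert ?S (?P ` ?N). P y" ..
  have "poly p y \<noteq> 0" if "p \<in> poly_over K" "p \<noteq> 0" for p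
    using bspec[OF y, of "?P p"] that by auto
  then have "\<not> alg_over K y" by (auto simp: alg_over_def)
  moreover have "y \<in> S" using bspec[OF y, of ?S] by simp
  ultimately show ?thesis using that by blast
qed

theorem proposition4p1:
  fixes d :: "'u::field_char_0 \<Rightarrow> 'u"
    and \<iota> :: "complex \<Rightarrow> 'u"
    and \<alpha> \<beta> \<gamma> :: complex
  assumes "differentially_closed d"
    and "saturated d"
    and "constants_iso_complex d \<iota>"
    and "alg_indep_over_rat [\<alpha>, \<beta>, \<gamma>]"
  shows "strongly_minimal d (schwarzian_solutions d (\<iota> \<alpha>) (\<iota> \<beta>) (\<iota> \<gamma>))"
proof -
  note dc = assms(1) and sat = assms(2)
  have d: "derivation d" using dc by (simp add: differentially_closed_def)
  have \<iota>: "hom_on UNIV \<iota>" and bij: "bij_betw \<iota> UNIV (constants d)"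
    using assms(3) by (auto simp: constants_iso_complex_def hom_on_def)
  have unc: "uncountable (UNIV :: 'u set)"
  proof
    assume "countable (UNIV :: 'u set)"
    then have "countable (range \<iota>)" by (rule countable_subset[OF subset_UNIV])
    then show False
      using countable_image_inj_on[of \<iota> UNIV] hom_inj[OF is_subfield_UNIV \<iota>] uncountable_UNIV_complex by blast
  qed
  let ?X = "schwarzian_solutions d (\<iota> \<alpha>) (\<iota> \<beta>) (\<iota> \<gamma>)"
  define pa pb pc where "pa = inverse (\<iota> \<alpha>)" and "pb = inverse (\<iota> \<beta>)" and "pc = inverse (\<iota> \<gamma>)"
  have \<iota>int: "\<iota> (of_int i) = of_int i" for i
    by (cases i rule: int_cases2) (simp_all add: hom_of_nat[OF is_subfield_UNIV \<iota>] hom_minus[OF is_subfield_UNIV \<iota>])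
  have indep: "i = 0 \<and> j = 0 \<and> k = 0 \<and> l = 0"
    if "of_int i + of_int j * pa + of_int k * pb + of_int l * pc = 0" for i j k l
  proof -
    have "\<iota> (of_int i + of_int j * inverse \<alpha> + of_int k * inverse \<beta> + of_int l * inverse \<gamma>) = 0"
      using that by (simp add: hom_add[OF \<iota>] hom_mult[OF \<iota>] hom_inverse[OF is_subfield_UNIV \<iota>] \<iota>int pa_def pb_def pc_def)
    then show ?thesis
      using hom_eq_0_iff[OF is_subfield_UNIV \<iota>] alg_indep_reciprocals[OF assms(4)] by blast
  qed
  have "definable d ?X"
    using schwarzian_def_pred[OF d is_subfield_UNIV, of "\<iota> \<alpha>" "\<iota> \<beta>" "\<iota> \<gamma>"]
    unfolding definable_def def_pred_def by auto
  moreover have "infinite ?X" by (rule infinite_schwarzian_solutions[OF dc])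
  moreover have "finite Y \<or> finite (?X - Y)" if YX: "Y \<subseteq> ?X" and Y: "definable d Y" for Y
  proof (rule ccontr)
    assume "\<not> ?thesis"
    then have inf: "infinite Y" "infinite (?X - Y)" by auto
    from Y obtain \<phi> where \<phi>: "\<phi> \<in> unary_fms UNIV" "Y = {x. fm_holds d \<phi> x}" unfolding definable_def by blast
    have "countable (fm_params \<phi> \<union> {pa, pb, pc})" using finite_fm_params[of \<phi>] by (simp add: countable_finite)
    from countable_differential_subfield[OF this, of d] obtain K where
      K: "is_subfield K" "countable K" "fm_params \<phi> \<union> {pa, pb, pc} \<subseteq> K" and dK: "\<And>x. x \<in> K \<Longrightarrow> d x \<in> K"
      by metis
    have \<phi>K: "\<phi> \<in> unary_fms K" using \<phi>(1) K(3) by (auto simp: unary_fms_def)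
    have par: "pa \<in> K" "pb \<in> K" "pc \<in> K" using K(3) by auto
    have defY: "def_pred d K (\<lambda>x. x \<in> Y)" unfolding def_pred_def \<phi>(2) using \<phi>K by auto
    have defX: "def_pred d K (\<lambda>x. x \<in> ?X)"
      using schwarzian_def_pred[OF d K(1), of "\<iota> \<alpha>" "\<iota> \<beta>" "\<iota> \<gamma>"] par by (simp add: pa_def pb_def pc_def)
    have "def_pred d K (\<lambda>x. x \<in> ?X - Y)"
      using def_pred_conj[OF defX def_pred_not[OF defY]] by simp
    with inf(2) obtain y2 where y2: "y2 \<in> ?X - Y" "\<not> alg_over K y2" using generic_element[OF sat unc K(1,2)] by metis
    obtain y1 where y1: "y1 \<in> Y" "\<not> alg_over K y1" using generic_element[OF sat unc K(1,2) defY inf(1)] by metis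
    let ?R = "fuchs_R (pa\<^sup>2) (pb\<^sup>2) (pc\<^sup>2)"
    define jet where "jet y n = (d ^^ n) y" for y and n :: nat
    have jet: "jet y 0 = y" "d (jet y n) = jet y (Suc n)" for y n by (simp_all add: jet_def)
    have sol: "jet y 1 \<noteq> 0 \<and> jet y 1 * jet y 3 = 3/2 * (jet y 2 * jet y 2) - (jet y 1 * jet y 1) * (jet y 1 * jet y 1) * ?R y"
      if "y \<in> ?X" for y
      using that unfolding schwarzian_solutions_iff[OF d] by (simp add: jet_def pa_def pb_def pc_def numeral_2_eq_2 numeral_3_eq_3)
    \<comment> \<open>Solutions outside the algebraic closure of \<open>K\<close> have independent derivatives of order below three.\<close>
    have trans: "\<not> alg_over (tower K (jet y) i) (jet y i)" if yX: "y \<in> ?X" "\<not> alg_over K y" and i: "i < 3" for y i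
    proof -
      interpret triangle_setting d K y pa pb pc
        by unfold_locales (use alg_closed_differentially_closed[OF dc] K(1) d dK par yX(2) indep in auto)
      have o: "jet y 1 = d y" "jet y 2 = d (jet y 1)" "jet y 3 = d (jet y 2)"
        by (simp_all add: jet_def numeral_2_eq_2 numeral_3_eq_3)
      have ode2: "jet y 1 * d (jet y 2) = 3/2 * (jet y 2 * jet y 2) - (jet y 1 * jet y 1) * (jet y 1 * jet y 1) * ?R y"
        using sol[OF yX(1)] by (simp only: o(3))
      then have ode: "jet y 1 * d (d (jet y 1)) = 3/2 * (d (jet y 1) * d (jet y 1)) - (jet y 1 * jet y 1) * (jet y 1 * jet y 1) * ?R y"
        by (simp only: o(2))
      have 1: "\<not> alg_over Ky (jet y 1)"
      proof
        assume "alg_over Ky (jet y 1)"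
        then show False
          using no_order1[OF o(1)[symmetric] _ _ ode] sol[OF yX(1)] by blast
      qed
      have 2: "\<not> alg_over (adjoin Ky (jet y 1)) (jet y 2)"
        using no_order2[OF o(1)[symmetric] 1 o(2)[symmetric] _ ode2] by blast
      consider "i = 0" | "i = 1" | "i = 2" using i by linarith
      then show ?thesis using yX(2) 1 2 by cases (simp_all add: jet numeral_2_eq_2)
    qed
    have X12: "y1 \<in> ?X" "y2 \<in> ?X" using y1 y2 YX by auto
    have id: "hom_on K (\<lambda>x. x)" by (simp add: hom_on_def)
    \<comment> \<open>Hence mapping one such solution to another is an isomorphism over \<open>K\<close>, and it preserves \<open>\<phi>\<close>.\<close>
    obtain \<tau> where \<tau>: "tower_hom K (\<lambda>x. x) (jet y1) (jet y2) 3 \<tau>"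
      using tower_homs_exist[OF K(1) id, of 3 "jet y1" "jet y2"] trans X12 y1(2) y2(2) by auto
    let ?F = "tower K (jet y1) 3"
    have F: "is_subfield ?F" by (rule is_subfield_tower[OF K(1)])
    have KF: "x \<in> ?F" if "x \<in> K" for x by (rule tower_base[OF K(1) that])
    have gF: "jet y1 i \<in> ?F" if "i < 3" for i by (rule tower_gen[OF K(1) that])
    have \<tau>h: "hom_on ?F \<tau>" "\<And>x. x \<in> K \<Longrightarrow> \<tau> x = x" "\<And>i. i < 3 \<Longrightarrow> \<tau> (jet y1 i) = jet y2 i"
      using \<tau> by (auto simp: tower_hom_def)
    have third: "jet y 3 = (3/2 * (jet y 2 * jet y 2) - (jet y 1 * jet y 1) * (jet y 1 * jet y 1) * ?R y) / jet y 1"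
      if "y \<in> ?X" for y using sol[OF that] by (simp add: field_simps)
    have y1F: "y1 \<in> ?F" using gF[of 0] by (simp add: jet)
    have par2: "pa\<^sup>2 \<in> K" "pb\<^sup>2 \<in> K" "pc\<^sup>2 \<in> K" using par by (auto intro: sf_power[OF K(1)])
    note RF = hom_fuchs_R[OF F \<tau>h(1) KF[OF par2(1)] KF[OF par2(2)] KF[OF par2(3)] y1F]
    have \<tau>y: "\<tau> y1 = y2" using \<tau>h(3)[of 0] by (simp add: jet)
    have \<tau>R: "\<tau> (?R y1) = ?R y2" using RF(1) \<tau>h(2) par2 \<tau>y by simp
    have g3F: "jet y1 3 \<in> ?F"
      unfolding third[OF X12(1)] using gF[of 1] gF[of 2] RF(2) by (intro sf_intros F) auto
    have \<tau>3: "\<tau> (jet y1 3) = jet y2 3"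
      unfolding third[OF X12(1)] third[OF X12(2)] using gF[of 1] gF[of 2] RF(2) \<tau>R \<tau>h(3)[of 1] \<tau>h(3)[of 2]
      by (simp add: hom_divide[OF F \<tau>h(1)] hom_diff[OF F \<tau>h(1)] hom_mult[OF \<tau>h(1)] hom_numeral[OF F \<tau>h(1)] sf_mult[OF F]
          sf_diff[OF F] sf_divide[OF F] sf_numeral[OF F])
    have dF: "d z \<in> ?F" if "z \<in> ?F" for z
    proof -
      have jl: "jet y1 = (\<lambda>i. (d ^^ i) y1)" by (simp add: jet_def fun_eq_iff)
      have F3: "?F = adjoin (tower K (jet y1) 2) (jet y1 2)" by (simp add: numeral_3_eq_3 numeral_2_eq_2)
      have "d w \<in> ?F" if "w \<in> tower K (jet y1) 2" for w
        using derivation_tower[OF d K(1) dK, of w y1 2] that unfolding jl[symmetric] by (simp add: numeral_3_eq_3 numeral_2_eq_2)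
      moreover have "tower K (jet y1) 2 \<subseteq> ?F" by (rule tower_mono[OF K(1)]) simp
      ultimately show ?thesis
        using derivation_adjoin[OF d F, of "tower K (jet y1) 2" "jet y1 2" z] gF[of 2] g3F that F3
        by (simp add: jet(2) numeral_3_eq_3 numeral_2_eq_2)
    qed
    have comm: "\<tau> (d z) = d (\<tau> z)" if "z \<in> ?F" for z
    proof (rule tower_commutes[OF d K(1) F \<tau>h(1) dF, of 3 "jet y1" 3])
      show "\<tau> (d z) = d (\<tau> z)" if "z \<in> K" for z using \<tau>h(2) dK that by simp
      show "alg_over (tower K (jet y1) i) (jet y1 i) \<or> \<tau> (d (jet y1 i)) = d (\<tau> (jet y1 i))" if "i < 3" for i
        using \<tau>h(3)[of "Suc i"] \<tau>h(3)[OF that] \<tau>3 that by (cases "i = 2") (auto simp: jet(2) numeral_3_eq_3)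
    qed (use that in auto)
    have iso: "diff_iso d ?F \<tau>"
      unfolding diff_iso_def using F countable_tower[OF K(2)] dF \<tau>h(1) comm by blast
    have "fm_sat d (\<lambda>_. y1) \<phi> \<longleftrightarrow> fm_sat d (\<lambda>_. \<tau> y1) (map_fm \<tau> \<phi>)"
      by (rule fm_sat_iso[OF dc sat unc iso]) (use y1F K(3) KF in auto)
    also have "map_fm \<tau> \<phi> = map_fm id \<phi>"
      by (rule fm.map_cong[OF refl]) (use K(3) \<tau>h(2) in auto)
    finally have "fm_holds d \<phi> y1 \<longleftrightarrow> fm_holds d \<phi> y2" by (simp add: fm_holds_def \<tau>y fm.map_id)
    then show False using y1(1) y2(1) \<phi>(2) by auto
  qed
  ultimately show ?thesis unfolding strongly_minimal_def by blast
qed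

end
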